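(* Let $\mathbb{F}$ be a subfield of the real numbers, let $n$ be a natural number, and suppose that $(V,V^+)$ is an ordered directed $n$-dimensional vector space over $\mathbb{F}$ with Riesz interpolation. Then there exists an inductive system (indexed by the positive integers) \[ (\mathbb{F}^n, \mathbb{F}_{\geq 0}^n) \xrightarrow{\phi_1^2} (\mathbb{F}^n, \mathbb{F}_{\geq 0}^n) \xrightarrow{\phi_2^3} \cdots \] of ordered vector spaces over $\mathbb{F}$ whose inductive limit is $(V,V^+)$.
   Context: Here $\mathbb{F}_{\geq 0} := \mathbb{F}\cap[0,\infty)$, so the order on $(\mathbb{F}^n,\mathbb{F}_{\ge 0}^n)$ is coordinatewise comparison. An ordered vector space over $\mathbb{F}$ is a vector space $V$ with a subset $V^+\subseteq V$ (the positive cone) such that $V^+\cap(-V^+)=\{0\}$, $V^++V^+\subseteq V^+$, and $\lambda V^+\subseteq V^+$ for all $\lambda\in\mathbb{F}_{\ge 0}$. The order is $x\le y$ iff $y-x\in V^+$. It is directed if for all $x,y\in V$ there is $z\in V$ with $x\le z$ and $y\le z$. It has Riesz interpolation if whenever $a_1,a_2,c_1,c_2\in V$ satisfy $a_i\le c_j$ for all $i,j\in\{1,2\}$, there is $b\in V$ with $a_i\le b\le c_j$ for all $i,j\in\{1,2\}$. In the category of ordered vector spaces over $\mathbb{F}$, the arrows are the linear maps that send the positive cone of the domain into the positive cone of the codomain (positivity-preserving linear maps); in particular the connecting maps of an inductive system of ordered vector spaces are of this kind. The inductive limit of a system $((V_\alpha,V_\alpha^+)_{\alpha\in A},(\phi_\alpha^\beta)_{\alpha\le\beta})$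 is $(V,V^+)$, where $V$ is the inductive limit in the category of vector spaces, with canonical maps $\phi_\alpha^\infty:V_\alpha\to V$, and $V^+=\bigcup_{\alpha\in A}\phi_\alpha^\infty(V_\alpha^+)$. The inductive limit in the theorem may be taken either in this category or in the category of ordered abelian groups with positivity-preserving homomorphisms. "Is" is understood up to isomorphism of ordered vector spaces. *)

theory Defs
  imports "HOL-Algebra.Subrings" "Jordan_Normal_Form.VS_Connect"
begin

section \<open>Ordered vector spaces over a subfield of the reals\<close>

text \<open>A subfield \<open>F\<close> of the reals is a set of reals with \<^term>\<open>subfield F class_ring\<close>, where
  \<^term>\<open>class_ring :: real ring\<close> is the field of all reals. The locale \<^locale>\<open>vectorspace\<close> takes the
  scalar field as a record.\<close>

abbreviation scalars :: "real set \<Rightarrow> real ring"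
  where "scalars F \<equiv> class_ring\<lparr>carrier := F\<rparr>"

locale ordered_vectorspace = vectorspace "scalars F" V
  for F :: "real set" and V :: "(real, 'v, 'm) module_scheme" (structure) +
  fixes P :: "'v set"
  assumes cone_subset: "P \<subseteq> carrier V"
    and cone_pointed: "P \<inter> {\<ominus>x | x. x \<in> P} = {\<zero>}"
    and cone_add: "\<lbrakk>x \<in> P; y \<in> P\<rbrakk> \<Longrightarrow> x \<oplus> y \<in> P"
    and cone_smult: "\<lbrakk>c \<in> F \<inter> {0..}; x \<in> P\<rbrakk> \<Longrightarrow> c \<odot> x \<in> P"

definition cone_le :: "(real, 'v, 'm) module_scheme \<Rightarrow> 'v set \<Rightarrow> 'v \<Rightarrow> 'v \<Rightarrow> bool"
  where "cone_le V P x y \<longleftrightarrow> y \<ominus>\<^bsub>V\<^esub> x \<in> P"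

definition directed_order :: "(real, 'v, 'm) module_scheme \<Rightarrow> 'v set \<Rightarrow> bool"
  where "directed_order V P \<longleftrightarrow>
    (\<forall>x\<in>carrier V. \<forall>y\<in>carrier V. \<exists>z\<in>carrier V. cone_le V P x z \<and> cone_le V P y z)"

definition riesz_interpolation :: "(real, 'v, 'm) module_scheme \<Rightarrow> 'v set \<Rightarrow> bool"
  where "riesz_interpolation V P \<longleftrightarrow>
    (\<forall>a1\<in>carrier V. \<forall>a2\<in>carrier V. \<forall>c1\<in>carrier V. \<forall>c2\<in>carrier V.
      (\<forall>a\<in>{a1, a2}. \<forall>c\<in>{c1, c2}. cone_le V P a c) \<longrightarrow>
      (\<exists>b\<in>carrier V. \<forall>a\<in>{a1, a2}. \<forall>c\<in>{c1, c2}. cone_le V P a b \<and> cone_le V P b c))"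

locale positive_linear_map =
  V?: ordered_vectorspace F V P + W?: ordered_vectorspace F W Q + linear_map "scalars F" V W f
  for F V P W Q f +
  assumes positive: "x \<in> P \<Longrightarrow> f x \<in> Q"

definition ordered_vs_iso ::
  "real set \<Rightarrow> (real, 'v, 'm) module_scheme \<Rightarrow> 'v set \<Rightarrow>
   (real, 'w, 'k) module_scheme \<Rightarrow> 'w set \<Rightarrow> ('v \<Rightarrow> 'w) \<Rightarrow> bool"
  where "ordered_vs_iso F V P W Q f \<longleftrightarrow>
    linear_map (scalars F) V W f \<and> bij_betw f (carrier V) (carrier W) \<and> f ` P = Q"

section \<open>Coordinate spaces\<close>

definition coord_space :: "real set \<Rightarrow> nat \<Rightarrow> (real, real vec) module"
  where "coord_space F n =
    module_vec TYPE(real) n\<lparr>carrier := {v \<in> carrier_vec n. \<forall>i<n. v $ i \<in> F}\<rparr>"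

definition coord_cone :: "real set \<Rightarrow> nat \<Rightarrow> real vec set"
  where "coord_cone F n = {v \<in> carrier_vec n. \<forall>i<n. v $ i \<in> F \<inter> {0..}}"

section \<open>Inductive systems and inductive limits\<close>

locale inductive_system =
  fixes F :: "real set" and A :: "'i::preorder set"
    and V :: "'i \<Rightarrow> (real, 'v) module" and P :: "'i \<Rightarrow> 'v set"
    and \<phi> :: "'i \<Rightarrow> 'i \<Rightarrow> 'v \<Rightarrow> 'v"
  assumes index_nonempty: "A \<noteq> {}"
    and index_directed: "\<lbrakk>\<alpha> \<in> A; \<beta> \<in> A\<rbrakk> \<Longrightarrow> \<exists>\<gamma>\<in>A. \<alpha> \<le> \<gamma> \<and> \<beta> \<le> \<gamma>"
    and space: "\<alpha> \<in> A \<Longrightarrow> ordered_vectorspace F (V \<alpha>) (P \<alpha>)"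
    and connecting: "\<lbrakk>\<alpha> \<in> A; \<beta> \<in> A; \<alpha> \<le> \<beta>\<rbrakk> \<Longrightarrow>
      positive_linear_map F (V \<alpha>) (P \<alpha>) (V \<beta>) (P \<beta>) (\<phi> \<alpha> \<beta>)"
    and connecting_refl: "\<lbrakk>\<alpha> \<in> A; x \<in> carrier (V \<alpha>)\<rbrakk> \<Longrightarrow> \<phi> \<alpha> \<alpha> x = x"
    and connecting_trans:
      "\<lbrakk>\<alpha> \<in> A; \<beta> \<in> A; \<gamma> \<in> A; \<alpha> \<le> \<beta>; \<beta> \<le> \<gamma>; x \<in> carrier (V \<alpha>)\<rbrakk> \<Longrightarrow>
        \<phi> \<beta> \<gamma> (\<phi> \<alpha> \<beta> x) = \<phi> \<alpha> \<gamma> x"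

text \<open>The inductive limit of vector spaces is the disjoint union of the spaces modulo eventual
  equality. Its operations are computed on representatives at a common index; each union below
  ranges over copies of one and the same class (see \<open>limit_add\<close>, \<open>limit_smult\<close> and
  \<open>limit_zero\<close>).\<close>

definition limit_rel ::
  "'i::preorder set \<Rightarrow> ('i \<Rightarrow> (real, 'v) module) \<Rightarrow> ('i \<Rightarrow> 'i \<Rightarrow> 'v \<Rightarrow> 'v) \<Rightarrow>
   (('i \<times> 'v) \<times> ('i \<times> 'v)) set"
  where "limit_rel A V \<phi> = {((\<alpha>, x), (\<beta>, y)).
    \<alpha> \<in> A \<and> \<beta> \<in> A \<and> x \<in> carrier (V \<alpha>) \<and> y \<in> carrier (V \<beta>) \<and>
    (\<exists>\<gamma>\<in>A. \<alpha> \<le> \<gamma> \<and> \<beta> \<le> \<gamma> \<and> \<phi> \<alpha> \<gamma> x = \<phi> \<beta> \<gamma> y)}"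

definition limit_map ::
  "'i::preorder set \<Rightarrow> ('i \<Rightarrow> (real, 'v) module) \<Rightarrow> ('i \<Rightarrow> 'i \<Rightarrow> 'v \<Rightarrow> 'v) \<Rightarrow>
   'i \<Rightarrow> 'v \<Rightarrow> ('i \<times> 'v) set"
  where "limit_map A V \<phi> \<alpha> x = limit_rel A V \<phi> `` {(\<alpha>, x)}"

definition limit_space ::
  "'i::preorder set \<Rightarrow> ('i \<Rightarrow> (real, 'v) module) \<Rightarrow> ('i \<Rightarrow> 'i \<Rightarrow> 'v \<Rightarrow> 'v) \<Rightarrow>
   (real, ('i \<times> 'v) set) module"
  where "limit_space A V \<phi> = \<lparr>
    carrier = (SIGMA \<alpha>:A. carrier (V \<alpha>)) // limit_rel A V \<phi>,
    mult = undefined,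
    one = undefined,
    zero = (\<Union>\<alpha>\<in>A. limit_map A V \<phi> \<alpha> \<zero>\<^bsub>V \<alpha>\<^esub>),
    add = (\<lambda>X Y. \<Union>{limit_map A V \<phi> \<alpha> (x \<oplus>\<^bsub>V \<alpha>\<^esub> y) | \<alpha> x y.
      \<alpha> \<in> A \<and> x \<in> carrier (V \<alpha>) \<and> y \<in> carrier (V \<alpha>) \<and>
      limit_map A V \<phi> \<alpha> x = X \<and> limit_map A V \<phi> \<alpha> y = Y}),
    smult = (\<lambda>c X. \<Union>{limit_map A V \<phi> \<alpha> (c \<odot>\<^bsub>V \<alpha>\<^esub> x) | \<alpha> x.
      \<alpha> \<in> A \<and> x \<in> carrier (V \<alpha>) \<and> limit_map A V \<phi> \<alpha> x = X})\<rparr>"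

definition limit_cone ::
  "'i::preorder set \<Rightarrow> ('i \<Rightarrow> (real, 'v) module) \<Rightarrow> ('i \<Rightarrow> 'v set) \<Rightarrow>
   ('i \<Rightarrow> 'i \<Rightarrow> 'v \<Rightarrow> 'v) \<Rightarrow> ('i \<times> 'v) set set"
  where "limit_cone A V P \<phi> = (\<Union>\<alpha>\<in>A. limit_map A V \<phi> \<alpha> ` P \<alpha>)"

context inductive_system
begin

abbreviation "L \<equiv> limit_space A V \<phi>"
abbreviation "\<iota> \<equiv> limit_map A V \<phi>"

lemma connecting_linear:
  assumes "\<alpha> \<in> A" "\<beta> \<in> A" "\<alpha> \<le> \<beta>"
  shows "linear_map (scalars F) (V \<alpha>) (V \<beta>) (\<phi> \<alpha> \<beta>)"
  using connecting[OF assms] by (rule positive_linear_map.axioms(3))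

lemma space_vs: "\<alpha> \<in> A \<Longrightarrow> vectorspace (scalars F) (V \<alpha>)"
  by (rule ordered_vectorspace.axioms(1)[OF space])

lemma space_module: "\<alpha> \<in> A \<Longrightarrow> module (scalars F) (V \<alpha>)"
  by (rule vectorspace.axioms(1)[OF space_vs])

lemma connecting_hom:
  assumes "\<alpha> \<in> A" "\<beta> \<in> A" "\<alpha> \<le> \<beta>"
  shows "x \<in> carrier (V \<alpha>) \<Longrightarrow> \<phi> \<alpha> \<beta> x \<in> carrier (V \<beta>)"
    and "\<lbrakk>x \<in> carrier (V \<alpha>); y \<in> carrier (V \<alpha>)\<rbrakk> \<Longrightarrow>
      \<phi> \<alpha> \<beta> (x \<oplus>\<^bsub>V \<alpha>\<^esub> y) = \<phi> \<alpha> \<beta> x \<oplus>\<^bsub>V \<beta>\<^esub> \<phi> \<alpha> \<beta> y"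
    and "\<lbrakk>c \<in> F; x \<in> carrier (V \<alpha>)\<rbrakk> \<Longrightarrow>
      \<phi> \<alpha> \<beta> (c \<odot>\<^bsub>V \<alpha>\<^esub> x) = c \<odot>\<^bsub>V \<beta>\<^esub> \<phi> \<alpha> \<beta> x"
    and "\<phi> \<alpha> \<beta> \<zero>\<^bsub>V \<alpha>\<^esub> = \<zero>\<^bsub>V \<beta>\<^esub>"
proof -
  interpret f: linear_map "scalars F" "V \<alpha>" "V \<beta>" "\<phi> \<alpha> \<beta>"
    by (rule connecting_linear[OF assms])
  have h: "\<phi> \<alpha> \<beta> \<in> module_hom (scalars F) (V \<alpha>) (V \<beta>)" by (rule f.f_hom)
  show "x \<in> carrier (V \<alpha>) \<Longrightarrow> \<phi> \<alpha> \<beta> x \<in> carrier (V \<beta>)"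
    and "\<lbrakk>x \<in> carrier (V \<alpha>); y \<in> carrier (V \<alpha>)\<rbrakk> \<Longrightarrow>
      \<phi> \<alpha> \<beta> (x \<oplus>\<^bsub>V \<alpha>\<^esub> y) = \<phi> \<alpha> \<beta> x \<oplus>\<^bsub>V \<beta>\<^esub> \<phi> \<alpha> \<beta> y"
    and "\<lbrakk>c \<in> F; x \<in> carrier (V \<alpha>)\<rbrakk> \<Longrightarrow>
      \<phi> \<alpha> \<beta> (c \<odot>\<^bsub>V \<alpha>\<^esub> x) = c \<odot>\<^bsub>V \<beta>\<^esub> \<phi> \<alpha> \<beta> x"
    using h by (auto simp: module_hom_def)
  show "\<phi> \<alpha> \<beta> \<zero>\<^bsub>V \<alpha>\<^esub> = \<zero>\<^bsub>V \<beta>\<^esub>" by (rule f.f0_is_0)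
qed

lemma equal_later:
  assumes "\<alpha> \<in> A" "\<beta> \<in> A" "\<gamma> \<in> A" "\<delta> \<in> A" "\<alpha> \<le> \<gamma>" "\<beta> \<le> \<gamma>" "\<gamma> \<le> \<delta>"
    "x \<in> carrier (V \<alpha>)" "y \<in> carrier (V \<beta>)" "\<phi> \<alpha> \<gamma> x = \<phi> \<beta> \<gamma> y"
  shows "\<phi> \<alpha> \<delta> x = \<phi> \<beta> \<delta> y"
proof -
  have "\<phi> \<alpha> \<delta> x = \<phi> \<gamma> \<delta> (\<phi> \<alpha> \<gamma> x)"
    by (rule connecting_trans[symmetric]) fact+
  also have "\<dots> = \<phi> \<gamma> \<delta> (\<phi> \<beta> \<gamma> y)"
    by (rule arg_cong[OF assms(10)])
  also have "\<dots> = \<phi> \<beta> \<delta> y"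
    by (rule connecting_trans) fact+
  finally show ?thesis .
qed

lemma equiv_limit_rel: "equiv (SIGMA \<alpha>:A. carrier (V \<alpha>)) (limit_rel A V \<phi>)"
proof (rule equivI)
  show "limit_rel A V \<phi> \<subseteq> (SIGMA \<alpha>:A. carrier (V \<alpha>)) \<times> (SIGMA \<alpha>:A. carrier (V \<alpha>))"
    by (auto simp: limit_rel_def)
  show "refl_on (SIGMA \<alpha>:A. carrier (V \<alpha>)) (limit_rel A V \<phi>)"
    by (auto simp: refl_on_def limit_rel_def)
  show "sym (limit_rel A V \<phi>)"
    unfolding sym_def limit_rel_def by (clarsimp, metis)
  show "trans (limit_rel A V \<phi>)"
  proof (rule transI, clarsimp simp: limit_rel_def)
    fix \<alpha> x \<beta> y \<gamma> z \<delta> \<epsilon>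
    assume *: "\<alpha> \<in> A" "\<beta> \<in> A" "\<gamma> \<in> A" "\<delta> \<in> A" "\<epsilon> \<in> A" "x \<in> carrier (V \<alpha>)"
      "y \<in> carrier (V \<beta>)" "z \<in> carrier (V \<gamma>)" "\<alpha> \<le> \<delta>" "\<beta> \<le> \<delta>" "\<phi> \<alpha> \<delta> x = \<phi> \<beta> \<delta> y"
      "\<beta> \<le> \<epsilon>" "\<gamma> \<le> \<epsilon>" "\<phi> \<beta> \<epsilon> y = \<phi> \<gamma> \<epsilon> z"
    obtain \<zeta> where \<zeta>: "\<zeta> \<in> A" "\<delta> \<le> \<zeta>" "\<epsilon> \<le> \<zeta>"
      using index_directed * by blast
    have "\<phi> \<alpha> \<zeta> x = \<phi> \<beta> \<zeta> y" "\<phi> \<beta> \<zeta> y = \<phi> \<gamma> \<zeta> z"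
      using equal_later[of \<alpha> \<beta> \<delta> \<zeta> x y] equal_later[of \<beta> \<gamma> \<epsilon> \<zeta> y z] * \<zeta> by auto
    then show "\<exists>\<delta>\<in>A. \<alpha> \<le> \<delta> \<and> \<gamma> \<le> \<delta> \<and> \<phi> \<alpha> \<delta> x = \<phi> \<gamma> \<delta> z"
      using * \<zeta> order_trans by metis
  qed
qed

lemma limit_map_eq_iff:
  assumes "\<alpha> \<in> A" "\<beta> \<in> A" "x \<in> carrier (V \<alpha>)" "y \<in> carrier (V \<beta>)"
  shows "\<iota> \<alpha> x = \<iota> \<beta> y \<longleftrightarrow> (\<exists>\<gamma>\<in>A. \<alpha> \<le> \<gamma> \<and> \<beta> \<le> \<gamma> \<and> \<phi> \<alpha> \<gamma> x = \<phi> \<beta> \<gamma> y)"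
proof -
  have "\<iota> \<alpha> x = \<iota> \<beta> y \<longleftrightarrow> ((\<alpha>, x), (\<beta>, y)) \<in> limit_rel A V \<phi>"
    unfolding limit_map_def
    by (rule eq_equiv_class_iff[OF equiv_limit_rel]) (simp_all add: assms)
  then show ?thesis using assms by (simp add: limit_rel_def)
qed

lemma limit_map_eqI:
  assumes "\<alpha> \<in> A" "\<beta> \<in> A" "x \<in> carrier (V \<alpha>)" "y \<in> carrier (V \<beta>)"
    and "\<gamma> \<in> A" "\<alpha> \<le> \<gamma>" "\<beta> \<le> \<gamma>" "\<phi> \<alpha> \<gamma> x = \<phi> \<beta> \<gamma> y"
  shows "\<iota> \<alpha> x = \<iota> \<beta> y"
  using limit_map_eq_iff[OF assms(1-4)] assms(5-8) by blast

lemma limit_map_connecting: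
  assumes "\<alpha> \<in> A" "\<beta> \<in> A" "\<alpha> \<le> \<beta>" "x \<in> carrier (V \<alpha>)"
  shows "\<iota> \<beta> (\<phi> \<alpha> \<beta> x) = \<iota> \<alpha> x"
  by (rule limit_map_eqI[of _ _ _ _ \<beta>])
    (simp_all add: assms connecting_hom(1)[OF assms] connecting_refl)

lemma carrier_limit: "carrier L = (\<Union>\<alpha>\<in>A. \<iota> \<alpha> ` carrier (V \<alpha>))"
proof -
  have "carrier L = (\<Union>p\<in>(SIGMA \<alpha>:A. carrier (V \<alpha>)). {limit_rel A V \<phi> `` {p}})"
    by (simp add: limit_space_def quotient_def)
  also have "\<dots> = (\<Union>\<alpha>\<in>A. \<iota> \<alpha> ` carrier (V \<alpha>))"
    unfolding limit_map_def by blast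
  finally show ?thesis .
qed

lemma limit_zero:
  assumes "\<alpha> \<in> A"
  shows "\<zero>\<^bsub>L\<^esub> = \<iota> \<alpha> \<zero>\<^bsub>V \<alpha>\<^esub>"
proof -
  have "\<iota> \<beta> \<zero>\<^bsub>V \<beta>\<^esub> = \<iota> \<alpha> \<zero>\<^bsub>V \<alpha>\<^esub>" if \<beta>: "\<beta> \<in> A" for \<beta>
  proof -
    obtain \<gamma> where "\<gamma> \<in> A" "\<alpha> \<le> \<gamma>" "\<beta> \<le> \<gamma>"
      using index_directed assms \<beta> by blast
    moreover have "\<zero>\<^bsub>V \<delta>\<^esub> \<in> carrier (V \<delta>)" if "\<delta> \<in> A" for \<delta>
      using abelian_group.axioms(1)[OF module.axioms(2)[OF space_module[OF that]]]
      by (rule abelian_monoid.zero_closed)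
    ultimately show ?thesis
      using assms \<beta> by (intro limit_map_eqI[of _ _ _ _ \<gamma>]) (simp_all add: connecting_hom(4))
  qed
  then have "(\<Union>\<beta>\<in>A. \<iota> \<beta> \<zero>\<^bsub>V \<beta>\<^esub>) = \<iota> \<alpha> \<zero>\<^bsub>V \<alpha>\<^esub>"
    by (rule SUP_eq_const[OF index_nonempty])
  then show ?thesis by (simp add: limit_space_def)
qed

lemma limit_add:
  assumes "\<alpha> \<in> A" "x \<in> carrier (V \<alpha>)" "y \<in> carrier (V \<alpha>)"
  shows "\<iota> \<alpha> x \<oplus>\<^bsub>L\<^esub> \<iota> \<alpha> y = \<iota> \<alpha> (x \<oplus>\<^bsub>V \<alpha>\<^esub> y)"
proof -
  have closed: "u \<oplus>\<^bsub>V \<delta>\<^esub> v \<in> carrier (V \<delta>)"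
    if "\<delta> \<in> A" "u \<in> carrier (V \<delta>)" "v \<in> carrier (V \<delta>)" for \<delta> u v
    using abelian_group.axioms(1)[OF module.axioms(2)[OF space_module[OF that(1)]]] that(2,3)
    by (rule abelian_monoid.a_closed)
  have "\<iota> \<beta> (u \<oplus>\<^bsub>V \<beta>\<^esub> v) = \<iota> \<alpha> (x \<oplus>\<^bsub>V \<alpha>\<^esub> y)"
    if *: "\<beta> \<in> A" "u \<in> carrier (V \<beta>)" "v \<in> carrier (V \<beta>)" "\<iota> \<beta> u = \<iota> \<alpha> x" "\<iota> \<beta> v = \<iota> \<alpha> y"
    for \<beta> u v
  proof -
    obtain \<gamma> where \<gamma>: "\<gamma> \<in> A" "\<beta> \<le> \<gamma>" "\<alpha> \<le> \<gamma>" "\<phi> \<beta> \<gamma> u = \<phi> \<alpha> \<gamma> x"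
      using * assms limit_map_eq_iff by metis
    obtain \<delta> where \<delta>: "\<delta> \<in> A" "\<beta> \<le> \<delta>" "\<alpha> \<le> \<delta>" "\<phi> \<beta> \<delta> v = \<phi> \<alpha> \<delta> y"
      using * assms limit_map_eq_iff by metis
    obtain \<epsilon> where \<epsilon>: "\<epsilon> \<in> A" "\<gamma> \<le> \<epsilon>" "\<delta> \<le> \<epsilon>"
      using index_directed \<gamma>(1) \<delta>(1) by blast
    have "\<phi> \<beta> \<epsilon> u = \<phi> \<alpha> \<epsilon> x" "\<phi> \<beta> \<epsilon> v = \<phi> \<alpha> \<epsilon> y"
      using equal_later[of \<beta> \<alpha> \<gamma> \<epsilon> u x] equal_later[of \<beta> \<alpha> \<delta> \<epsilon> v y] * \<gamma> \<delta> \<epsilon> assms by auto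
    moreover have "\<beta> \<le> \<epsilon>" "\<alpha> \<le> \<epsilon>"
      using \<gamma> \<epsilon> order_trans by blast+
    ultimately show ?thesis
      using * assms \<epsilon>
      by (intro limit_map_eqI[of _ _ _ _ \<epsilon>]) (simp_all add: closed connecting_hom(2))
  qed
  then have "{\<iota> \<beta> (u \<oplus>\<^bsub>V \<beta>\<^esub> v) | \<beta> u v. \<beta> \<in> A \<and> u \<in> carrier (V \<beta>) \<and>
      v \<in> carrier (V \<beta>) \<and> \<iota> \<beta> u = \<iota> \<alpha> x \<and> \<iota> \<beta> v = \<iota> \<alpha> y} = {\<iota> \<alpha> (x \<oplus>\<^bsub>V \<alpha>\<^esub> y)}"
    using assms by blast
  then show ?thesis by (simp add: limit_space_def)
qed

lemma limit_smult:
  assumes "\<alpha> \<in> A" "x \<in> carrier (V \<alpha>)" "c \<in> F"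
  shows "c \<odot>\<^bsub>L\<^esub> \<iota> \<alpha> x = \<iota> \<alpha> (c \<odot>\<^bsub>V \<alpha>\<^esub> x)"
proof -
  have closed: "c \<odot>\<^bsub>V \<delta>\<^esub> u \<in> carrier (V \<delta>)" if "\<delta> \<in> A" "u \<in> carrier (V \<delta>)" for \<delta> u
    using module.smult_closed[OF space_module[OF that(1)], of c u] assms(3) that(2) by simp
  have "\<iota> \<beta> (c \<odot>\<^bsub>V \<beta>\<^esub> u) = \<iota> \<alpha> (c \<odot>\<^bsub>V \<alpha>\<^esub> x)"
    if *: "\<beta> \<in> A" "u \<in> carrier (V \<beta>)" "\<iota> \<beta> u = \<iota> \<alpha> x" for \<beta> u
  proof -
    obtain \<gamma> where "\<gamma> \<in> A" "\<beta> \<le> \<gamma>" "\<alpha> \<le> \<gamma>" "\<phi> \<beta> \<gamma> u = \<phi> \<alpha> \<gamma> x"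
      using * assms limit_map_eq_iff by metis
    then show ?thesis
      using * assms
      by (intro limit_map_eqI[of _ _ _ _ \<gamma>]) (simp_all add: closed connecting_hom(3))
  qed
  then have "{\<iota> \<beta> (c \<odot>\<^bsub>V \<beta>\<^esub> u) | \<beta> u. \<beta> \<in> A \<and> u \<in> carrier (V \<beta>) \<and> \<iota> \<beta> u = \<iota> \<alpha> x} =
      {\<iota> \<alpha> (c \<odot>\<^bsub>V \<alpha>\<^esub> x)}"
    using assms by blast
  then show ?thesis by (simp add: limit_space_def)
qed

lemma common_index2:
  assumes "X \<in> carrier L" "Y \<in> carrier L"
  obtains \<alpha> x y where "\<alpha> \<in> A" "x \<in> carrier (V \<alpha>)" "y \<in> carrier (V \<alpha>)" "X = \<iota> \<alpha> x" "Y = \<iota> \<alpha> y"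
proof -
  obtain \<beta> x \<gamma> y where *: "\<beta> \<in> A" "\<gamma> \<in> A" "x \<in> carrier (V \<beta>)" "y \<in> carrier (V \<gamma>)"
    "X = \<iota> \<beta> x" "Y = \<iota> \<gamma> y"
    using assms unfolding carrier_limit by blast
  obtain \<alpha> where \<alpha>: "\<alpha> \<in> A" "\<beta> \<le> \<alpha>" "\<gamma> \<le> \<alpha>"
    using index_directed *(1,2) by blast
  show thesis
    by (rule that[of \<alpha> "\<phi> \<beta> \<alpha> x" "\<phi> \<gamma> \<alpha> y"])
      (simp_all add: * \<alpha> connecting_hom(1) limit_map_connecting)
qed

lemma common_index3:
  assumes "X \<in> carrier L" "Y \<in> carrier L" "Z \<in> carrier L"
  obtains \<alpha> x y z where "\<alpha> \<in> A" "x \<in> carrier (V \<alpha>)" "y \<in> carrier (V \<alpha>)" "z \<in> carrier (V \<alpha>)"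
    "X = \<iota> \<alpha> x" "Y = \<iota> \<alpha> y" "Z = \<iota> \<alpha> z"
proof -
  obtain \<beta> x y where *: "\<beta> \<in> A" "x \<in> carrier (V \<beta>)" "y \<in> carrier (V \<beta>)" "X = \<iota> \<beta> x" "Y = \<iota> \<beta> y"
    using common_index2[OF assms(1,2)] .
  obtain \<gamma> z where **: "\<gamma> \<in> A" "z \<in> carrier (V \<gamma>)" "Z = \<iota> \<gamma> z"
    using assms(3) unfolding carrier_limit by blast
  obtain \<alpha> where \<alpha>: "\<alpha> \<in> A" "\<beta> \<le> \<alpha>" "\<gamma> \<le> \<alpha>"
    using index_directed *(1) **(1) by blast
  show thesis
    by (rule that[of \<alpha> "\<phi> \<beta> \<alpha> x" "\<phi> \<beta> \<alpha> y" "\<phi> \<gamma> \<alpha> z"])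
      (simp_all add: * ** \<alpha> connecting_hom(1) limit_map_connecting)
qed

lemma limit_vectorspace: "vectorspace (scalars F) L"
proof -
  obtain \<alpha>0 where \<alpha>0: "\<alpha>0 \<in> A" using index_nonempty by blast
  interpret F: field "scalars F"
    using space_vs[OF \<alpha>0] by (simp add: vectorspace_def)
  have closed: "\<iota> \<alpha> x \<in> carrier L" if "\<alpha> \<in> A" "x \<in> carrier (V \<alpha>)" for \<alpha> x
    unfolding carrier_limit using that by blast
  have group: "abelian_group L"
  proof (rule abelian_groupI)
    fix X Y assume "X \<in> carrier L" "Y \<in> carrier L"
    then obtain \<alpha> x y where *: "\<alpha> \<in> A" "x \<in> carrier (V \<alpha>)" "y \<in> carrier (V \<alpha>)"
      "X = \<iota> \<alpha> x" "Y = \<iota> \<alpha> y" by (rule common_index2)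
    interpret module "scalars F" "V \<alpha>" by (rule space_module[OF *(1)])
    show "X \<oplus>\<^bsub>L\<^esub> Y \<in> carrier L" "X \<oplus>\<^bsub>L\<^esub> Y = Y \<oplus>\<^bsub>L\<^esub> X"
      using * by (simp_all add: limit_add closed M.a_comm)
  next
    interpret module "scalars F" "V \<alpha>0" by (rule space_module[OF \<alpha>0])
    show "\<zero>\<^bsub>L\<^esub> \<in> carrier L" by (simp add: limit_zero[OF \<alpha>0] closed \<alpha>0)
  next
    fix X Y Z assume "X \<in> carrier L" "Y \<in> carrier L" "Z \<in> carrier L"
    then obtain \<alpha> x y z where *: "\<alpha> \<in> A" "x \<in> carrier (V \<alpha>)" "y \<in> carrier (V \<alpha>)"
      "z \<in> carrier (V \<alpha>)" "X = \<iota> \<alpha> x" "Y = \<iota> \<alpha> y" "Z = \<iota> \<alpha> z" by (rule common_index3)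
    interpret module "scalars F" "V \<alpha>" by (rule space_module[OF *(1)])
    show "X \<oplus>\<^bsub>L\<^esub> Y \<oplus>\<^bsub>L\<^esub> Z = X \<oplus>\<^bsub>L\<^esub> (Y \<oplus>\<^bsub>L\<^esub> Z)"
      using * by (simp add: limit_add M.a_assoc)
  next
    fix X assume "X \<in> carrier L"
    then obtain \<alpha> x where *: "\<alpha> \<in> A" "x \<in> carrier (V \<alpha>)" "X = \<iota> \<alpha> x"
      unfolding carrier_limit by blast
    interpret module "scalars F" "V \<alpha>" by (rule space_module[OF *(1)])
    show "\<zero>\<^bsub>L\<^esub> \<oplus>\<^bsub>L\<^esub> X = X"
      using * by (simp add: limit_zero[OF *(1)] limit_add)
    have "\<iota> \<alpha> (\<ominus>\<^bsub>V \<alpha>\<^esub> x) \<oplus>\<^bsub>L\<^esub> X = \<zero>\<^bsub>L\<^esub>"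
      using * by (simp add: limit_zero[OF *(1)] limit_add M.l_neg)
    then show "\<exists>Y\<in>carrier L. Y \<oplus>\<^bsub>L\<^esub> X = \<zero>\<^bsub>L\<^esub>"
      using closed[OF *(1), of "\<ominus>\<^bsub>V \<alpha>\<^esub> x"] * by auto
  qed
  have "module (scalars F) L"
  proof (rule moduleI[OF F.is_cring group])
    fix c X assume c: "c \<in> carrier (scalars F)" and "X \<in> carrier L"
    then obtain \<alpha> x where *: "\<alpha> \<in> A" "x \<in> carrier (V \<alpha>)" "X = \<iota> \<alpha> x"
      unfolding carrier_limit by blast
    interpret module "scalars F" "V \<alpha>" by (rule space_module[OF *(1)])
    show "c \<odot>\<^bsub>L\<^esub> X \<in> carrier L"
      using c * smult_closed[OF c *(2)] by (simp add: limit_smult closed)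
  next
    fix c d X assume cd: "c \<in> carrier (scalars F)" "d \<in> carrier (scalars F)" and "X \<in> carrier L"
    then obtain \<alpha> x where *: "\<alpha> \<in> A" "x \<in> carrier (V \<alpha>)" "X = \<iota> \<alpha> x"
      unfolding carrier_limit by blast
    interpret module "scalars F" "V \<alpha>" by (rule space_module[OF *(1)])
    note cl = smult_closed[OF cd(1) *(2)] smult_closed[OF cd(2) *(2)]
    have "c + d \<in> F" "c * d \<in> F"
      using F.a_closed[OF cd] F.m_closed[OF cd] by simp_all
    then show "(c \<oplus>\<^bsub>scalars F\<^esub> d) \<odot>\<^bsub>L\<^esub> X = c \<odot>\<^bsub>L\<^esub> X \<oplus>\<^bsub>L\<^esub> d \<odot>\<^bsub>L\<^esub> X"
      and "(c \<otimes>\<^bsub>scalars F\<^esub> d) \<odot>\<^bsub>L\<^esub> X = c \<odot>\<^bsub>L\<^esub> (d \<odot>\<^bsub>L\<^esub> X)"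
      using cd * cl smult_l_distr[OF cd *(2)] smult_assoc1[OF cd *(2)]
      by (simp_all add: limit_smult limit_add)
  next
    fix c X Y assume c: "c \<in> carrier (scalars F)" and "X \<in> carrier L" "Y \<in> carrier L"
    then obtain \<alpha> x y where *: "\<alpha> \<in> A" "x \<in> carrier (V \<alpha>)" "y \<in> carrier (V \<alpha>)"
      "X = \<iota> \<alpha> x" "Y = \<iota> \<alpha> y" by - (rule common_index2)
    interpret module "scalars F" "V \<alpha>" by (rule space_module[OF *(1)])
    show "c \<odot>\<^bsub>L\<^esub> (X \<oplus>\<^bsub>L\<^esub> Y) = c \<odot>\<^bsub>L\<^esub> X \<oplus>\<^bsub>L\<^esub> c \<odot>\<^bsub>L\<^esub> Y"
      using c * smult_closed[OF c *(2)] smult_closed[OF c *(3)] smult_r_distr[OF c *(2,3)]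
      by (simp add: limit_smult limit_add)
  next
    fix X assume "X \<in> carrier L"
    then obtain \<alpha> x where *: "\<alpha> \<in> A" "x \<in> carrier (V \<alpha>)" "X = \<iota> \<alpha> x"
      unfolding carrier_limit by blast
    interpret module "scalars F" "V \<alpha>" by (rule space_module[OF *(1)])
    have "1 \<in> F" using F.one_closed by simp
    then show "\<one>\<^bsub>scalars F\<^esub> \<odot>\<^bsub>L\<^esub> X = X"
      using * smult_one[OF *(2)] by (simp add: limit_smult)
  qed
  then show ?thesis using F.field_axioms by (rule vectorspace.intro)
qed

lemma limit_map_linear:
  assumes "\<alpha> \<in> A"
  shows "linear_map (scalars F) (V \<alpha>) L (\<iota> \<alpha>)"
proof -
  have "\<iota> \<alpha> \<in> module_hom (scalars F) (V \<alpha>) L"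
    unfolding module_hom_def
  proof (intro CollectI conjI allI impI Pi_I)
    show "\<iota> \<alpha> x \<in> carrier L" if "x \<in> carrier (V \<alpha>)" for x
      unfolding carrier_limit using assms that by blast
  qed (simp_all add: assms limit_add limit_smult)
  then show ?thesis
    using space_vs[OF assms] limit_vectorspace
    by (simp add: linear_map_def mod_hom_def mod_hom_axioms_def vectorspace_def)
qed

text \<open>The universal property; uniqueness of \<open>g\<close> on the carrier is \<open>carrier_limit\<close>.\<close>

lemma limit_universal:
  assumes W: "vectorspace (scalars F) W"
    and \<psi>: "\<And>\<alpha>. \<alpha> \<in> A \<Longrightarrow> linear_map (scalars F) (V \<alpha>) W (\<psi> \<alpha>)"
    and compat: "\<And>\<alpha> \<beta> x. \<lbrakk>\<alpha> \<in> A; \<beta> \<in> A; \<alpha> \<le> \<beta>; x \<in> carrier (V \<alpha>)\<rbrakk> \<Longrightarrow> \<psi> \<beta> (\<phi> \<alpha> \<beta> x) = \<psi> \<alpha> x"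
  shows "\<exists>g. linear_map (scalars F) L W g \<and> (\<forall>\<alpha>\<in>A. \<forall>x\<in>carrier (V \<alpha>). g (\<iota> \<alpha> x) = \<psi> \<alpha> x)"
proof -
  define g where "g X = (SOME w. \<exists>\<alpha>\<in>A. \<exists>x\<in>carrier (V \<alpha>). X = \<iota> \<alpha> x \<and> w = \<psi> \<alpha> x)" for X
  have g: "g (\<iota> \<alpha> x) = \<psi> \<alpha> x" if \<alpha>: "\<alpha> \<in> A" "x \<in> carrier (V \<alpha>)" for \<alpha> x
  proof -
    have "w = \<psi> \<alpha> x" if w: "\<exists>\<beta>\<in>A. \<exists>y\<in>carrier (V \<beta>). \<iota> \<alpha> x = \<iota> \<beta> y \<and> w = \<psi> \<beta> y" for w
    proof -
      obtain \<beta> y where *: "\<beta> \<in> A" "y \<in> carrier (V \<beta>)" "\<iota> \<alpha> x = \<iota> \<beta> y" "w = \<psi> \<beta> y"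
        using w by blast
      obtain \<gamma> where \<gamma>: "\<gamma> \<in> A" "\<alpha> \<le> \<gamma>" "\<beta> \<le> \<gamma>" "\<phi> \<alpha> \<gamma> x = \<phi> \<beta> \<gamma> y"
        using limit_map_eq_iff[OF \<alpha>(1) *(1) \<alpha>(2) *(2)] *(3) by blast
      show ?thesis
        using compat[OF \<alpha>(1) \<gamma>(1,2) \<alpha>(2)] compat[OF *(1) \<gamma>(1,3) *(2)] \<gamma>(4) *(4) by simp
    qed
    then show ?thesis unfolding g_def using \<alpha> by (intro some_equality) blast+
  qed
  have hom: "\<psi> \<alpha> \<in> module_hom (scalars F) (V \<alpha>) W" if "\<alpha> \<in> A" for \<alpha>
    using \<psi>[OF that] by (simp add: linear_map_def mod_hom_def mod_hom_axioms_def)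
  have "g \<in> module_hom (scalars F) L W"
    unfolding module_hom_def
  proof (intro CollectI conjI allI impI Pi_I)
    fix X assume "X \<in> carrier L"
    then obtain \<alpha> x where *: "\<alpha> \<in> A" "x \<in> carrier (V \<alpha>)" "X = \<iota> \<alpha> x"
      unfolding carrier_limit by blast
    show "g X \<in> carrier W"
      using module_hom_closed[OF hom[OF *(1)]] * by (auto simp: g)
  next
    fix X Y assume XY: "X \<in> carrier L \<and> Y \<in> carrier L"
    obtain \<alpha> x y where *: "\<alpha> \<in> A" "x \<in> carrier (V \<alpha>)" "y \<in> carrier (V \<alpha>)"
      "X = \<iota> \<alpha> x" "Y = \<iota> \<alpha> y"
      by (rule common_index2[OF conjunct1[OF XY] conjunct2[OF XY]])
    interpret module "scalars F" "V \<alpha>" by (rule space_module[OF *(1)])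
    show "g (X \<oplus>\<^bsub>L\<^esub> Y) = g X \<oplus>\<^bsub>W\<^esub> g Y"
      using * hom[OF *(1)] by (simp add: limit_add g module_hom_def)
  next
    fix c X assume c: "c \<in> carrier (scalars F) \<and> X \<in> carrier L"
    then obtain \<alpha> x where *: "\<alpha> \<in> A" "x \<in> carrier (V \<alpha>)" "X = \<iota> \<alpha> x"
      unfolding carrier_limit by blast
    interpret module "scalars F" "V \<alpha>" by (rule space_module[OF *(1)])
    show "g (c \<odot>\<^bsub>L\<^esub> X) = c \<odot>\<^bsub>W\<^esub> g X"
      using * c smult_closed[of c x] hom[OF *(1)] by (simp add: limit_smult g module_hom_def)
  qed
  then have "linear_map (scalars F) L W g"
    using W limit_vectorspace
    by (simp add: linear_map_def mod_hom_def mod_hom_axioms_def vectorspace_def)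
  then show ?thesis using g by blast
qed

end

end

theory Submission
  imports Defs "HOL-Analysis.Finite_Function_Topology"
begin

text \<open>
  A limit of maps \<open>F\<^sup>n \<rightarrow> F\<^sup>n\<close> that has dimension \<open>n\<close> is a cone that is the union of an
  increasing sequence of simplicial cones, each generated by a basis of \<open>V\<close>. So the point is that
  \<open>P\<close> is countably generated and that finitely many elements of \<open>P\<close> always lie in a simplicial
  cone inside \<open>P\<close>.

  By Riesz decomposition the sum of two faces of \<open>P\<close> is a face. So the faces form a distributive
  lattice of finite length, which is finite, and \<open>P\<close> is generated by the elements that lie in some
  face \<open>R\<close> and are rational combinations of a fixed basis of \<open>R\<close>.

  For the second claim let \<open>M\<close> be a maximal proper face of a face \<open>Q\<close>. Modulo \<open>M\<close> every element
  of \<open>Q - M\<close> is an order unit. The states of the quotient (positive real functionals on \<open>Q\<close> that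
  vanish on \<open>M\<close>) form a lattice cone by Riesz and Kantorovich, generated by a maximal family
  \<open>\<Phi>\<close> of pairwise disjoint states. By separation, an element on which all states in \<open>\<Phi>\<close> are
  strictly positive is positive modulo \<open>M\<close>. As \<open>\<Phi>\<close> is linearly independent, finitely many such
  elements lie in a simplicial cone over the reals on which \<open>\<Phi>\<close> is positive, and its generators
  can be exchanged, one at a time, for vectors defined over \<open>F\<close>. Riesz decomposition shrinks lifts
  of these generators to \<open>Q\<close> until the given elements differ from their combinations by elements
  of \<open>M\<close>, and one continues with \<open>M\<close>.
\<close>

section \<open>Exchange over a subfield of the reals\<close>

text \<open>Two obstacles shape the argument. Cones here need not be closed: if the nonzero positive
  vectors of a plane are those with two strictly positive coordinates, nonnegative values of all
  states do not imply positivity. Separation therefore certifies only elements on which the states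
  are strictly positive. Elements of a proper face, where states vanish, must be treated separately,
  and the exchange arguments keep every inequality strict. The other obstacle is the gap between
  \<open>F\<close> and the reals. On pairs of rationals ordered by the sign of a + b sqrt 2 there is
  only one state up to scaling, and its real kernel contains no nonzero rational vector. So the
  \<open>F\<close>-space is kept as \<open>combos F B\<close> inside the real space
  \<open>span B\<close>: bases are built over the reals and then perturbed into
  \<open>combos F B\<close>, which is possible because strict inequalities are open conditions.
  Nothing is lost in passing to real scalars, since a real dependence between vectors of
  \<open>combos F B\<close> is already one over \<open>F\<close> (\<open>span_inter_combos\<close>).
  Countable generation uses rational coefficients even when \<open>F\<close> is larger, because
  \<open>F\<close> may be uncountable.\<close>

definition combos :: "real set \<Rightarrow> 'a::real_vector set \<Rightarrow> 'a set"
  where "combos C T = {\<Sum>t\<in>T. c t *\<^sub>R t | c. c ` T \<subseteq> C}"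

lemma combosI: "c ` T \<subseteq> C \<Longrightarrow> (\<Sum>t\<in>T. c t *\<^sub>R t) \<in> combos C T"
  by (auto simp: combos_def)

lemma combosE:
  assumes "x \<in> combos C T"
  obtains c where "\<forall>t\<in>T. c t \<in> C" "x = (\<Sum>t\<in>T. c t *\<^sub>R t)"
  using assms unfolding combos_def by blast

lemma combos_subset_span: "combos C T \<subseteq> span T"
  by (auto simp: combos_def intro!: span_sum span_scale intro: span_base)

lemma combos_leastI:
  assumes "0 \<in> A" "\<And>x y. x \<in> A \<Longrightarrow> y \<in> A \<Longrightarrow> x + y \<in> A"
    "\<And>c x. c \<in> C \<Longrightarrow> x \<in> A \<Longrightarrow> c *\<^sub>R x \<in> A" "T \<subseteq> A"
  shows "combos C T \<subseteq> A"
proof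
  fix x assume "x \<in> combos C T"
  then obtain c where c: "\<forall>t\<in>T. c t \<in> C" "x = (\<Sum>t\<in>T. c t *\<^sub>R t)" by (rule combosE)
  have "(\<Sum>t\<in>T. c t *\<^sub>R t) \<in> A"
    using c(1) assms(4) by (induction T rule: infinite_finite_induct) (auto intro: assms(1-3))
  then show "x \<in> A" using c by simp
qed

lemma representation_sum_coeff:
  fixes T :: "'a::real_vector set"
  assumes "finite T" "independent T" "t \<in> T"
  shows "representation T (\<Sum>v\<in>T. c v *\<^sub>R v) t = c t"
proof -
  have "representation T (\<Sum>v\<in>T. c v *\<^sub>R v) t = (\<Sum>v\<in>T. representation T (c v *\<^sub>R v) t)"
    by (subst real_vector.representation_sum[OF assms(2)]) (auto intro: span_scale span_base)
  also have "\<dots> = (\<Sum>v\<in>T. if t = v then c v else 0)"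
    by (rule sum.cong)
      (auto simp: real_vector.representation_scale assms span_base real_vector.representation_basis)
  also have "\<dots> = c t" using assms by simp
  finally show ?thesis .
qed

lemma sum_representation:
  fixes T :: "'a::real_vector set"
  assumes "finite T" "independent T" "x \<in> span T"
  shows "(\<Sum>t\<in>T. representation T x t *\<^sub>R t) = x"
  by (rule real_vector.sum_representation_eq) (use assms in auto)

lemma combos_iff_representation:
  fixes T :: "'a::real_vector set"
  assumes "finite T" "independent T"
  shows "x \<in> combos C T \<longleftrightarrow> x \<in> span T \<and> (\<forall>t\<in>T. representation T x t \<in> C)"
proof
  assume x: "x \<in> combos C T"
  then obtain c where c: "\<forall>t\<in>T. c t \<in> C" "x = (\<Sum>t\<in>T. c t *\<^sub>R t)"
    by (rule combosE)
  then show "x \<in> span T \<and> (\<forall>t\<in>T. representation T x t \<in> C)"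
    using combos_subset_span x by (auto simp: representation_sum_coeff[OF assms])
next
  assume "x \<in> span T \<and> (\<forall>t\<in>T. representation T x t \<in> C)"
  then show "x \<in> combos C T"
    using combosI[of "representation T x" T C] sum_representation[OF assms, of x] by auto
qed

text \<open>The pivot formulas of Steinitz exchange. They are recorded explicitly because later uses
  need more than independence: that coordinates stay in \<open>F\<close>, and that they stay
  positive.\<close>

lemma independent_exchange:
  fixes W :: "'a::real_vector set"
  assumes W: "finite W" "independent W" and w: "w \<in> W"
    and t: "t \<in> span W" "representation W t w \<noteq> 0"
  defines "W' \<equiv> insert t (W - {w})"
  shows "t \<notin> W - {w}" "independent W'" "span W' = span W"
    "\<And>x. x \<in> span W \<Longrightarrow> representation W' x t = representation W x w / representation W t w"
    "\<And>x l. x \<in> span W \<Longrightarrow> l \<in> W - {w} \<Longrightarrow> representation W' x l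
       = representation W x l - representation W x w * representation W t l / representation W t w"
proof -
  define \<tau> where "\<tau> = representation W t"
  have t_eq: "t = \<tau> w *\<^sub>R w + (\<Sum>l\<in>W-{w}. \<tau> l *\<^sub>R l)"
    using sum_representation[OF W t(1)] W w by (simp add: \<tau>_def sum.remove)
  have "t \<notin> span (W - {w})"
  proof
    assume "t \<in> span (W - {w})"
    moreover have "(\<Sum>l\<in>W-{w}. \<tau> l *\<^sub>R l) \<in> span (W - {w})"
      by (intro span_sum span_scale span_base)
    ultimately have "\<tau> w *\<^sub>R w \<in> span (W - {w})"
      using t_eq span_diff by (metis add_diff_cancel_right')
    then have "w \<in> span (W - {w})"
      using t(2) span_scale[of "\<tau> w *\<^sub>R w" "W - {w}" "1 / \<tau> w"] by (simp add: \<tau>_def)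
    then show False using W(2) w by (simp add: dependent_def)
  qed
  then show notin: "t \<notin> W - {w}" using span_base[of t "W - {w}"] by blast
  show ind: "independent W'"
    unfolding W'_def
    by (intro real_vector.independent_insertI real_vector.independent_mono[OF W(2)]) (fact | blast)+
  have w_eq: "w = (1 / \<tau> w) *\<^sub>R (t - (\<Sum>l\<in>W-{w}. \<tau> l *\<^sub>R l))"
    using t(2) by (subst t_eq) (simp add: \<tau>_def)
  have "w \<in> span W'"
    by (subst w_eq) (auto simp: W'_def intro!: span_scale span_diff span_sum intro: span_base)
  then have "W \<subseteq> span W'" using span_base[of _ W'] by (auto simp: W'_def)
  moreover have "W' \<subseteq> span W" using t(1) by (auto simp: W'_def intro: span_base)
  ultimately show sp: "span W' = span W" by (simp add: span_eq)
  have fin: "finite W'" using W by (simp add: W'_def)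
  define r where "r x l = (if l = t then representation W x w / \<tau> w
    else representation W x l - representation W x w * \<tau> l / \<tau> w)" for x l
  have rep: "representation W' x l = r x l" if x: "x \<in> span W" and l: "l \<in> W'" for x l
  proof -
    let ?X = "representation W x"
    have "(\<Sum>l\<in>W'. r x l *\<^sub>R l) = (?X w / \<tau> w) *\<^sub>R t + (\<Sum>l\<in>W-{w}. (?X l - ?X w * \<tau> l / \<tau> w) *\<^sub>R l)"
    proof -
      have "(\<Sum>l\<in>W-{w}. r x l *\<^sub>R l) = (\<Sum>l\<in>W-{w}. (?X l - ?X w * \<tau> l / \<tau> w) *\<^sub>R l)"
        using notin by (intro sum.cong) (auto simp: r_def)
      then show ?thesis unfolding W'_def using notin W by (simp add: r_def)
    qed
    also have "\<dots> = ?X w *\<^sub>R w + (\<Sum>l\<in>W-{w}. ?X l *\<^sub>R l)"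
      using t(2) by (subst t_eq)
        (simp add: \<tau>_def scaleR_add_right scaleR_diff_left sum_subtractf scaleR_sum_right)
    also have "\<dots> = x" using sum_representation[OF W x] W w by (simp add: sum.remove)
    finally show ?thesis using representation_sum_coeff[OF fin ind l, of "r x"] by simp
  qed
  show "representation W' x t = representation W x w / representation W t w" if "x \<in> span W" for x
    using rep[OF that, of t] by (simp add: W'_def r_def \<tau>_def)
  show "representation W' x l
       = representation W x l - representation W x w * representation W t l / representation W t w"
    if "x \<in> span W" "l \<in> W - {w}" for x l
    using rep[OF that(1), of l] that notin by (auto simp: W'_def r_def \<tau>_def)
qed

section \<open>Spaces over \<open>F\<close> inside real vector spaces\<close>

locale real_subfield =
  fixes F :: "real set"
  assumes one_mem: "1 \<in> F"
    and diff_mem: "x \<in> F \<Longrightarrow> y \<in> F \<Longrightarrow> x - y \<in> F"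
    and mult_mem: "x \<in> F \<Longrightarrow> y \<in> F \<Longrightarrow> x * y \<in> F"
    and inverse_mem: "x \<in> F \<Longrightarrow> inverse x \<in> F"
begin

lemma zero_mem: "0 \<in> F"
  using diff_mem[OF one_mem one_mem] by simp

lemma uminus_mem: "x \<in> F \<Longrightarrow> - x \<in> F"
  using diff_mem[OF zero_mem] by force

lemma add_mem: "x \<in> F \<Longrightarrow> y \<in> F \<Longrightarrow> x + y \<in> F"
  using diff_mem[OF _ uminus_mem] by force

lemma divide_mem: "x \<in> F \<Longrightarrow> y \<in> F \<Longrightarrow> x / y \<in> F"
  by (simp add: divide_inverse mult_mem inverse_mem)

lemma of_nat_mem: "of_nat n \<in> F"
  by (induction n) (auto intro: add_mem zero_mem one_mem)

lemma of_rat_mem: "of_rat q \<in> F"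
proof (cases q)
  case (Fract a b)
  have "of_int i \<in> F" for i :: int
    by (cases i rule: int_cases2) (auto intro: of_nat_mem uminus_mem)
  then show ?thesis using Fract by (auto simp: of_rat_rat intro: divide_mem)
qed

abbreviation "Fpos \<equiv> F \<inter> {0..}"

definition F_subspace :: "'a::real_vector set \<Rightarrow> bool"
  where "F_subspace M \<longleftrightarrow> 0 \<in> M \<and> (\<forall>x\<in>M. \<forall>y\<in>M. x + y \<in> M) \<and> (\<forall>c\<in>F. \<forall>x\<in>M. c *\<^sub>R x \<in> M)"

lemma F_subspaceD:
  assumes "F_subspace M"
  shows "0 \<in> M" "x \<in> M \<Longrightarrow> y \<in> M \<Longrightarrow> x + y \<in> M" "c \<in> F \<Longrightarrow> x \<in> M \<Longrightarrow> c *\<^sub>R x \<in> M"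
    "x \<in> M \<Longrightarrow> - x \<in> M" "x \<in> M \<Longrightarrow> y \<in> M \<Longrightarrow> x - y \<in> M"
proof -
  show *: "0 \<in> M" "\<And>x y. x \<in> M \<Longrightarrow> y \<in> M \<Longrightarrow> x + y \<in> M" "\<And>c x. c \<in> F \<Longrightarrow> x \<in> M \<Longrightarrow> c *\<^sub>R x \<in> M"
    using assms by (auto simp: F_subspace_def)
  show m: "x \<in> M \<Longrightarrow> - x \<in> M" for x using *(3)[OF uminus_mem[OF one_mem], of x] by simp
  show "x \<in> M \<Longrightarrow> y \<in> M \<Longrightarrow> x - y \<in> M" using *(2)[OF _ m, of x y] by simp
qed

lemma F_subspace_combos: "F_subspace (combos F T)"
  unfolding F_subspace_def
proof (intro conjI ballI)
  show "0 \<in> combos F T" using combosI[of "\<lambda>_. 0" T F] zero_mem by auto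
next
  fix x y assume x: "x \<in> combos F T" and y: "y \<in> combos F T"
  obtain c where c: "\<forall>t\<in>T. c t \<in> F" "x = (\<Sum>t\<in>T. c t *\<^sub>R t)" using combosE[OF x] .
  obtain d where d: "\<forall>t\<in>T. d t \<in> F" "y = (\<Sum>t\<in>T. d t *\<^sub>R t)" using combosE[OF y] .
  show "x + y \<in> combos F T"
    using combosI[of "\<lambda>t. c t + d t" T F] c d
    by (auto simp: sum.distrib scaleR_add_left image_subset_iff intro: add_mem)
next
  fix r x assume r: "r \<in> F" and x: "x \<in> combos F T"
  obtain c where c: "\<forall>t\<in>T. c t \<in> F" "x = (\<Sum>t\<in>T. c t *\<^sub>R t)" using combosE[OF x] .
  show "r *\<^sub>R x \<in> combos F T"
    using combosI[of "\<lambda>t. r * c t" T F] c r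
    by (auto simp: scaleR_sum_right image_subset_iff intro: mult_mem)
qed

lemma in_combos:
  assumes "finite T" "x \<in> T" "0 \<in> C" "1 \<in> C"
  shows "x \<in> combos C T"
proof -
  have "(\<Sum>t\<in>T. (if t = x then 1 else 0) *\<^sub>R t) = (\<Sum>t\<in>T. if t = x then t else 0)"
    by (rule sum.cong) auto
  also have "\<dots> = x" using assms by simp
  finally show ?thesis using combosI[of "\<lambda>t. if t = x then 1 else 0" T C] assms by auto
qed

lemma combos_F_least: "F_subspace M \<Longrightarrow> T \<subseteq> M \<Longrightarrow> combos F T \<subseteq> M"
  by (rule combos_leastI) (auto dest: F_subspaceD)

lemma combos_cone:
  shows "0 \<in> combos Fpos T"
    and "x \<in> combos Fpos T \<Longrightarrow> y \<in> combos Fpos T \<Longrightarrow> x + y \<in> combos Fpos T"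
    and "r \<in> Fpos \<Longrightarrow> x \<in> combos Fpos T \<Longrightarrow> r *\<^sub>R x \<in> combos Fpos T"
proof -
  show "0 \<in> combos Fpos T" using combosI[of "\<lambda>_. 0" T "Fpos"] zero_mem by auto
next
  assume x: "x \<in> combos Fpos T" and y: "y \<in> combos Fpos T"
  obtain c where c: "\<forall>t\<in>T. c t \<in> Fpos" "x = (\<Sum>t\<in>T. c t *\<^sub>R t)" using combosE[OF x] .
  obtain d where d: "\<forall>t\<in>T. d t \<in> Fpos" "y = (\<Sum>t\<in>T. d t *\<^sub>R t)" using combosE[OF y] .
  show "x + y \<in> combos Fpos T"
    using combosI[of "\<lambda>t. c t + d t" T Fpos] c d
    by (auto simp: sum.distrib scaleR_add_left image_subset_iff intro: add_mem)
next
  assume r: "r \<in> Fpos" and x: "x \<in> combos Fpos T"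
  obtain c where c: "\<forall>t\<in>T. c t \<in> Fpos" "x = (\<Sum>t\<in>T. c t *\<^sub>R t)" using combosE[OF x] .
  show "r *\<^sub>R x \<in> combos Fpos T"
    using combosI[of "\<lambda>t. r * c t" T Fpos] c r
    by (auto simp: scaleR_sum_right image_subset_iff intro: mult_mem)
qed

text \<open>Each new \<open>x\<close> has coordinates in \<open>F\<close> with respect to the
  current basis, and one of them outside \<open>C\<close> is nonzero because \<open>x\<close> is not
  in \<open>span C\<close>. Exchanging there keeps all coordinates in \<open>F\<close>, since the
  pivot formulas use field operations only.\<close>

lemma steinitz:
  fixes B C :: "'a::real_vector set"
  assumes B: "finite B" "independent B" and "finite C" "independent C" "C \<subseteq> combos F B"
  shows "\<exists>B'\<subseteq>B. C \<inter> B' = {} \<and> independent (C \<union> B') \<and> combos F B \<subseteq> combos F (C \<union> B')"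
  using assms(3-5)
proof (induction C rule: finite_induct)
  case empty
  show ?case using B by (intro exI[of _ B]) auto
next
  case (insert x C)
  then have "independent C" by (metis real_vector.independent_mono subset_insertI)
  then obtain B' where B': "B' \<subseteq> B" "C \<inter> B' = {}" "independent (C \<union> B')"
    "combos F B \<subseteq> combos F (C \<union> B')"
    using insert.IH insert.prems(2) by auto
  have fin: "finite (C \<union> B')" using finite_subset[OF B'(1) B(1)] insert.hyps(1) by simp
  let ?X = "representation (C \<union> B') x"
  have x: "x \<in> span (C \<union> B')" "\<And>t. t \<in> C \<union> B' \<Longrightarrow> ?X t \<in> F"
    using insert.prems B'(4) combos_iff_representation[OF fin B'(3), of x F] by auto
  have "\<exists>b\<in>B'. ?X b \<noteq> 0"
  proof (rule ccontr)
    assume "\<not> (\<exists>b\<in>B'. ?X b \<noteq> 0)"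
    then have "(\<Sum>t\<in>C. ?X t *\<^sub>R t) = (\<Sum>t\<in>C\<union>B'. ?X t *\<^sub>R t)"
      by (intro sum.mono_neutral_left) (use fin in auto)
    then have "(\<Sum>t\<in>C. ?X t *\<^sub>R t) = x" using sum_representation[OF fin B'(3) x(1)] by simp
    moreover have "(\<Sum>t\<in>C. ?X t *\<^sub>R t) \<in> span C" by (intro span_sum span_scale span_base)
    ultimately show False
      using insert.prems(1) insert.hyps by (simp add: real_vector.independent_insert)
  qed
  then obtain b where b: "b \<in> B'" "?X b \<noteq> 0" by blast
  note ex = independent_exchange[OF fin B'(3) _ x(1) b(2)]
  have bC: "b \<in> C \<union> B'" using b by simp
  have eq: "insert x (C \<union> B' - {b}) = insert x C \<union> (B' - {b})" using B' b by auto
  have "combos F (C \<union> B') \<subseteq> combos F (insert x (C \<union> B' - {b}))"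
  proof
    fix y assume "y \<in> combos F (C \<union> B')"
    then have y: "y \<in> span (C \<union> B')" "\<And>t. t \<in> C \<union> B' \<Longrightarrow> representation (C \<union> B') y t \<in> F"
      using combos_iff_representation[OF fin B'(3), of y F] by auto
    show "y \<in> combos F (insert x (C \<union> B' - {b}))"
      using y x(2) b(1) fin ex(2-5)[OF bC]
      by (subst combos_iff_representation) (auto intro!: divide_mem mult_mem diff_mem)
  qed
  moreover have "insert x C \<inter> (B' - {b}) = {}"
    using ex(1)[OF bC] B' by auto
  ultimately show ?case
    using B' ex(2)[OF bC] eq by (intro exI[of _ "B' - {b}"]) auto
qed

text \<open>Complete \<open>C\<close> to a real independent set over which all of
  \<open>combos F B\<close> has coordinates in \<open>F\<close>. By uniqueness of real coordinates,
  those of a vector in \<open>span C\<close> are its coordinates over \<open>C\<close>. This is the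
  bridge that permits real spans, dimensions and representations throughout.\<close>

lemma span_inter_combos:
  fixes B C :: "'a::real_vector set"
  assumes "finite B" "independent B" "finite C" "independent C" "C \<subseteq> combos F B"
  shows "span C \<inter> combos F B \<subseteq> combos F C"
proof
  fix x assume x: "x \<in> span C \<inter> combos F B"
  obtain B' where B': "B' \<subseteq> B" "independent (C \<union> B')" "combos F B \<subseteq> combos F (C \<union> B')"
    using steinitz[OF assms] by blast
  have fin: "finite (C \<union> B')" using finite_subset[OF B'(1) assms(1)] assms(3) by simp
  have "representation (C \<union> B') x = representation C x"
    using x B' by (intro real_vector.representation_extend) auto
  then show "x \<in> combos F C"
    using x B' combos_iff_representation[OF fin B'(2), of x F]
      combos_iff_representation[OF assms(3,4), of x F] by auto
qed

end

section \<open>Faces of a cone with Riesz decomposition\<close>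

text \<open>\<open>B\<close> is independent over the reals while \<open>P\<close> consists of
  combinations over \<open>F\<close>, so \<open>combos F B\<close> is an \<open>F\<close>-form of
  \<open>span B\<close>. Riesz decomposition is assumed in place of interpolation because it is the
  form that splits elements along sums of faces.\<close>

locale riesz_cone = real_subfield F for F +
  fixes B P :: "'a::real_vector set"
  assumes finite_B: "finite B" and independent_B: "independent B"
    and P_subset: "P \<subseteq> combos F B"
    and zero_P: "0 \<in> P"
    and add_P: "x \<in> P \<Longrightarrow> y \<in> P \<Longrightarrow> x + y \<in> P"
    and scale_P: "c \<in> Fpos \<Longrightarrow> x \<in> P \<Longrightarrow> c *\<^sub>R x \<in> P"
    and pointed: "x \<in> P \<Longrightarrow> - x \<in> P \<Longrightarrow> x = 0"
    and decomposition: "x \<in> P \<Longrightarrow> y \<in> P \<Longrightarrow> z \<in> P \<Longrightarrow> y + z - x \<in> P \<Longrightarrow>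
      \<exists>y' z'. x = y' + z' \<and> y' \<in> P \<and> z' \<in> P \<and> y - y' \<in> P \<and> z - z' \<in> P"
begin

lemma sum_P: "(\<And>i. i \<in> I \<Longrightarrow> f i \<in> P) \<Longrightarrow> sum f I \<in> P"
  by (induction I rule: infinite_finite_induct) (auto intro: zero_P add_P)

text \<open>Heredity for one summand suffices, as addition commutes. Closure under scalars is not
  imposed: \<open>face_scale\<close> derives it from \<open>c *\<^sub>R x\<close> being dominated by
  an integer multiple of \<open>x\<close>.\<close>

definition face :: "'a set \<Rightarrow> bool"
  where "face Q \<longleftrightarrow> Q \<subseteq> P \<and> 0 \<in> Q \<and> (\<forall>x\<in>Q. \<forall>y\<in>Q. x + y \<in> Q) \<and>
    (\<forall>x\<in>P. \<forall>y\<in>P. x + y \<in> Q \<longrightarrow> x \<in> Q)"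

lemma faceD:
  assumes "face Q"
  shows "x \<in> Q \<Longrightarrow> x \<in> P" "0 \<in> Q" "x \<in> Q \<Longrightarrow> y \<in> Q \<Longrightarrow> x + y \<in> Q"
proof -
  note f = assms[unfolded face_def]
  show "x \<in> Q \<Longrightarrow> x \<in> P" using conjunct1[OF f] by (rule subsetD)
  show "0 \<in> Q" using f by (elim conjE)
  show "x \<in> Q \<Longrightarrow> y \<in> Q \<Longrightarrow> x + y \<in> Q"
    using f[THEN conjunct2, THEN conjunct2, THEN conjunct1] by simp
qed

lemma face_le:
  assumes "face Q" "y \<in> Q" "x \<in> P" "y - x \<in> P"
  shows "x \<in> Q"
proof -
  have "x + (y - x) \<in> Q" using assms(2) by simp
  then show ?thesis
    using assms(3,4) assms(1)[unfolded face_def, THEN conjunct2, THEN conjunct2, THEN conjunct2] by blast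
qed

lemma face_sum_mem:
  assumes "face Q" "\<And>i. i \<in> I \<Longrightarrow> f i \<in> Q"
  shows "sum f I \<in> Q"
  using assms(2)
  by (induction I rule: infinite_finite_induct) (simp_all add: faceD(2,3)[OF assms(1)])

lemma face_scale:
  assumes "face Q" "c \<in> Fpos" "x \<in> Q"
  shows "c *\<^sub>R x \<in> Q"
proof -
  obtain n :: nat where n: "c \<le> n" using real_arch_simple by blast
  have 1: "real n *\<^sub>R x \<in> Q"
    by (induction n) (simp_all add: scaleR_add_left faceD(2,3)[OF assms(1)] assms(3))
  have 2: "real n *\<^sub>R x - c *\<^sub>R x \<in> P"
    unfolding scaleR_diff_left[symmetric]
    by (rule scale_P) (use assms n in \<open>auto intro: faceD diff_mem of_nat_mem\<close>)
  have "c *\<^sub>R x \<in> P" using assms(2,3) faceD(1)[OF assms(1)] by (intro scale_P) auto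
  then show ?thesis by (rule face_le[OF assms(1) 1 _ 2])
qed

lemma faceI:
  assumes "Q \<subseteq> P" "0 \<in> Q" "\<And>x y. x \<in> Q \<Longrightarrow> y \<in> Q \<Longrightarrow> x + y \<in> Q"
    and "\<And>x y. x \<in> P \<Longrightarrow> y \<in> P \<Longrightarrow> x + y \<in> Q \<Longrightarrow> x \<in> Q"
  shows "face Q"
  unfolding face_def using assms by blast

lemma face_zero: "face {0}"
proof -
  have "x = 0" if "x \<in> P" "y \<in> P" "x + y = 0" for x y
    using that pointed[of x] by (simp add: add_eq_0_iff)
  then show ?thesis using zero_P by (intro faceI) auto
qed

lemma face_P: "face P"
  by (rule faceI) (auto intro: zero_P add_P)

lemma face_add_cancel:
  assumes "face Q" "x \<in> P" "y \<in> P" "x + y \<in> Q"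
  shows "x \<in> Q"
  using face_le[OF assms(1,4,2)] assms(3) by simp

lemma face_Int:
  assumes "face Q" "face R"
  shows "face (Q \<inter> R)"
proof (rule faceI)
  show "Q \<inter> R \<subseteq> P" using faceD(1)[OF assms(1)] by blast
  show "0 \<in> Q \<inter> R" using faceD(2)[OF assms(1)] faceD(2)[OF assms(2)] by blast
  show "x + y \<in> Q \<inter> R" if "x \<in> Q \<inter> R" "y \<in> Q \<inter> R" for x y
    using that faceD(3)[OF assms(1)] faceD(3)[OF assms(2)] by blast
  show "x \<in> Q \<inter> R" if "x \<in> P" "y \<in> P" "x + y \<in> Q \<inter> R" for x y
    using that(3) face_add_cancel[OF assms(1) that(1,2)] face_add_cancel[OF assms(2) that(1,2)] by blast
qed

text \<open>Heredity is Riesz decomposition: \<open>u\<close> below \<open>x + y\<close> splits into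
  a part below \<open>x\<close> and a part below \<open>y\<close>, which lie in the respective
  faces.\<close>

lemma face_plus:
  assumes "face Q" "face R"
  shows "face {x + y | x y. x \<in> Q \<and> y \<in> R}"
proof (rule faceI)
  show "{x + y |x y. x \<in> Q \<and> y \<in> R} \<subseteq> P"
    using faceD(1)[OF assms(1)] faceD(1)[OF assms(2)] by (auto intro: add_P)
  show "0 \<in> {x + y |x y. x \<in> Q \<and> y \<in> R}"
    using faceD(2)[OF assms(1)] faceD(2)[OF assms(2)] by force
next
  fix u v assume "u \<in> {x + y |x y. x \<in> Q \<and> y \<in> R}" "v \<in> {x + y |x y. x \<in> Q \<and> y \<in> R}"
  then obtain x y x' y' where "u = x + y" "v = x' + y'" "x \<in> Q" "y \<in> R" "x' \<in> Q" "y' \<in> R" by blast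
  then have "u + v = (x + x') + (y + y')" "x + x' \<in> Q" "y + y' \<in> R"
    using faceD(3)[OF assms(1)] faceD(3)[OF assms(2)] by auto
  then show "u + v \<in> {x + y |x y. x \<in> Q \<and> y \<in> R}" by blast
next
  fix u v assume uv: "u \<in> P" "v \<in> P" and "u + v \<in> {x + y |x y. x \<in> Q \<and> y \<in> R}"
  then obtain x y where xy: "u + v = x + y" "x \<in> Q" "y \<in> R" by blast
  have "x + y - u \<in> P" using uv xy(1) by (metis add_diff_cancel_left')
  then obtain x' y' where "u = x' + y'" "x' \<in> P" "y' \<in> P" "x - x' \<in> P" "y - y' \<in> P"
    using decomposition[OF uv(1) faceD(1)[OF assms(1) xy(2)] faceD(1)[OF assms(2) xy(3)]] by blast
  then show "u \<in> {x + y |x y. x \<in> Q \<and> y \<in> R}"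
    using face_le[OF assms(1) xy(2)] face_le[OF assms(2) xy(3)] by blast
qed

text \<open>The face generated by \<open>Q\<close> and \<open>p\<close>, described through
  domination by multiples of \<open>p\<close> plus elements of \<open>Q\<close>.\<close>

definition face_gen :: "'a set \<Rightarrow> 'a \<Rightarrow> 'a set"
  where "face_gen Q p = {x \<in> P. \<exists>n::nat. \<exists>q\<in>Q. real n *\<^sub>R p + q - x \<in> P}"

lemma face_gen:
  assumes Q: "face Q" and p: "p \<in> P"
  shows "face (face_gen Q p)" "Q \<subseteq> face_gen Q p" "p \<in> face_gen Q p"
proof -
  show sub: "Q \<subseteq> face_gen Q p"
  proof
    fix x assume x: "x \<in> Q"
    then have "real 0 *\<^sub>R p + x - x \<in> P" using zero_P by simp
    then show "x \<in> face_gen Q p" using x faceD[OF Q] unfolding face_gen_def by blast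
  qed
  have "real 1 *\<^sub>R p + 0 - p \<in> P" using zero_P by simp
  then show "p \<in> face_gen Q p" using p faceD(2)[OF Q] unfolding face_gen_def by blast
  show "face (face_gen Q p)"
  proof (rule faceI)
    show "face_gen Q p \<subseteq> P" by (auto simp: face_gen_def)
    show "0 \<in> face_gen Q p" using sub faceD(2)[OF Q] by blast
  next
    fix x y assume "x \<in> face_gen Q p" "y \<in> face_gen Q p"
    then obtain n q m r where *: "x \<in> P" "y \<in> P" "q \<in> Q" "r \<in> Q" "real n *\<^sub>R p + q - x \<in> P"
      "real m *\<^sub>R p + r - y \<in> P" unfolding face_gen_def by blast
    have "real (n + m) *\<^sub>R p + (q + r) - (x + y) \<in> P"
      using add_P[OF *(5,6)] by (simp add: algebra_simps)
    then show "x + y \<in> face_gen Q p"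
      using * add_P faceD(3)[OF Q] unfolding face_gen_def by blast
  next
    fix x y assume xy: "x \<in> P" "y \<in> P" "x + y \<in> face_gen Q p"
    then obtain n q where *: "q \<in> Q" "real n *\<^sub>R p + q - (x + y) \<in> P"
      unfolding face_gen_def by blast
    have "real n *\<^sub>R p + q - x \<in> P" using add_P[OF *(2) xy(2)] by (simp add: algebra_simps)
    then show "x \<in> face_gen Q p" using xy * unfolding face_gen_def by blast
  qed
qed

section \<open>Linear spans, dimensions and finiteness of the set of faces\<close>

lemma F_subspace_differences:
  assumes "face Q"
  shows "F_subspace {x - y | x y. x \<in> Q \<and> y \<in> Q}" (is "F_subspace ?D")
  unfolding F_subspace_def
proof (intro conjI ballI)
  show "0 \<in> ?D" using faceD(2)[OF assms] by force
next
  fix u v assume "u \<in> ?D" "v \<in> ?D"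
  then obtain x y x' y' where "u = x - y" "v = x' - y'" "x \<in> Q" "y \<in> Q" "x' \<in> Q" "y' \<in> Q" by blast
  then have "u + v = (x + x') - (y + y')" "x + x' \<in> Q" "y + y' \<in> Q"
    using faceD(3)[OF assms] by auto
  then show "u + v \<in> ?D" by blast
next
  fix c u assume c: "c \<in> F" and "u \<in> ?D"
  then obtain x y where u: "u = x - y" "x \<in> Q" "y \<in> Q" by blast
  show "c *\<^sub>R u \<in> ?D"
  proof (cases "c \<ge> 0")
    case True
    then have "c *\<^sub>R u = c *\<^sub>R x - c *\<^sub>R y" "c *\<^sub>R x \<in> Q" "c *\<^sub>R y \<in> Q"
      using u c by (auto simp: scaleR_diff_right intro: face_scale assms)
    then show ?thesis by blast
  next
    case False
    then have "- c \<in> Fpos" using c by (simp add: uminus_mem)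
    then have "(-c) *\<^sub>R x \<in> Q" "(-c) *\<^sub>R y \<in> Q"
      using u face_scale[OF assms] by blast+
    moreover have "c *\<^sub>R u = (-c) *\<^sub>R y - (-c) *\<^sub>R x" by (simp add: u scaleR_diff_right)
    ultimately show ?thesis by blast
  qed
qed

lemma face_subset:
  assumes "face Q"
  shows "Q \<subseteq> combos F B" "Q \<subseteq> span B"
  using faceD(1)[OF assms] P_subset combos_subset_span[of F B] by blast+

lemma face_basis:
  assumes "face Q" "C0 \<subseteq> Q" "independent C0"
  obtains C where "C0 \<subseteq> C" "C \<subseteq> Q" "finite C" "independent C" "Q \<subseteq> combos F C" "dim Q = card C"
    "span C = span Q"
proof -
  obtain C where C: "C0 \<subseteq> C" "C \<subseteq> Q" "independent C" "Q \<subseteq> span C"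
    using real_vector.maximal_independent_subset_extend[OF assms(2,3)] by blast
  have "C \<subseteq> span B" using C(2) face_subset(2)[OF assms(1)] by blast
  then have fin: "finite C" using real_vector.independent_span_bound[OF finite_B C(3)] by blast
  have "span C \<inter> combos F B \<subseteq> combos F C"
    using C(2) face_subset(1)[OF assms(1)]
    by (intro span_inter_combos finite_B independent_B fin C) blast
  then have "Q \<subseteq> combos F C" using C(4) face_subset(1)[OF assms(1)] by blast
  moreover have "dim Q = card C" using real_vector.basis_card_eq_dim[OF C(2,4,3)] by simp
  moreover have "span C = span Q" using C(2,4) span_mono[of C Q] span_minimal[of Q "span C"] by auto
  ultimately show thesis using that C fin by blast
qed

text \<open>A basis of \<open>Q\<close> inside \<open>Q\<close> gives coordinates in
  \<open>F\<close>, and the differences of elements of \<open>Q\<close> form an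
  \<open>F\<close>-subspace. Thus membership in a real span is turned back into an order
  statement.\<close>

lemma span_face_differences:
  assumes "face Q" "x \<in> span Q" "x \<in> combos F B"
  obtains a b where "a \<in> Q" "b \<in> Q" "x = a - b"
proof -
  obtain C where C: "C \<subseteq> Q" "finite C" "independent C" "Q \<subseteq> combos F C" "span C = span Q"
    using face_basis[OF assms(1) empty_subsetI real_vector.independent_empty] by metis
  have "x \<in> combos F C"
    using span_inter_combos[OF finite_B independent_B C(2,3)] C(1,5) face_subset(1)[OF assms(1)] assms
    by blast
  moreover have "combos F C \<subseteq> {x - y | x y. x \<in> Q \<and> y \<in> Q}"
  proof (rule combos_F_least[OF F_subspace_differences[OF assms(1)]])
    show "C \<subseteq> {x - y |x y. x \<in> Q \<and> y \<in> Q}"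
      using C(1) faceD(2)[OF assms(1)] by force
  qed
  ultimately show thesis using that by blast
qed

text \<open>If \<open>x = a - b\<close> with \<open>a\<close> and \<open>b\<close> in
  \<open>Q\<close>, then \<open>x\<close> lies below \<open>a\<close>. Hence a face is recovered
  from its real span, and proper inclusions of faces raise the dimension.\<close>

lemma face_mem_span: "face Q \<Longrightarrow> x \<in> P \<Longrightarrow> x \<in> span Q \<Longrightarrow> x \<in> Q"
proof -
  assume Q: "face Q" and x: "x \<in> P" "x \<in> span Q"
  obtain a b where ab: "a \<in> Q" "b \<in> Q" "x = a - b"
    using span_face_differences[OF Q x(2)] x(1) P_subset by blast
  then have "a - x \<in> P" using faceD[OF Q] by simp
  then show "x \<in> Q" using face_le[OF Q ab(1) x(1)] by blast
qed

lemma dim_face_less: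
  assumes "face Q" "face R" "Q \<subset> R"
  shows "dim Q < dim R"
proof -
  obtain C where C: "C \<subseteq> Q" "finite C" "independent C" "dim Q = card C" "span C = span Q"
    using face_basis[OF assms(1) empty_subsetI real_vector.independent_empty] by metis
  obtain D where D: "finite D" "R \<subseteq> combos F D" "dim R = card D"
    using face_basis[OF assms(2) empty_subsetI real_vector.independent_empty] by metis
  obtain x where x: "x \<in> R" "x \<notin> Q" using assms(3) by blast
  have "x \<notin> span C" using face_mem_span[OF assms(1), of x] x faceD[OF assms(2)] C(5) by blast
  moreover have "insert x C \<subseteq> span D"
    using C(1) x assms(3) D(2) combos_subset_span[of F D] by blast
  ultimately have "card (insert x C) \<le> card D"
    using real_vector.independent_span_bound[OF D(1)] real_vector.independent_insertI C(3) by metis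
  moreover have "x \<notin> C" using x C by blast
  ultimately show ?thesis using C D by simp
qed

lemma dim_face_le: "face Q \<Longrightarrow> dim Q \<le> card B"
  by (rule real_vector.dim_le_card[OF face_subset(2) finite_B])

definition maximal_face :: "'a set \<Rightarrow> 'a set \<Rightarrow> bool"
  where "maximal_face M Q \<longleftrightarrow> face M \<and> M \<subset> Q \<and> (\<forall>R. face R \<longrightarrow> M \<subset> R \<longrightarrow> R \<subseteq> Q \<longrightarrow> R = Q)"

lemma maximal_face_exists:
  assumes Q: "face Q" "Q \<noteq> {0}"
  obtains M where "maximal_face M Q"
proof -
  have "{0} \<subset> Q" using Q faceD(2)[OF Q(1)] by blast
  moreover have "dim R < Suc (card B)" if "face R" for R using dim_face_le[OF that] by simp
  ultimately have "\<exists>M. (face M \<and> M \<subset> Q) \<and> (\<forall>R. face R \<and> R \<subset> Q \<longrightarrow> dim R \<le> dim M)"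
    using face_zero by (intro ex_has_greatest_nat[of _ "{0}" _ "Suc (card B)"]) simp_all
  then obtain M where M: "face M" "M \<subset> Q" "\<And>R. face R \<Longrightarrow> R \<subset> Q \<Longrightarrow> dim R \<le> dim M"
    by blast
  have "maximal_face M Q"
    unfolding maximal_face_def
  proof (intro conjI allI impI M)
    fix R assume R: "face R" "M \<subset> R" "R \<subseteq> Q"
    have "dim M < dim R" by (rule dim_face_less[OF M(1) R(1,2)])
    then show "R = Q" using M(3)[OF R(1)] R(3) by fastforce
  qed
  then show thesis by (rule that)
qed

text \<open>The sum of \<open>R\<close> and \<open>M\<close> is a face between \<open>M\<close> and
  \<open>Q\<close> that differs from \<open>M\<close>, so maximality makes it all of
  \<open>Q\<close>.\<close>

lemma maximal_face_plus:
  assumes M: "maximal_face M Q" and Q: "face Q" and R: "face R" "R \<subseteq> Q" "\<not> R \<subseteq> M"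
    and x: "x \<in> Q"
  obtains r m where "r \<in> R" "m \<in> M" "x = r + m"
proof -
  have fM: "face M" "M \<subseteq> Q" using M by (auto simp: maximal_face_def)
  define S where "S = {x + y | x y. x \<in> R \<and> y \<in> M}"
  have 1: "face S" unfolding S_def by (rule face_plus[OF R(1) fM(1)])
  have 2: "M \<subseteq> S" using faceD(2)[OF R(1)] by (force simp: S_def)
  have "R \<subseteq> S" using faceD(2)[OF fM(1)] by (force simp: S_def)
  then have 3: "M \<subset> S" using R(3) 2 by blast
  have 4: "S \<subseteq> Q"
  proof
    fix z assume "z \<in> S"
    then obtain a b where "a \<in> R" "b \<in> M" "z = a + b" by (auto simp: S_def)
    then show "z \<in> Q" using faceD(3)[OF Q, of a b] R(2) fM(2) by auto
  qed
  have "S = Q"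
    using M 1 3 4 unfolding maximal_face_def by simp
  then obtain a b where "a \<in> R" "b \<in> M" "x = a + b" using x by (auto simp: S_def)
  then show thesis by (rule that)
qed

text \<open>A face \<open>R\<close> of \<open>Q\<close> is determined by its trace on a maximal face
  \<open>M\<close> together with whether \<open>R\<close> lies in \<open>M\<close>; the traces are
  finitely many by induction on the dimension.\<close>

lemma finite_faces:
  assumes "face Q"
  shows "finite {R. face R \<and> R \<subseteq> Q}"
  using assms
proof (induction "dim Q" arbitrary: Q rule: less_induct)
  case less
  show ?case
  proof (cases "Q = {0}")
    case True
    then have "{R. face R \<and> R \<subseteq> Q} \<subseteq> {{0}}" using faceD(2) by blast
    then show ?thesis using finite_subset by blast
  next
    case False
    obtain M where M: "maximal_face M Q" using maximal_face_exists[OF less.prems False] .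
    then have fM: "face M" "M \<subset> Q" by (auto simp: maximal_face_def)
    have fin: "finite {R. face R \<and> R \<subseteq> M}"
      using less.hyps[OF dim_face_less[OF fM(1) less.prems fM(2)] fM(1)] .
    let ?f = "\<lambda>R. (R \<inter> M, R \<subseteq> M)"
    have key: "R \<subseteq> S" if R: "face R" "R \<subseteq> Q" and S: "face S" "S \<subseteq> Q" and eq: "?f R = ?f S" for R S
    proof (cases "S \<subseteq> M")
      case True
      then show ?thesis using eq by auto
    next
      case False
      show ?thesis
      proof
        fix x assume x: "x \<in> R"
        obtain s m where sm: "s \<in> S" "m \<in> M" "x = s + m"
          using maximal_face_plus[OF M less.prems S False] x R by blast
        \<comment> \<open>\<open>m\<close> lies below \<open>x\<close>, so it belongs to
          \<open>R\<close> and to \<open>M\<close>; equality of the traces then carries it into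
          \<open>S\<close>.\<close>
        have "m \<in> R"
          by (rule face_le[OF R(1) x]) (use sm faceD[OF fM(1)] faceD[OF S(1)] in auto)
        then have "m \<in> S" using eq sm by auto
        then show "x \<in> S" using sm faceD(3)[OF S(1)] by simp
      qed
    qed
    have "inj_on ?f {R. face R \<and> R \<subseteq> Q}"
      using key by (intro inj_onI) (metis (mono_tags, lifting) mem_Collect_eq subset_antisym)
    moreover have "?f ` {R. face R \<and> R \<subseteq> Q} \<subseteq> {R. face R \<and> R \<subseteq> M} \<times> UNIV"
      using face_Int fM(1) by auto
    ultimately show ?thesis
      using fin by (meson finite_SigmaI finite_UNIV finite_imageD finite_subset)
  qed
qed

end

section \<open>States modulo a maximal face\<close>

locale maximal_face_pair = riesz_cone +
  fixes Q M
  assumes Q: "face Q" and M: "maximal_face M Q"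
begin

lemma face_M: "face M" and M_subset: "M \<subseteq> Q"
  using M by (auto simp: maximal_face_def)

text \<open>The face generated by \<open>M\<close> and \<open>s\<close>, cut down to
  \<open>Q\<close>, properly contains \<open>M\<close> and hence equals \<open>Q\<close>.\<close>

lemma order_unit:
  assumes "s \<in> Q" "s \<notin> M" "x \<in> Q"
  obtains n :: nat and m where "m \<in> M" "real n *\<^sub>R s + m - x \<in> Q"
proof -
  have s: "s \<in> P" using assms(1) faceD(1)[OF Q] by blast
  note g = face_gen[OF face_M s]
  have "face_gen M s \<inter> Q = Q"
  proof -
    have 1: "face (face_gen M s \<inter> Q)" by (rule face_Int[OF g(1) Q])
    have 2: "M \<subset> face_gen M s \<inter> Q" using g(2,3) assms(1,2) M_subset by blast
    have 3: "face_gen M s \<inter> Q \<subseteq> Q" by blast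
    show ?thesis using M 1 2 3 unfolding maximal_face_def by simp
  qed
  then have "x \<in> face_gen M s" using assms(3) by blast
  then obtain n :: nat and m where nm: "m \<in> M" "real n *\<^sub>R s + m - x \<in> P"
    unfolding face_gen_def by blast
  have "real n *\<^sub>R s \<in> Q" using face_scale[OF Q _ assms(1)] of_nat_mem by simp
  then have "real n *\<^sub>R s + m \<in> Q" using faceD(3)[OF Q] nm(1) M_subset by blast
  then have "real n *\<^sub>R s + m - x \<in> Q"
    by (rule face_le[OF Q]) (use nm(2) faceD(1)[OF Q assms(3)] in simp_all)
  then show thesis using that nm(1) by blast
qed

text \<open>Additivity and nonnegativity give monotonicity, and monotonicity with rational bounds on
  \<open>c\<close> forces homogeneity. This lets states be constructed by checking additivity
  alone.\<close>

lemma additive_scale: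
  assumes add: "\<And>x y. x \<in> Q \<Longrightarrow> y \<in> Q \<Longrightarrow> f (x + y) = f x + f y"
    and nonneg: "\<And>x. x \<in> Q \<Longrightarrow> (0::real) \<le> f x" and x: "x \<in> Q" and c: "c \<in> Fpos"
  shows "f (c *\<^sub>R x) = c * f x"
proof -
  have nat_scale: "f (real n *\<^sub>R y) = real n * f y" if y: "y \<in> Q" for n y
  proof (induction n)
    case 0
    show ?case using add[of 0 0] faceD(2)[OF Q] by simp
  next
    case (Suc n)
    have "real n *\<^sub>R y \<in> Q" using face_scale[OF Q _ y] of_nat_mem by simp
    then show ?case using add[OF y, of "real n *\<^sub>R y"] Suc by (simp add: scaleR_add_left algebra_simps)
  qed
  have mono: "f (a *\<^sub>R x) \<le> f (b *\<^sub>R x)" if "a \<in> Fpos" "b \<in> F" "a \<le> b" for a b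
  proof -
    have "a *\<^sub>R x \<in> Q" "(b - a) *\<^sub>R x \<in> Q"
      using that by (auto intro!: face_scale[OF Q _ x] diff_mem)
    then show ?thesis
      using add[of "a *\<^sub>R x" "(b - a) *\<^sub>R x"] nonneg[of "(b - a) *\<^sub>R x"]
      by (simp add: scaleR_add_left[symmetric])
  qed
  have "\<bar>f (c *\<^sub>R x) - c * f x\<bar> * real n \<le> f x" for n
  proof -
    \<comment> \<open>Both \<open>n * f (c *\<^sub>R x)\<close> and \<open>n * c * f x\<close> lie
      between \<open>k * f x\<close> and \<open>(k + 1) * f x\<close>, so the defect times
      \<open>n\<close> is bounded independently of \<open>n\<close>.\<close>
    define k where "k = nat \<lfloor>real n * c\<rfloor>"
    have k: "real k \<le> real n * c" "real n * c \<le> real (Suc k)"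
      using c unfolding k_def by (auto simp: of_nat_nat) linarith
    have nc: "real n * c \<in> F" using c of_nat_mem mult_mem by simp
    have eq: "f ((real n * c) *\<^sub>R x) = real n * f (c *\<^sub>R x)"
      using nat_scale[OF face_scale[OF Q c x], of n] by simp
    have 1: "real k * f x \<le> real n * f (c *\<^sub>R x)"
      using mono[of "real k" "real n * c"] k nc of_nat_mem[of k] nat_scale[OF x] eq by simp
    have "f ((real n * c) *\<^sub>R x) \<le> f (real (Suc k) *\<^sub>R x)"
      by (rule mono) (use k nc of_nat_mem[of "Suc k"] c in auto)
    then have 2: "real n * f (c *\<^sub>R x) \<le> real (Suc k) * f x"
      using nat_scale[OF x, of "Suc k"] eq by simp
    have 3: "real k * f x \<le> real n * c * f x" "real n * c * f x \<le> real (Suc k) * f x"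
      using k nonneg[OF x] by (auto intro!: mult_right_mono simp del: of_nat_Suc)
    have "\<bar>real n * f (c *\<^sub>R x) - real n * c * f x\<bar> \<le> f x"
      using 1 2 3 by (simp add: algebra_simps)
    moreover have "real n * f (c *\<^sub>R x) - real n * c * f x = (f (c *\<^sub>R x) - c * f x) * real n"
      by (simp add: algebra_simps)
    ultimately show ?thesis by (simp add: abs_mult)
  qed
  then have "\<bar>f (c *\<^sub>R x) - c * f x\<bar> \<le> 0"
    by (metis abs_ge_zero linorder_not_le ex_less_of_nat_mult mult.commute less_le_not_le)
  then show ?thesis by simp
qed

text \<open>Extend the values on a basis of \<open>Q\<close> chosen inside \<open>Q\<close>.
  Agreement on all of \<open>Q\<close> needs an argument, since elements of \<open>Q\<close> may
  have negative coordinates in that basis.\<close>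

lemma linear_extension:
  assumes add: "\<And>x y. x \<in> Q \<Longrightarrow> y \<in> Q \<Longrightarrow> f (x + y) = f x + f y"
    and nonneg: "\<And>x. x \<in> Q \<Longrightarrow> (0::real) \<le> f x"
  obtains g where "linear g" "\<And>x. x \<in> Q \<Longrightarrow> g x = f x"
proof -
  obtain C where C: "C \<subseteq> Q" "finite C" "independent C" "Q \<subseteq> combos F C"
    using face_basis[OF Q empty_subsetI real_vector.independent_empty] by metis
  obtain g :: "'a \<Rightarrow> real" where g: "linear g" "\<And>x. x \<in> C \<Longrightarrow> g x = f x"
    using real_vector.linear_independent_extend[OF C(3), of f] by blast
  have sum: "f (\<Sum>c\<in>D. r c *\<^sub>R c) = (\<Sum>c\<in>D. r c * f c)"
    if "finite D" "D \<subseteq> C" "\<And>c. r c \<in> Fpos" for D r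
    using that(1,2)
  proof (induction D rule: finite_induct)
    case empty
    show ?case using add[of 0 0] faceD(2)[OF Q] by simp
  next
    case (insert d D)
    have d: "r d *\<^sub>R d \<in> Q" using face_scale[OF Q that(3)] insert C(1) by blast
    have "(\<Sum>c\<in>D. r c *\<^sub>R c) \<in> Q"
      by (rule face_sum_mem[OF Q]) (use face_scale[OF Q that(3)] insert C(1) in blast)
    then show ?case
      using add[OF d] insert additive_scale[of f, OF add nonneg _ that(3), of d] C(1) by auto
  qed
  have "g x = f x" if x: "x \<in> Q" for x
  proof -
    obtain a where a: "\<forall>c\<in>C. a c \<in> F" "x = (\<Sum>c\<in>C. a c *\<^sub>R c)"
      using C(4) x combosE[of x F C] by blast
    \<comment> \<open>Positive and negative parts of the coordinates. Moving the negative part to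
      the other side leaves an equation between elements of \<open>Q\<close>, to which additivity of
      \<open>f\<close> applies.\<close>
    define a1 where "a1 c = (if c \<in> C then max (a c) 0 else 0)" for c
    define a2 where "a2 c = (if c \<in> C then max (- a c) 0 else 0)" for c
    have F: "a1 c \<in> Fpos" "a2 c \<in> Fpos" for c
      using a(1) by (auto simp: a1_def a2_def max_def zero_mem uminus_mem)
    have diff: "a c = a1 c - a2 c" if "c \<in> C" for c using that by (auto simp: a1_def a2_def)
    have mem: "(\<Sum>c\<in>C. a2 c *\<^sub>R c) \<in> Q"
      by (rule face_sum_mem[OF Q]) (use face_scale[OF Q F(2)] C(1) in blast)
    have eq: "x + (\<Sum>c\<in>C. a2 c *\<^sub>R c) = (\<Sum>c\<in>C. a1 c *\<^sub>R c)"
      using a(2) diff by (simp add: scaleR_diff_left sum_subtractf)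
    have "f x + (\<Sum>c\<in>C. a2 c * f c) = (\<Sum>c\<in>C. a1 c * f c)"
      using add[OF x mem] unfolding eq using sum[OF C(2), of a1] sum[OF C(2), of a2] F by simp
    then have "f x = (\<Sum>c\<in>C. a c * f c)"
      using diff by (simp add: left_diff_distrib sum_subtractf)
    also have "\<dots> = g x"
      using g by (simp add: a(2) linear_sum linear_scale)
    finally show ?thesis by simp
  qed
  then show thesis using that g(1) by blast
qed

text \<open>States are not normalised, so they form a cone. They are real linear on the whole type,
  but only their values on \<open>Q\<close> carry information.\<close>

definition state :: "('a \<Rightarrow> real) \<Rightarrow> bool"
  where "state \<phi> \<longleftrightarrow> linear \<phi> \<and> (\<forall>x\<in>Q. 0 \<le> \<phi> x) \<and> (\<forall>x\<in>M. \<phi> x = 0)"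

lemma stateD:
  assumes "state \<phi>"
  shows "linear \<phi>" "x \<in> Q \<Longrightarrow> 0 \<le> \<phi> x" "x \<in> M \<Longrightarrow> \<phi> x = 0" "\<phi> (x + y) = \<phi> x + \<phi> y"
    "\<phi> (x - y) = \<phi> x - \<phi> y" "\<phi> (c *\<^sub>R x) = c * \<phi> x"
  using assms by (auto simp: state_def linear_add linear_diff linear_scale)

lemma state_mono: "state \<phi> \<Longrightarrow> y - x \<in> Q \<Longrightarrow> \<phi> x \<le> \<phi> y"
  using stateD(2)[of \<phi> "y - x"] stateD(5)[of \<phi> y x] by simp

text \<open>The infimum is given by the Riesz-Kantorovich formula.\<close>

lemma state_inf:
  assumes \<phi>: "state \<phi>" and \<psi>: "state \<psi>"
  obtains \<theta> where "state \<theta>" "\<And>x. x \<in> Q \<Longrightarrow> \<theta> x \<le> \<phi> x" "\<And>x. x \<in> Q \<Longrightarrow> \<theta> x \<le> \<psi> x"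
    "\<And>x e. x \<in> Q \<Longrightarrow> 0 < e \<Longrightarrow> \<exists>a\<in>Q. \<exists>b\<in>Q. x = a + b \<and> \<phi> a + \<psi> b < \<theta> x + e"
proof -
  define S where "S x = {\<phi> a + \<psi> b | a b. a \<in> Q \<and> b \<in> Q \<and> x = a + b}" for x
  define f where "f x = Inf (S x)" for x
  have zero: "0 \<in> Q" by (rule faceD(2)[OF Q])
  have ne: "\<phi> x \<in> S x" "\<psi> x \<in> S x" if "x \<in> Q" for x
    using that zero stateD(6)[OF \<phi>, of 0 0] stateD(6)[OF \<psi>, of 0 0] unfolding S_def by force+
  have pos: "0 \<le> s" if "s \<in> S x" for s x
    using that stateD(2)[OF \<phi>] stateD(2)[OF \<psi>] by (auto simp: S_def)
  have bdd: "bdd_below (S x)" for x using pos by (meson bdd_belowI)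
  have nonneg: "0 \<le> f x" if "x \<in> Q" for x
    unfolding f_def by (rule cInf_greatest) (use ne[OF that] pos in auto)
  have le: "f x \<le> \<phi> x" "f x \<le> \<psi> x" if "x \<in> Q" for x
    unfolding f_def using ne[OF that] bdd by (auto intro: cInf_lower)
  have approx: "\<exists>a\<in>Q. \<exists>b\<in>Q. x = a + b \<and> \<phi> a + \<psi> b < f x + e" if "x \<in> Q" "0 < e" for x e
  proof -
    have "\<exists>s\<in>S x. s < f x + e"
      using cInf_lessD[of "S x" "f x + e"] ne(1)[OF that(1)] that(2) by (auto simp: f_def)
    then show ?thesis unfolding S_def by blast
  qed
  have add: "f (x + y) = f x + f y" if x: "x \<in> Q" and y: "y \<in> Q" for x y
  proof (rule antisym)
    show "f (x + y) \<le> f x + f y"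
    proof (rule field_le_epsilon)
      fix e :: real assume e: "0 < e"
      obtain a b where ab: "a \<in> Q" "b \<in> Q" "x = a + b" "\<phi> a + \<psi> b < f x + e / 2"
        using approx[OF x, of "e / 2"] e by auto
      obtain c d where cd: "c \<in> Q" "d \<in> Q" "y = c + d" "\<phi> c + \<psi> d < f y + e / 2"
        using approx[OF y, of "e / 2"] e by auto
      have "a + c \<in> Q" "b + d \<in> Q" "x + y = (a + c) + (b + d)"
        using faceD(3)[OF Q] ab cd by auto
      then have "\<phi> (a + c) + \<psi> (b + d) \<in> S (x + y)" unfolding S_def by blast
      then have "f (x + y) \<le> \<phi> (a + c) + \<psi> (b + d)" unfolding f_def by (rule cInf_lower[OF _ bdd])
      then show "f (x + y) \<le> f x + f y + e"
        using ab cd stateD(4)[OF \<phi>] stateD(4)[OF \<psi>] by simp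
    qed
    show "f x + f y \<le> f (x + y)"
      unfolding f_def[of "x + y"]
    proof (rule cInf_greatest)
      show "S (x + y) \<noteq> {}" using ne faceD(3)[OF Q x y] by blast
      fix s assume "s \<in> S (x + y)"
      then obtain a b where ab: "a \<in> Q" "b \<in> Q" "x + y = a + b" "s = \<phi> a + \<psi> b"
        unfolding S_def by blast
      \<comment> \<open>The step that needs Riesz decomposition: a splitting of \<open>x + y\<close>
        is refined to splittings of \<open>x\<close> and of \<open>y\<close> with the same total
        cost.\<close>
      have "a + b - x \<in> P" using ab(3)[symmetric] faceD(1)[OF Q y] by simp
      then obtain a' b' where *: "x = a' + b'" "a' \<in> P" "b' \<in> P" "a - a' \<in> P" "b - b' \<in> P"
        using decomposition[OF faceD(1)[OF Q x] faceD(1)[OF Q ab(1)] faceD(1)[OF Q ab(2)]] by blast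
      have Q': "a' \<in> Q" "b' \<in> Q" "a - a' \<in> Q" "b - b' \<in> Q"
        using face_le[OF Q ab(1), of a'] face_le[OF Q ab(2), of b']
          face_le[OF Q ab(1), of "a - a'"] face_le[OF Q ab(2), of "b - b'"] * by auto
      have "y = (a - a') + (b - b')" using ab(3) *(1) by (simp add: algebra_simps)
      then have "\<phi> a' + \<psi> b' \<in> S x" "\<phi> (a - a') + \<psi> (b - b') \<in> S y"
        using Q' *(1) unfolding S_def by blast+
      then have "f x \<le> \<phi> a' + \<psi> b'" "f y \<le> \<phi> (a - a') + \<psi> (b - b')"
        unfolding f_def using bdd by (auto intro: cInf_lower)
      then show "f x + f y \<le> s" using ab(4) stateD(5)[OF \<phi>] stateD(5)[OF \<psi>] by simp
    qed
  qed
  obtain g where g: "linear g" "\<And>x. x \<in> Q \<Longrightarrow> g x = f x"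
    using linear_extension[of f, OF add nonneg] by blast
  have "state g"
    unfolding state_def
  proof (intro conjI ballI g(1))
    show "0 \<le> g x" if "x \<in> Q" for x using g(2) nonneg that by simp
    show "g x = 0" if "x \<in> M" for x
      using le(1)[of x] nonneg[of x] stateD(3)[OF \<phi> that] M_subset g(2)[of x] that by fastforce
  qed
  then show thesis using that[of g] g(2) le approx by simp
qed

section \<open>Separation of elements modulo the maximal face by states\<close>

definition differences :: "'a set" where "differences = {a - b | a b. a \<in> Q \<and> b \<in> Q}"

text \<open>The nonnegative part of a vector preorder on \<open>Q - Q\<close> that extends the given
  order and makes the elements of \<open>M\<close> equivalent to 0.\<close>

definition preorder_cone :: "'a set \<Rightarrow> bool"
  where "preorder_cone R \<longleftrightarrow> R \<subseteq> differences \<and> Q \<subseteq> R \<and> uminus ` M \<subseteq> R \<and>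
    (\<forall>u\<in>R. \<forall>v\<in>R. u + v \<in> R) \<and> (\<forall>c\<in>Fpos. \<forall>u\<in>R. c *\<^sub>R u \<in> R)"

lemma preorder_coneD:
  assumes "preorder_cone R"
  shows "R \<subseteq> differences" "Q \<subseteq> R" "m \<in> M \<Longrightarrow> - m \<in> R" "u \<in> R \<Longrightarrow> v \<in> R \<Longrightarrow> u + v \<in> R"
    "c \<in> Fpos \<Longrightarrow> u \<in> R \<Longrightarrow> c *\<^sub>R u \<in> R"
  using assms unfolding preorder_cone_def by blast+

lemma F_subspace_diffs: "F_subspace differences"
  unfolding differences_def by (rule F_subspace_differences[OF Q])

lemma Q_subset_differences: "Q \<subseteq> differences"
  using faceD(2)[OF Q] unfolding differences_def by force

lemma mem_zero: "0 \<in> Q" "0 \<in> M" "0 \<in> Fpos" "1 \<in> Fpos"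
  using faceD(2) Q face_M zero_mem one_mem by auto

text \<open>The cone generated by \<open>Q\<close>, \<open>- M\<close> and \<open>y - x\<close>. It
  still omits \<open>- p\<close>, so \<open>p\<close> stays strictly positive even after
  \<open>x\<close> has been declared to lie below \<open>y\<close>.\<close>

lemma initial_cone:
  assumes p: "p \<in> Q" "p \<notin> M" and xy: "x \<in> Q" "y \<in> Q"
    and notin: "\<And>a b. a \<in> Q \<Longrightarrow> b \<in> M \<Longrightarrow> x - y \<noteq> a - b"
  obtains R where "preorder_cone R" "y - x \<in> R" "- p \<notin> R"
proof -
  note N = F_subspace_diffs and zQ = mem_zero(1) and zM = mem_zero(2) and z = mem_zero(3,4)
    and QN = Q_subset_differences
  define R0 where "R0 = {a - b - c *\<^sub>R (x - y) | a b c. a \<in> Q \<and> b \<in> M \<and> c \<in> Fpos}"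
  have xyN: "x - y \<in> differences" using xy by (auto simp: differences_def)
  have pc: "preorder_cone R0"
    unfolding preorder_cone_def
  proof (intro conjI ballI)
    show "R0 \<subseteq> differences"
    proof
      fix u assume "u \<in> R0"
      then obtain a b c where u: "u = a - b - c *\<^sub>R (x - y)" "a \<in> Q" "b \<in> M" "c \<in> Fpos"
        unfolding R0_def by blast
      have "a \<in> differences" "b \<in> differences" using u QN M_subset by auto
      then show "u \<in> differences"
        unfolding u(1) using F_subspaceD(5)[OF N F_subspaceD(5)[OF N] F_subspaceD(3)[OF N _ xyN]] u(4) by blast
    qed
    show "Q \<subseteq> R0"
    proof
      fix a assume "a \<in> Q"
      moreover have "a = a - 0 - 0 *\<^sub>R (x - y)" by simp
      ultimately show "a \<in> R0" unfolding R0_def using zM z by blast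
    qed
    show "uminus ` M \<subseteq> R0"
    proof
      fix u assume "u \<in> uminus ` M"
      then obtain b where "b \<in> M" "u = 0 - b - 0 *\<^sub>R (x - y)" by auto
      then show "u \<in> R0" unfolding R0_def using zQ z by blast
    qed
  next
    fix u v assume "u \<in> R0" "v \<in> R0"
    then obtain a b c a' b' c' where uv: "u = a - b - c *\<^sub>R (x - y)" "v = a' - b' - c' *\<^sub>R (x - y)"
      and *: "a \<in> Q" "b \<in> M" "c \<in> Fpos" "a' \<in> Q" "b' \<in> M" "c' \<in> Fpos"
      unfolding R0_def by blast
    have "u + v = (a + a') - (b + b') - (c + c') *\<^sub>R (x - y)" by (simp add: uv algebra_simps)
    moreover have "a + a' \<in> Q" "b + b' \<in> M" "c + c' \<in> Fpos"
      using faceD(3)[OF Q] faceD(3)[OF face_M] add_mem * by auto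
    ultimately show "u + v \<in> R0" unfolding R0_def by blast
  next
    fix r u assume r: "r \<in> Fpos" and "u \<in> R0"
    then obtain a b c where u: "u = a - b - c *\<^sub>R (x - y)" and *: "a \<in> Q" "b \<in> M" "c \<in> Fpos"
      unfolding R0_def by blast
    have "r *\<^sub>R u = r *\<^sub>R a - r *\<^sub>R b - (r * c) *\<^sub>R (x - y)" by (simp add: u algebra_simps)
    moreover have "r *\<^sub>R a \<in> Q" "r *\<^sub>R b \<in> M" "r * c \<in> Fpos"
      using face_scale[OF Q r] face_scale[OF face_M r] r mult_mem * by auto
    ultimately show "r *\<^sub>R u \<in> R0" unfolding R0_def by blast
  qed
  have "y - x = 0 - 0 - 1 *\<^sub>R (x - y)" by simp
  then have "y - x \<in> R0" unfolding R0_def using zQ zM z by blast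
  moreover have "- p \<notin> R0"
  proof
    assume "- p \<in> R0"
    then obtain a b c where *: "- p = a - b - c *\<^sub>R (x - y)" "a \<in> Q" "b \<in> M" "c \<in> Fpos"
      unfolding R0_def by blast
    \<comment> \<open>If \<open>c = 0\<close> this puts \<open>p\<close> below an element of
      \<open>M\<close>; otherwise dividing by \<open>c\<close> writes \<open>x - y\<close> as a
      member of \<open>Q\<close> minus a member of \<open>M\<close>. Both are excluded.\<close>
    have eq: "c *\<^sub>R (x - y) = (a + p) - b" using *(1) by (simp add: algebra_simps)
    have ap: "a + p \<in> Q" using faceD(3)[OF Q] * p by blast
    show False
    proof (cases "c = 0")
      case True
      then have "b - p = a" using eq by (simp add: eq_diff_eq)
      then have "p \<in> M"
        using face_le[OF face_M *(3), of p] faceD(1)[OF Q] *(2) p(1) by simp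
      then show False using p by simp
    next
      case False
      have ic: "inverse c \<in> Fpos" using *(4) inverse_mem by simp
      have "x - y = inverse c *\<^sub>R (c *\<^sub>R (x - y))" using False by simp
      also have "\<dots> = inverse c *\<^sub>R (a + p) - inverse c *\<^sub>R b"
        unfolding eq by (simp add: scaleR_diff_right)
      finally show False using notin face_scale[OF Q ic ap] face_scale[OF face_M ic *(3)] by blast
    qed
  qed
  ultimately show thesis by (rule that[OF pc])
qed

text \<open>By Zorn's lemma there is a cone maximal among those avoiding \<open>- p\<close>. Such a
  cone is total: if \<open>u\<close> could not be added, the enlarged cone contains
  \<open>- p\<close>, which exhibits \<open>- u\<close> as a member.\<close>

lemma maximal_cone:
  assumes p: "p \<in> Q" "p \<notin> M" and R0: "preorder_cone R0" "y \<in> R0" "- p \<notin> R0"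
  obtains R where "preorder_cone R" "y \<in> R" "- p \<notin> R"
    "\<And>u. u \<in> differences \<Longrightarrow> u \<notin> R \<Longrightarrow> - u \<in> R"
proof -
  define cone where "cone R \<longleftrightarrow> preorder_cone R \<and> y \<in> R \<and> - p \<notin> R" for R
  note N = F_subspace_diffs and z = mem_zero(3,4) and zQ = mem_zero(1)
  have "\<exists>R\<in>{R. cone R}. \<forall>X\<in>{R. cone R}. R \<subseteq> X \<longrightarrow> X = R"
  proof (rule subset_Zorn)
    fix \<C> assume chain: "subset.chain {R. cone R} \<C>"
    show "\<exists>U\<in>{R. cone R}. \<forall>X\<in>\<C>. X \<subseteq> U"
    proof (cases "\<C> = {}")
      case True
      then show ?thesis by (intro bexI[of _ R0]) (auto simp: cone_def R0)
    next
      case False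
      have c: "cone X" if "X \<in> \<C>" for X using chain that by (auto simp: subset.chain_def)
      have lin: "X \<subseteq> Y \<or> Y \<subseteq> X" if "X \<in> \<C>" "Y \<in> \<C>" for X Y
        using chain that by (auto simp: subset_chain_def)
      have cp: "preorder_cone X" if "X \<in> \<C>" for X using c[OF that] by (simp add: cone_def)
      have "preorder_cone (\<Union>\<C>)"
        unfolding preorder_cone_def
      proof (intro conjI ballI)
        obtain X where X: "X \<in> \<C>" using False by blast
        show "Q \<subseteq> \<Union>\<C>" "uminus ` M \<subseteq> \<Union>\<C>" using preorder_coneD(2,3)[OF cp[OF X]] X by blast+
        show "\<Union>\<C> \<subseteq> differences" using preorder_coneD(1)[OF cp] by blast
        show "u + v \<in> \<Union>\<C>" if uv: "u \<in> \<Union>\<C>" "v \<in> \<Union>\<C>" for u v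
        proof -
          obtain X Y where "X \<in> \<C>" "Y \<in> \<C>" "u \<in> X" "v \<in> Y" using uv by blast
          then obtain Z where Z: "Z \<in> \<C>" "u \<in> Z" "v \<in> Z" using lin by blast
          then show ?thesis using preorder_coneD(4)[OF cp[OF Z(1)] Z(2,3)] by blast
        qed
        show "r *\<^sub>R u \<in> \<Union>\<C>" if ru: "r \<in> Fpos" "u \<in> \<Union>\<C>" for r u
          using ru preorder_coneD(5)[OF cp _ , of _ r u] by blast
      qed
      moreover have "y \<in> \<Union>\<C>" "- p \<notin> \<Union>\<C>" using c False unfolding cone_def by blast+
      ultimately have "cone (\<Union>\<C>)" by (simp add: cone_def)
      then show ?thesis by blast
    qed
  qed
  then obtain R where R: "cone R" and maximal: "\<And>X. cone X \<Longrightarrow> R \<subseteq> X \<Longrightarrow> X = R" by blast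
  have pc: "preorder_cone R" and yR: "y \<in> R" and pR: "- p \<notin> R" using R by (auto simp: cone_def)
  note RN = preorder_coneD(1)[OF pc] and QR = preorder_coneD(2)[OF pc] and MR = preorder_coneD(3)[OF pc]
    and addR = preorder_coneD(4)[OF pc] and scaleR = preorder_coneD(5)[OF pc]
  have total: "- u \<in> R" if u: "u \<in> differences" "u \<notin> R" for u
  proof -
    define R' where "R' = {v + c *\<^sub>R u | v c. v \<in> R \<and> c \<in> Fpos}"
    have RR': "R \<subseteq> R'"
    proof
      fix v assume "v \<in> R"
      moreover have "v = v + 0 *\<^sub>R u" by simp
      ultimately show "v \<in> R'" unfolding R'_def using z by blast
    qed
    have "u = 0 + 1 *\<^sub>R u" by simp
    then have "u \<in> R'" unfolding R'_def using z QR zQ by blast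
    then have "R' \<noteq> R" using u by blast
    then have "\<not> cone R'" using maximal RR' by blast
    moreover have "R' \<subseteq> differences"

    proof
      fix a assume "a \<in> R'"
      then obtain v c where "a = v + c *\<^sub>R u" "v \<in> R" "c \<in> F" unfolding R'_def by blast
      then show "a \<in> differences"
        using F_subspaceD(2)[OF N subsetD[OF RN] F_subspaceD(3)[OF N _ u(1)]] by blast
    qed
    moreover have "a + b \<in> R'" if ab: "a \<in> R'" "b \<in> R'" for a b
    proof -
      obtain v c w d where e: "a = v + c *\<^sub>R u" "b = w + d *\<^sub>R u" and *: "v \<in> R" "w \<in> R" "c \<in> Fpos" "d \<in> Fpos"
        using ab unfolding R'_def by blast
      have "a + b = (v + w) + (c + d) *\<^sub>R u" by (simp add: e algebra_simps)
      moreover have "v + w \<in> R" "c + d \<in> Fpos" using addR add_mem * by auto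
      ultimately show ?thesis unfolding R'_def by blast
    qed
    moreover have "r *\<^sub>R a \<in> R'" if ra: "r \<in> Fpos" "a \<in> R'" for a r
    proof -
      obtain v c where e: "a = v + c *\<^sub>R u" and *: "v \<in> R" "c \<in> Fpos"
        using ra unfolding R'_def by blast
      have "r *\<^sub>R a = r *\<^sub>R v + (r * c) *\<^sub>R u" by (simp add: e algebra_simps)
      moreover have "r *\<^sub>R v \<in> R" "r * c \<in> Fpos" using scaleR[OF ra(1)] ra(1) mult_mem * by auto
      ultimately show ?thesis unfolding R'_def by blast
    qed
    moreover have "Q \<subseteq> R'" "uminus ` M \<subseteq> R'" "y \<in> R'"
      using RR' QR MR yR by blast+
    ultimately have "- p \<in> R'" unfolding cone_def preorder_cone_def by blast
    \<comment> \<open>Here \<open>c\<close> is nonzero because \<open>- p\<close> is not in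
      \<open>R\<close>, so the equation can be solved for \<open>- u\<close> with the nonnegative
      coefficient \<open>inverse c\<close>.\<close>
    then obtain v c where vc: "- p = v + c *\<^sub>R u" "v \<in> R" "c \<in> Fpos" unfolding R'_def by blast
    have c0: "c \<noteq> 0" using vc pR by auto
    have ic: "inverse c \<in> Fpos" using vc(3) inverse_mem by simp
    have "c *\<^sub>R u = - p - v" by (simp add: vc(1))
    then have "c *\<^sub>R (- u) = v + p" by simp
    then have "- u = inverse c *\<^sub>R (v + p)" using c0 by (metis scaleR_scaleR left_inverse scaleR_one)
    then show ?thesis using scaleR[OF ic] addR[OF vc(2)] QR p(1) by auto
  qed
  show thesis by (rule that[OF _ _ pR total]) (use R in \<open>auto simp: cone_def\<close>)
qed

text \<open>A total preorder with order unit \<open>p\<close> has a state given by Dedekind cuts: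
  \<open>u\<close> is sent to the supremum of the rational \<open>r\<close> for which
  \<open>r *\<^sub>R p\<close> lies below \<open>u\<close>.\<close>

lemma state_of_total_cone:
  assumes p: "p \<in> Q" "p \<notin> M" and pc: "preorder_cone R" and pR: "- p \<notin> R"
    and total: "\<And>u. u \<in> differences \<Longrightarrow> u \<notin> R \<Longrightarrow> - u \<in> R"
  obtains \<phi> where "state \<phi>" "\<phi> p = 1" "\<And>x y. x \<in> Q \<Longrightarrow> y \<in> Q \<Longrightarrow> y - x \<in> R \<Longrightarrow> \<phi> x \<le> \<phi> y"
proof -
  note N = F_subspace_diffs and QN = Q_subset_differences and z = mem_zero(3,4) and zQ = mem_zero(1)
  note RN = preorder_coneD(1)[OF pc] and QR = preorder_coneD(2)[OF pc] and MR = preorder_coneD(3)[OF pc]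
    and addR = preorder_coneD(4)[OF pc] and scaleR = preorder_coneD(5)[OF pc]
  \<comment> \<open>Every inequality derived below is reduced to one between multiples of
    \<open>p\<close>, from which this extracts an inequality of numbers.\<close>
  have p_scaled: "r \<le> 0" if "(- r) *\<^sub>R p \<in> R" "r \<in> F" for r
  proof (rule ccontr)
    assume "\<not> r \<le> 0"
    then have "inverse r \<in> Fpos" "r \<noteq> 0" using that(2) inverse_mem by auto
    then show False using scaleR[of "inverse r" "(- r) *\<^sub>R p"] that(1) pR by simp
  qed
  have rat: "of_rat q \<in> F" for q by (rule of_rat_mem)
  \<comment> \<open>Rational \<open>r\<close> are scalars in every subfield and are dense in the
    reals, so the cut determines a real number whatever \<open>F\<close> is.\<close>
  define S where "S u = {r \<in> \<rat>. u - r *\<^sub>R p \<in> R}" for u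
  define f where "f u = Sup (S u)" for u
  have SF: "r \<in> F" if "r \<in> S u" for r u using that rat unfolding S_def Rats_def by blast
  have zero_S: "0 \<in> S u" if "u \<in> Q" for u using that QR by (auto simp: S_def)
  have bdd: "bdd_above (S u)" if u: "u \<in> Q" for u
  proof -
    obtain n :: nat and m where nm: "m \<in> M" "real n *\<^sub>R p + m - u \<in> Q" using order_unit[OF p u] .
    have "r \<le> real n" if r: "r \<in> S u" for r
    proof -
      have "(real n *\<^sub>R p + m - u) + (- m) + (u - r *\<^sub>R p) \<in> R"
        using addR[OF addR[OF subsetD[OF QR nm(2)] MR[OF nm(1)]], of "u - r *\<^sub>R p"] r
        unfolding S_def by blast
      then have "(- (r - real n)) *\<^sub>R p \<in> R" by (simp add: algebra_simps)
      then have "r - real n \<le> 0"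
        by (rule p_scaled) (use SF[OF r] of_nat_mem in \<open>auto intro: diff_mem\<close>)
      then show ?thesis by simp
    qed
    then show ?thesis by (rule bdd_aboveI)
  qed
  have nonneg: "0 \<le> f u" if "u \<in> Q" for u
    unfolding f_def by (rule cSup_upper[OF zero_S bdd]) (use that in auto)
  have above: "r *\<^sub>R p - u \<in> R" if "u \<in> Q" "r \<in> \<rat>" "f u < r" for u r
  proof -
    have "r \<notin> S u" using cSup_upper[OF _ bdd[OF that(1)], of r] that(3) by (auto simp: f_def)
    then have "u - r *\<^sub>R p \<notin> R" using that(2) by (auto simp: S_def)
    moreover have "r \<in> F" using that(2) rat by (auto simp: Rats_def)
    then have "u - r *\<^sub>R p \<in> differences" using QN p(1) that(1) by (intro F_subspaceD(3,5)[OF N]) blast+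
    ultimately have "- (u - r *\<^sub>R p) \<in> R" using total by blast
    then show ?thesis by simp
  qed
  have below: "\<exists>r\<in>S u. t < r" if "u \<in> Q" "t < f u" for u t
    using less_cSup_iff[OF _ bdd[OF that(1)]] zero_S[OF that(1)] that(2) unfolding f_def by blast
  have add: "f (u + v) = f u + f v" if u: "u \<in> Q" and v: "v \<in> Q" for u v
  proof (rule antisym)
    have uv: "u + v \<in> Q" by (rule faceD(3)[OF Q u v])
    show "f (u + v) \<le> f u + f v"
    proof (rule ccontr)
      assume "\<not> f (u + v) \<le> f u + f v"
      then obtain e where e: "e > 0" "f u + f v + 2 * e < f (u + v)"
        by (metis add.commute field_sum_of_halves less_diff_eq linorder_not_le mult_2
            half_gt_zero diff_gt_0_iff_gt dense)
      obtain r where r: "r \<in> \<rat>" "f u < r" "r < f u + e" using Rats_dense_in_real[of "f u" "f u + e"] e by auto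
      obtain s where s: "s \<in> \<rat>" "f v < s" "s < f v + e" using Rats_dense_in_real[of "f v" "f v + e"] e by auto
      obtain t where t: "t \<in> S (u + v)" "r + s < t" using below[OF uv, of "r + s"] r s e by auto
      have "(r *\<^sub>R p - u) + (s *\<^sub>R p - v) + (u + v - t *\<^sub>R p) \<in> R"
        using addR[OF addR[OF above[OF u r(1,2)] above[OF v s(1,2)]], of "u + v - t *\<^sub>R p"] t(1)
        unfolding S_def by blast
      then have "(- (t - (r + s))) *\<^sub>R p \<in> R" by (simp add: algebra_simps)
      then have "t - (r + s) \<le> 0"
        by (rule p_scaled) (use SF[OF t(1)] r(1) s(1) rat in \<open>auto simp: Rats_def intro!: diff_mem add_mem\<close>)
      then show False using t(2) by simp
    qed
    show "f u + f v \<le> f (u + v)"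
    proof (rule ccontr)
      assume less: "\<not> f u + f v \<le> f (u + v)"
      then have "f (u + v) - f v < f u" by simp
      then obtain r where r: "r \<in> S u" "f (u + v) - f v < r" using below[OF u] by blast
      then have "f (u + v) - r < f v" by simp
      then obtain s where s: "s \<in> S v" "f (u + v) - r < s" using below[OF v] by blast
      have "u - r *\<^sub>R p + (v - s *\<^sub>R p) \<in> R"
        using addR[of "u - r *\<^sub>R p" "v - s *\<^sub>R p"] r(1) s(1) unfolding S_def by blast
      then have "r + s \<in> S (u + v)" using r s by (auto simp: S_def algebra_simps)
      then have "r + s \<le> f (u + v)" unfolding f_def by (rule cSup_upper[OF _ bdd[OF uv]])
      then show False using s by simp
    qed
  qed
  obtain g where g: "linear g" "\<And>u. u \<in> Q \<Longrightarrow> g u = f u"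
    using linear_extension[of f, OF add nonneg] by blast
  have "state g"
    unfolding state_def
  proof (intro conjI ballI g(1))
    show "0 \<le> g u" if "u \<in> Q" for u using g(2) nonneg that by simp
    show "g m = 0" if m: "m \<in> M" for m
    proof -
      have mQ: "m \<in> Q" using m M_subset by blast
      have "r \<le> 0" if r: "r \<in> S m" for r
      proof -
        have "- m + (m - r *\<^sub>R p) \<in> R"
          using addR[OF MR[OF m], of "m - r *\<^sub>R p"] r unfolding S_def by blast
        then show ?thesis using p_scaled[OF _ SF[OF r]] by simp
      qed
      then have "f m \<le> 0" unfolding f_def using zero_S[OF mQ] by (intro cSup_least) auto
      then show ?thesis using nonneg[OF mQ] g(2)[OF mQ] by simp
    qed
  qed
  moreover have "g p = 1"
  proof -
    have "r \<le> 1" if r: "r \<in> S p" for r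
    proof -
      have "(- (r - 1)) *\<^sub>R p \<in> R" using r by (auto simp: S_def algebra_simps)
      then have "r - 1 \<le> 0" by (rule p_scaled) (use SF[OF r] one_mem diff_mem in auto)
      then show ?thesis by simp
    qed
    moreover have "1 \<in> S p" using QR zQ by (auto simp: S_def)
    ultimately have "f p = 1" unfolding f_def by (intro cSup_eq_maximum)
    then show ?thesis using g(2) p by simp
  qed
  moreover have "g x \<le> g y" if xy: "x \<in> Q" "y \<in> Q" and yxR: "y - x \<in> R" for x y
  proof -
    have "S x \<subseteq> S y"
    proof
      fix r assume "r \<in> S x"
      then have "(x - r *\<^sub>R p) + (y - x) \<in> R" "r \<in> \<rat>"
        using addR[OF _ yxR, of "x - r *\<^sub>R p"] unfolding S_def by blast+
      then show "r \<in> S y" by (simp add: S_def)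
    qed
    then have "f x \<le> f y" unfolding f_def using zero_S xy bdd by (intro cSup_subset_mono) auto
    then show ?thesis using g(2) xy by simp
  qed
  ultimately show thesis by (rule that)
qed

text \<open>The normalisation at \<open>p\<close> guarantees that the state does not vanish on
  \<open>Q\<close>. The inequality \<open>\<phi> x \<le> \<phi> y\<close> is weak, so in the
  contrapositive only strict inequalities at all such states yield positivity.\<close>

lemma state_separation:
  assumes p: "p \<in> Q" "p \<notin> M" and xy: "x \<in> Q" "y \<in> Q"
    and notin: "\<And>a b. a \<in> Q \<Longrightarrow> b \<in> M \<Longrightarrow> x - y \<noteq> a - b"
  obtains \<phi> where "state \<phi>" "\<phi> p = 1" "\<phi> x \<le> \<phi> y"
proof -
  obtain R0 where "preorder_cone R0" "y - x \<in> R0" "- p \<notin> R0" using initial_cone[OF assms] .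
  then obtain R where R: "preorder_cone R" "y - x \<in> R" "- p \<notin> R"
    "\<And>u. u \<in> differences \<Longrightarrow> u \<notin> R \<Longrightarrow> - u \<in> R" using maximal_cone[OF p] by metis
  obtain \<phi> where "state \<phi>" "\<phi> p = 1" "\<And>x y. x \<in> Q \<Longrightarrow> y \<in> Q \<Longrightarrow> y - x \<in> R \<Longrightarrow> \<phi> x \<le> \<phi> y"
    using state_of_total_cone[OF p R(1,3,4)] by blast
  then show thesis using that R(2) xy by blast
qed

end

section \<open>Finite families of functionals and their dual vectors\<close>

lemma linear_functional_dual:
  fixes \<Phi> :: "('a::real_vector \<Rightarrow> real) set"
  assumes "finite \<Phi>" "\<And>\<psi>. \<psi> \<in> \<Phi> \<Longrightarrow> linear \<psi>" "linear \<phi>" "Real_Vector_Spaces.subspace U"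
  shows "(\<exists>c. \<forall>x\<in>U. \<phi> x = (\<Sum>\<psi>\<in>\<Phi>. c \<psi> * \<psi> x)) \<or> (\<exists>w\<in>U. \<phi> w = 1 \<and> (\<forall>\<psi>\<in>\<Phi>. \<psi> w = 0))"
  using assms(1-3)
proof (induction \<Phi> arbitrary: \<phi> rule: finite_induct)
  case empty
  show ?case
  proof (cases "\<exists>x\<in>U. \<phi> x \<noteq> 0")
    case True
    then obtain x where "x \<in> U" "\<phi> x \<noteq> 0" by blast
    then have "inverse (\<phi> x) *\<^sub>R x \<in> U" "\<phi> (inverse (\<phi> x) *\<^sub>R x) = 1"
      using assms(4) empty.prems(2) by (auto simp: real_vector.subspace_scale linear_scale)
    then show ?thesis by blast
  qed auto
next
  case (insert \<psi> \<Phi>)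
  have lin: "linear \<psi>" "\<And>\<chi>. \<chi> \<in> \<Phi> \<Longrightarrow> linear \<chi>" using insert.prems by auto
  consider (A) c where "\<forall>x\<in>U. \<psi> x = (\<Sum>\<chi>\<in>\<Phi>. c \<chi> * \<chi> x)"
    | (B) z where "z \<in> U" "\<psi> z = 1" "\<forall>\<chi>\<in>\<Phi>. \<chi> z = 0"
    using insert.IH[OF lin(2,1)] by blast
  then show ?case
  proof cases
    case (A c)
    consider (L) d where "\<forall>x\<in>U. \<phi> x = (\<Sum>\<chi>\<in>\<Phi>. d \<chi> * \<chi> x)"
      | (R) w where "w \<in> U" "\<phi> w = 1" "\<forall>\<chi>\<in>\<Phi>. \<chi> w = 0"
      using insert.IH[OF lin(2) insert.prems(2)] by blast
    then show ?thesis
    proof cases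
      case (L d)
      have "(\<Sum>\<chi>\<in>\<Phi>. (d(\<psi> := 0)) \<chi> * \<chi> x) = (\<Sum>\<chi>\<in>\<Phi>. d \<chi> * \<chi> x)" for x
        using insert.hyps by (intro sum.cong) auto
      then have "\<forall>x\<in>U. \<phi> x = (\<Sum>\<chi>\<in>insert \<psi> \<Phi>. (d(\<psi> := 0)) \<chi> * \<chi> x)"
        using L insert.hyps by simp
      then show ?thesis by blast
    next
      case (R w)
      then have "\<psi> w = 0" using A by simp
      then show ?thesis using R by blast
    qed
  next
    case (B z)
    \<comment> \<open>Subtracting a multiple of \<open>\<psi>\<close> makes the functional vanish at
      \<open>z\<close>, so \<open>z\<close> can be used to correct a witness for the smaller family
      without changing its values there.\<close>
    define \<phi>' where "\<phi>' x = \<phi> x - \<phi> z * \<psi> x" for x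
    have "linear \<phi>'"
      using insert.prems(2) lin(1) unfolding \<phi>'_def linear_iff by (simp add: algebra_simps)
    then consider (L) d where "\<forall>x\<in>U. \<phi>' x = (\<Sum>\<chi>\<in>\<Phi>. d \<chi> * \<chi> x)"
      | (R) w where "w \<in> U" "\<phi>' w = 1" "\<forall>\<chi>\<in>\<Phi>. \<chi> w = 0"
      using insert.IH[OF lin(2)] by blast
    then show ?thesis
    proof cases
      case (L d)
      have "(\<Sum>\<chi>\<in>\<Phi>. (d(\<psi> := \<phi> z)) \<chi> * \<chi> x) = (\<Sum>\<chi>\<in>\<Phi>. d \<chi> * \<chi> x)" for x
        using insert.hyps by (intro sum.cong) auto
      then have "\<forall>x\<in>U. \<phi> x = (\<Sum>\<chi>\<in>insert \<psi> \<Phi>. (d(\<psi> := \<phi> z)) \<chi> * \<chi> x)"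
        using L insert.hyps by (simp add: \<phi>'_def algebra_simps)
      then show ?thesis by blast
    next
      case (R w)
      let ?w = "w - \<psi> w *\<^sub>R z"
      have "?w \<in> U" using R B assms(4) by (simp add: real_vector.subspace_diff real_vector.subspace_scale)
      moreover have "\<phi> ?w = 1"
        using R insert.prems(2) by (simp add: linear_diff linear_scale \<phi>'_def algebra_simps)
      moreover have "\<chi> ?w = 0" if "\<chi> \<in> insert \<psi> \<Phi>" for \<chi>
        using that R B lin by (auto simp: linear_diff linear_scale)
      ultimately show ?thesis by blast
    qed
  qed
qed

lemma dual_family_independent:
  fixes \<Phi> :: "('a::real_vector \<Rightarrow> real) set"
  assumes "finite \<Phi>" "\<And>\<phi>. \<phi> \<in> \<Phi> \<Longrightarrow> linear \<phi>"
    and dual: "\<And>\<phi> \<psi>. \<phi> \<in> \<Phi> \<Longrightarrow> \<psi> \<in> \<Phi> \<Longrightarrow> \<phi> (w \<psi>) = (if \<phi> = \<psi> then 1 else 0)"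
  shows "inj_on w \<Phi>" "independent (w ` \<Phi>)"
proof -
  show inj: "inj_on w \<Phi>"
  proof (rule inj_onI)
    fix \<phi> \<psi> assume "\<phi> \<in> \<Phi>" "\<psi> \<in> \<Phi>" "w \<phi> = w \<psi>"
    then have "\<phi> (w \<psi>) = 1" using dual[of \<phi> \<phi>] by simp
    then show "\<phi> = \<psi>" using dual[of \<phi> \<psi>] \<open>\<phi> \<in> \<Phi>\<close> \<open>\<psi> \<in> \<Phi>\<close> by (simp split: if_splits)
  qed
  show "independent (w ` \<Phi>)"
  proof (rule real_vector.independent_if_scalars_zero)
    show "finite (w ` \<Phi>)" using assms(1) by simp
    fix f x assume sum0: "(\<Sum>x\<in>w ` \<Phi>. f x *\<^sub>R x) = 0" and "x \<in> w ` \<Phi>"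
    then obtain \<phi> where \<phi>: "\<phi> \<in> \<Phi>" "x = w \<phi>" by blast
    have "0 = \<phi> (\<Sum>x\<in>w ` \<Phi>. f x *\<^sub>R x)" using sum0 assms(2)[OF \<phi>(1)] by (simp add: linear_0)
    also have "\<dots> = (\<Sum>\<psi>\<in>\<Phi>. f (w \<psi>) * \<phi> (w \<psi>))"
      using assms(2)[OF \<phi>(1)] inj by (simp add: linear_sum linear_scale sum.reindex)
    also have "\<dots> = (\<Sum>\<psi>\<in>\<Phi>. if \<phi> = \<psi> then f (w \<psi>) else 0)"
      using dual[OF \<phi>(1)] by (intro sum.cong) auto
    also have "\<dots> = f x" using \<phi> assms(1) by simp
    finally show "f x = 0" by simp
  qed
qed

section \<open>Disjoint states and maximal frames\<close>

context maximal_face_pair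
begin

text \<open>A state may take any values off the span of \<open>Q\<close>, so vanishing, like
  \<open>state_le\<close>, is tested on \<open>Q\<close> rather than as equality of
  functions.\<close>

definition null_state :: "('a \<Rightarrow> real) \<Rightarrow> bool"
  where "null_state \<phi> \<longleftrightarrow> (\<forall>x\<in>Q. \<phi> x = 0)"

text \<open>The condition says that the infimum of \<open>\<phi>\<close> and \<open>\<psi>\<close> in the lattice of states vanishes.\<close>

definition disjoint_states :: "('a \<Rightarrow> real) \<Rightarrow> ('a \<Rightarrow> real) \<Rightarrow> bool"
  where "disjoint_states \<phi> \<psi> \<longleftrightarrow>
    (\<forall>x\<in>Q. \<forall>e>0. \<exists>a\<in>Q. \<exists>b\<in>Q. x = a + b \<and> \<phi> a < e \<and> \<psi> b < e)"

definition state_le :: "('a \<Rightarrow> real) \<Rightarrow> ('a \<Rightarrow> real) \<Rightarrow> bool"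
  where "state_le \<phi> \<psi> \<longleftrightarrow> (\<forall>x\<in>Q. \<phi> x \<le> \<psi> x)"

lemma disjoint_states_sym: "disjoint_states \<phi> \<psi> \<Longrightarrow> disjoint_states \<psi> \<phi>"
  unfolding disjoint_states_def by (metis add.commute)

lemma disjoint_states_mono:
  assumes "disjoint_states \<phi> \<psi>" "state_le \<phi>' \<phi>" "state_le \<psi>' \<psi>"
  shows "disjoint_states \<phi>' \<psi>'"
  using assms unfolding disjoint_states_def state_le_def by (meson le_less_trans)

lemma disjoint_states_self:
  assumes "state \<phi>" "disjoint_states \<phi> \<phi>"
  shows "null_state \<phi>"
  unfolding null_state_def
proof (rule ballI, rule ccontr)
  fix x assume x: "x \<in> Q" "\<phi> x \<noteq> 0"
  then have "\<phi> x > 0" using stateD(2)[OF assms(1)] by force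
  then obtain a b where "x = a + b" "\<phi> a < \<phi> x / 2" "\<phi> b < \<phi> x / 2"
    using assms(2) x(1) half_gt_zero unfolding disjoint_states_def by blast
  then show False using stateD(4)[OF assms(1), of a b] by simp
qed

lemma state_scale_diff:
  assumes "state \<phi>" "state \<psi>" "\<And>x. x \<in> Q \<Longrightarrow> t * \<phi> x \<le> \<psi> x"
  shows "state (\<lambda>x. \<psi> x - t * \<phi> x)"
  unfolding state_def
proof (intro conjI ballI)
  show "linear (\<lambda>x. \<psi> x - t * \<phi> x)"
    using stateD(1)[OF assms(1)] stateD(1)[OF assms(2)] unfolding linear_iff by (simp add: algebra_simps)
qed (use assms stateD(3)[OF assms(1)] stateD(3)[OF assms(2)] in auto)

lemma state_scale: "state \<phi> \<Longrightarrow> 0 \<le> t \<Longrightarrow> state (\<lambda>x. t * \<phi> x)"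
  unfolding state_def linear_iff by (auto simp: algebra_simps)

text \<open>Subtract the infimum \<open>\<theta>\<close>. For a nearly optimal splitting
  \<open>x = a + b\<close> the excesses \<open>\<phi> a - \<theta> a\<close> and
  \<open>\<psi> b - \<theta> b\<close> are nonnegative with small sum, so each is small.\<close>

lemma disjoint_part:
  assumes "state \<phi>" "state \<psi>"
  obtains \<theta> where "state \<theta>" "state_le \<theta> \<phi>" "state_le \<theta> \<psi>"
    "disjoint_states (\<lambda>x. \<phi> x - \<theta> x) (\<lambda>x. \<psi> x - \<theta> x)"
proof -
  obtain \<theta> where \<theta>: "state \<theta>" "\<And>x. x \<in> Q \<Longrightarrow> \<theta> x \<le> \<phi> x" "\<And>x. x \<in> Q \<Longrightarrow> \<theta> x \<le> \<psi> x"
    "\<And>x e. x \<in> Q \<Longrightarrow> 0 < e \<Longrightarrow> \<exists>a\<in>Q. \<exists>b\<in>Q. x = a + b \<and> \<phi> a + \<psi> b < \<theta> x + e"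
    using state_inf[OF assms] by blast
  have "disjoint_states (\<lambda>x. \<phi> x - \<theta> x) (\<lambda>x. \<psi> x - \<theta> x)"
    unfolding disjoint_states_def
  proof (intro ballI allI impI)
    fix x and e :: real assume "x \<in> Q" "0 < e"
    then obtain a b where ab: "a \<in> Q" "b \<in> Q" "x = a + b" "\<phi> a + \<psi> b < \<theta> x + e" using \<theta>(4) by blast
    then have "(\<phi> a - \<theta> a) + (\<psi> b - \<theta> b) < e" using stateD(4)[OF \<theta>(1)] by simp
    then have "\<phi> a - \<theta> a < e" "\<psi> b - \<theta> b < e" using \<theta>(2)[OF ab(1)] \<theta>(3)[OF ab(2)] by linarith+
    then show "\<exists>a\<in>Q. \<exists>b\<in>Q. x = a + b \<and> \<phi> a - \<theta> a < e \<and> \<psi> b - \<theta> b < e" using ab by blast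
  qed
  then show thesis using that \<theta>(1-3) unfolding state_le_def by blast
qed

text \<open>The supremum of admissible coefficients is finite because \<open>\<phi>\<close> is
  positive somewhere on \<open>Q\<close>, and it is attained because each inequality at a fixed
  \<open>x\<close> is closed.\<close>

lemma largest_multiple:
  assumes \<phi>: "state \<phi>" "\<not> null_state \<phi>" and \<psi>: "state \<psi>"
  obtains t where "0 \<le> t" "state_le (\<lambda>x. t * \<phi> x) \<psi>"
    "\<And>r. 0 < r \<Longrightarrow> \<not> state_le (\<lambda>x. r * \<phi> x) (\<lambda>x. \<psi> x - t * \<phi> x)"
proof -
  define T where "T = {t. 0 \<le> t \<and> (\<forall>x\<in>Q. t * \<phi> x \<le> \<psi> x)}"
  define t where "t = Sup T"
  obtain y where y: "y \<in> Q" "\<phi> y > 0"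
    using \<phi> stateD(2)[OF \<phi>(1)] unfolding null_state_def by force
  have bdd: "bdd_above T"
    by (rule bdd_aboveI[of _ "\<psi> y / \<phi> y"]) (use y in \<open>auto simp: T_def pos_le_divide_eq\<close>)
  have T0: "0 \<in> T" using stateD(2)[OF \<psi>] by (auto simp: T_def)
  have t0: "0 \<le> t" unfolding t_def by (rule cSup_upper[OF T0 bdd])
  have le: "t * \<phi> x \<le> \<psi> x" if x: "x \<in> Q" for x
  proof (cases "\<phi> x = 0")
    case True
    then show ?thesis using stateD(2)[OF \<psi> x] by simp
  next
    case False
    then have pos: "\<phi> x > 0" using stateD(2)[OF \<phi>(1) x] by simp
    have "t \<le> \<psi> x / \<phi> x"
      unfolding t_def by (rule cSup_least) (use T0 pos x in \<open>auto simp: T_def pos_le_divide_eq\<close>)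
    then show ?thesis using pos by (simp add: pos_le_divide_eq)
  qed
  have "\<not> state_le (\<lambda>x. r * \<phi> x) (\<lambda>x. \<psi> x - t * \<phi> x)" if "0 < r" for r
  proof
    assume "state_le (\<lambda>x. r * \<phi> x) (\<lambda>x. \<psi> x - t * \<phi> x)"
    then have "t + r \<in> T" using t0 that by (auto simp: T_def state_le_def algebra_simps)
    then have "t + r \<le> t" unfolding t_def by (rule cSup_upper[OF _ bdd])
    then show False using that by simp
  qed
  then show thesis using that[OF t0] le unfolding state_le_def by blast
qed

text \<open>One splitting serves all of \<open>\<Psi>\<close>: split off one state at a time from
  the part \<open>a\<close>, moving the remainder to \<open>b\<close>. Earlier bounds survive since
  states are monotone.\<close>

lemma disjoint_states_finite:
  assumes "state \<phi>" "finite \<Psi>" "\<And>\<psi>. \<psi> \<in> \<Psi> \<Longrightarrow> state \<psi> \<and> disjoint_states \<phi> \<psi>" "x \<in> Q" "0 < e"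
  obtains a b where "a \<in> Q" "b \<in> Q" "x = a + b" "\<phi> b < e" "\<And>\<psi>. \<psi> \<in> \<Psi> \<Longrightarrow> \<psi> a < e"
proof -
  have "\<exists>a\<in>Q. \<exists>b\<in>Q. x = a + b \<and> \<phi> b < e \<and> (\<forall>\<psi>\<in>\<Psi>. \<psi> a < e)"
    using assms(2,3,5)
  proof (induction \<Psi> arbitrary: e rule: finite_induct)
    case empty
    have "\<phi> 0 < e" using stateD(6)[OF assms(1), of 0 0] empty by simp
    then show ?case using assms(4) faceD(2)[OF Q] by (intro bexI[of _ x] bexI[of _ 0]) auto
  next
    case (insert \<psi> \<Psi>)
    have st: "state \<psi>" "disjoint_states \<psi> \<phi>" "\<And>\<chi>. \<chi> \<in> \<Psi> \<Longrightarrow> state \<chi> \<and> disjoint_states \<phi> \<chi>"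
      using insert.prems(1) disjoint_states_sym by auto
    obtain a b where ab: "a \<in> Q" "b \<in> Q" "x = a + b" "\<phi> b < e / 2" "\<forall>\<chi>\<in>\<Psi>. \<chi> a < e / 2"
      using insert.IH[OF st(3), of "e / 2"] insert.prems(2) by auto
    obtain c d where cd: "c \<in> Q" "d \<in> Q" "a = c + d" "\<psi> c < e / 2" "\<phi> d < e / 2"
      using st(2) ab(1) insert.prems(2) unfolding disjoint_states_def by (meson half_gt_zero)
    have "\<chi> c < e" if "\<chi> \<in> insert \<psi> \<Psi>" for \<chi>
    proof (cases "\<chi> = \<psi>")
      case True
      then show ?thesis using cd(4) insert.prems(2) by simp
    next
      case False
      then have "\<chi> \<in> \<Psi>" using that by simp
      then have "\<chi> c \<le> \<chi> a" "\<chi> a < e / 2"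
        using state_mono[of \<chi> a c] st(3) cd ab(5) by auto
      then show ?thesis using insert.prems(2) by simp
    qed
    moreover have "\<phi> (d + b) < e" using stateD(4)[OF assms(1)] ab(4) cd(5) by simp
    moreover have "x = c + (d + b)" "d + b \<in> Q" using ab cd faceD(3)[OF Q] by auto
    ultimately show ?case using cd(1) by blast
  qed
  then show thesis using that by blast
qed

definition frame :: "('a \<Rightarrow> real) set \<Rightarrow> bool"
  where "frame \<Phi> \<longleftrightarrow> finite \<Phi> \<and> (\<forall>\<phi>\<in>\<Phi>. state \<phi> \<and> \<not> null_state \<phi>) \<and>
    (\<forall>\<phi>\<in>\<Phi>. \<forall>\<psi>\<in>\<Phi>. \<phi> \<noteq> \<psi> \<longrightarrow> disjoint_states \<phi> \<psi>)"

lemma frameD: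
  assumes "frame \<Phi>"
  shows "finite \<Phi>" "\<phi> \<in> \<Phi> \<Longrightarrow> state \<phi>" "\<phi> \<in> \<Phi> \<Longrightarrow> \<not> null_state \<phi>"
    "\<phi> \<in> \<Phi> \<Longrightarrow> \<psi> \<in> \<Phi> \<Longrightarrow> \<phi> \<noteq> \<psi> \<Longrightarrow> disjoint_states \<phi> \<psi>"
  using assms by (simp_all add: frame_def)

text \<open>Otherwise \<open>\<phi>\<close> is a combination of the other states on
  \<open>span D\<close>, hence on \<open>Q\<close>, because all of them vanish on \<open>M\<close>.
  But disjointness splits \<open>x\<close> into a part where the others are small and a part where
  \<open>\<phi>\<close> is small.\<close>

lemma frame_dual:
  assumes fr: "frame \<Phi>" and D: "Q \<subseteq> span (M \<union> D)" and \<phi>: "\<phi> \<in> \<Phi>"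
  shows "\<exists>w\<in>span D. \<phi> w = 1 \<and> (\<forall>\<psi>\<in>\<Phi> - {\<phi>}. \<psi> w = 0)"
proof (rule ccontr)
  assume no: "\<not> ?thesis"
  note st = frameD[OF fr]
  have \<phi>s: "state \<phi>" by (rule st(2)[OF \<phi>])
  have "(\<exists>c. \<forall>x\<in>span D. \<phi> x = (\<Sum>\<psi>\<in>\<Phi> - {\<phi>}. c \<psi> * \<psi> x)) \<or>
    (\<exists>w\<in>span D. \<phi> w = 1 \<and> (\<forall>\<psi>\<in>\<Phi> - {\<phi>}. \<psi> w = 0))"
    by (rule linear_functional_dual)
      (use st(1) stateD(1)[OF st(2)] stateD(1)[OF \<phi>s] in auto)
  then obtain c where c: "\<And>x. x \<in> span D \<Longrightarrow> \<phi> x = (\<Sum>\<psi>\<in>\<Phi> - {\<phi>}. c \<psi> * \<psi> x)" using no by blast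
  have lin: "linear (\<lambda>x. \<Sum>\<psi>\<in>\<Phi> - {\<phi>}. c \<psi> * \<psi> x)"
    unfolding linear_iff
    by (simp add: stateD(4,6)[OF st(2)] distrib_left sum.distrib sum_distrib_left mult.left_commute)
  have eq: "\<phi> x = (\<Sum>\<psi>\<in>\<Phi> - {\<phi>}. c \<psi> * \<psi> x)" if "x \<in> Q" for x
  proof (rule linear_eq_on_span[OF stateD(1)[OF \<phi>s] lin])
    show "x \<in> span (M \<union> D)" using D that by blast
    show "\<phi> y = (\<Sum>\<psi>\<in>\<Phi> - {\<phi>}. c \<psi> * \<psi> y)" if "y \<in> M \<union> D" for y
    proof (cases "y \<in> D")
      case True
      then show ?thesis using c span_base by blast
    next
      case False
      then have "y \<in> M" using that by simp
      moreover have "(\<Sum>\<psi>\<in>\<Phi> - {\<phi>}. c \<psi> * \<psi> y) = 0"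
        using stateD(3)[OF st(2)] \<open>y \<in> M\<close> by (intro sum.neutral) auto
      ultimately show ?thesis using stateD(3)[OF \<phi>s] by simp
    qed
  qed
  obtain x where x: "x \<in> Q" "\<phi> x > 0"
    using st(3)[OF \<phi>] stateD(2)[OF \<phi>s] unfolding null_state_def by force
  \<comment> \<open>The combination contributes at most \<open>K - 1\<close> times the error
    \<open>e\<close> and the second part less than \<open>e\<close>; the choice of \<open>e\<close>
    makes the total \<open>\<phi> x / 2\<close>.\<close>
  define K where "K = 1 + (\<Sum>\<psi>\<in>\<Phi> - {\<phi>}. \<bar>c \<psi>\<bar>)"
  have K: "K \<ge> 1" unfolding K_def by (simp add: sum_nonneg)
  define e where "e = \<phi> x / (2 * K)"
  have e: "e > 0" using x K by (simp add: e_def)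
  have dj: "state \<psi> \<and> disjoint_states \<phi> \<psi>" if "\<psi> \<in> \<Phi> - {\<phi>}" for \<psi>
    using that st(2) st(4)[OF \<phi>] by auto
  obtain a b where ab: "a \<in> Q" "b \<in> Q" "x = a + b" "\<phi> b < e" "\<And>\<psi>. \<psi> \<in> \<Phi> - {\<phi>} \<Longrightarrow> \<psi> a < e"
    using disjoint_states_finite[OF \<phi>s, of "\<Phi> - {\<phi>}" x e] dj x(1) e st(1) by auto
  have "\<phi> a \<le> (\<Sum>\<psi>\<in>\<Phi> - {\<phi>}. \<bar>c \<psi>\<bar> * e)"
    unfolding eq[OF ab(1)]
  proof (rule sum_mono)
    fix \<psi> assume \<psi>: "\<psi> \<in> \<Phi> - {\<phi>}"
    have "0 \<le> \<psi> a" using dj[OF \<psi>] stateD(2) ab(1) by blast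
    then have "c \<psi> * \<psi> a \<le> \<bar>c \<psi>\<bar> * \<psi> a" by (simp add: mult_right_mono)
    also have "\<dots> \<le> \<bar>c \<psi>\<bar> * e" using ab(5)[OF \<psi>] by (intro mult_left_mono) auto
    finally show "c \<psi> * \<psi> a \<le> \<bar>c \<psi>\<bar> * e" .
  qed
  also have "\<dots> = (K - 1) * e" by (simp add: K_def sum_distrib_right)
  finally have "\<phi> x < K * e" using ab(3,4) stateD(4)[OF \<phi>s, of a b] by (simp add: algebra_simps)
  also have "\<dots> = \<phi> x / 2" using K by (simp add: e_def)
  finally show False using x(2) by simp
qed

text \<open>The vectors dual to a frame are independent in \<open>span B\<close>. The resulting
  bound is what makes a frame of greatest cardinality exist.\<close>

lemma card_frame_le:
  assumes "frame \<Phi>"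
  shows "card \<Phi> \<le> card B"
proof -
  note st = frameD[OF assms]
  have "Q \<subseteq> span (M \<union> Q)" using span_base by blast
  then have "\<forall>\<phi>\<in>\<Phi>. \<exists>w. w \<in> span Q \<and> \<phi> w = 1 \<and> (\<forall>\<psi>\<in>\<Phi> - {\<phi>}. \<psi> w = 0)"
    using frame_dual[OF assms, of Q] by blast
  then obtain w where w: "\<And>\<phi>. \<phi> \<in> \<Phi> \<Longrightarrow> w \<phi> \<in> span Q \<and> \<phi> (w \<phi>) = 1 \<and> (\<forall>\<psi>\<in>\<Phi> - {\<phi>}. \<psi> (w \<phi>) = 0)"
    by metis
  have dual: "\<phi> (w \<psi>) = (if \<phi> = \<psi> then 1 else 0)" if "\<phi> \<in> \<Phi>" "\<psi> \<in> \<Phi>" for \<phi> \<psi>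
    using w[OF that(2)] that(1) by auto
  have ind: "inj_on w \<Phi>" "independent (w ` \<Phi>)"
    using dual_family_independent[of \<Phi> w] st(1) stateD(1)[OF st(2)] dual by blast+
  have "span Q \<subseteq> span B" using face_subset(2)[OF Q] span_minimal real_vector.subspace_span by blast
  then have "w ` \<Phi> \<subseteq> span B" using w by blast
  then have "card (w ` \<Phi>) \<le> card B"
    using real_vector.independent_span_bound[OF finite_B ind(2)] by blast
  then show ?thesis unfolding card_image[OF ind(1)] .
qed

definition maximal_frame :: "('a \<Rightarrow> real) set \<Rightarrow> bool"
  where "maximal_frame \<Phi> \<longleftrightarrow> frame \<Phi> \<and> (\<forall>\<Psi>. frame \<Psi> \<longrightarrow> card \<Psi> \<le> card \<Phi>)"

lemma maximal_frame_exists: obtains \<Phi> where "maximal_frame \<Phi>"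
proof -
  have "\<exists>\<Phi>. frame \<Phi> \<and> (\<forall>\<Psi>. frame \<Psi> \<longrightarrow> card \<Psi> \<le> card \<Phi>)"
    by (rule ex_has_greatest_nat[of _ "{}" _ "Suc (card B)"])
      (use card_frame_le in \<open>auto simp: frame_def le_imp_less_Suc\<close>)
  then show thesis using that unfolding maximal_frame_def by blast
qed

lemma frame_insert:
  assumes "frame \<Phi>" "state \<psi>" "\<not> null_state \<psi>" "\<And>\<phi>. \<phi> \<in> \<Phi> \<Longrightarrow> disjoint_states \<psi> \<phi>"
  shows "frame (insert \<psi> \<Phi>)" "\<psi> \<notin> \<Phi>"
proof -
  show "frame (insert \<psi> \<Phi>)"
    using assms disjoint_states_sym unfolding frame_def by (metis finite_insert insert_iff)
  show "\<psi> \<notin> \<Phi>" using assms(3) assms(4)[of \<psi>] disjoint_states_self[OF assms(2)] by blast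
qed

text \<open>Remove from \<open>\<psi>\<close> the largest multiple of \<open>\<phi>\<close>. If
  something is left, it and a small multiple of \<open>\<phi>\<close> have two nonzero disjoint
  parts below \<open>\<phi>\<close>, and putting these in place of \<open>\<phi>\<close> gives a
  frame with one more member.\<close>

lemma maximal_frame_atom:
  assumes \<Phi>: "maximal_frame \<Phi>" and \<phi>: "\<phi> \<in> \<Phi>" and \<psi>: "state \<psi>" "state_le \<psi> \<phi>"
  shows "\<exists>t\<ge>0. \<forall>x\<in>Q. \<psi> x = t * \<phi> x"
proof -
  have fr: "frame \<Phi>" using \<Phi> by (simp add: maximal_frame_def)
  note st = frameD[OF fr]
  note \<phi>s = st(2,3)[OF \<phi>]
  obtain t where t: "0 \<le> t" "state_le (\<lambda>x. t * \<phi> x) \<psi>"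
    "\<And>r. 0 < r \<Longrightarrow> \<not> state_le (\<lambda>x. r * \<phi> x) (\<lambda>x. \<psi> x - t * \<phi> x)"
    using largest_multiple[OF \<phi>s \<psi>(1)] by blast
  define \<chi> where "\<chi> x = \<psi> x - t * \<phi> x" for x
  have \<chi>: "state \<chi>"
    unfolding \<chi>_def using t(2) \<psi>(1) \<phi>s(1) by (intro state_scale_diff) (auto simp: state_le_def)
  have "null_state \<chi>"
  proof (rule ccontr)
    assume nn: "\<not> null_state \<chi>"
    then obtain x where x: "x \<in> Q" "\<chi> x > 0" using stateD(2)[OF \<chi>] unfolding null_state_def by force
    have \<chi>\<phi>: "state_le \<chi> \<phi>"
      unfolding state_le_def
    proof
      fix x assume "x \<in> Q"
      then have "\<psi> x \<le> \<phi> x" "0 \<le> t * \<phi> x" using \<psi>(2) stateD(2)[OF \<phi>s(1)] t(1) by (auto simp: state_le_def)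
      then show "\<chi> x \<le> \<phi> x" by (simp add: \<chi>_def)
    qed
    have "\<phi> x > 0" using x \<chi>\<phi> by (force simp: state_le_def)
    \<comment> \<open>Small enough that \<open>r * \<phi> x\<close> stays below
      \<open>\<chi> x\<close>, so \<open>\<chi>\<close> keeps a nonzero part after the infimum is
      removed; at most 1, so that the multiple stays below \<open>\<phi>\<close>. The other part is
      nonzero by the choice of \<open>t\<close>.\<close>
    define r where "r = min 1 (\<chi> x / (2 * \<phi> x))"
    have r: "0 < r" "r \<le> 1" "r * \<phi> x < \<chi> x"
    proof -
      show "0 < r" "r \<le> 1" using x \<open>\<phi> x > 0\<close> by (auto simp: r_def)
      have "r * \<phi> x \<le> \<chi> x / (2 * \<phi> x) * \<phi> x"
        using \<open>\<phi> x > 0\<close> by (intro mult_right_mono) (auto simp: r_def)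
      also have "\<dots> < \<chi> x" using \<open>\<phi> x > 0\<close> x by simp
      finally show "r * \<phi> x < \<chi> x" .
    qed
    have r\<phi>: "state (\<lambda>x. r * \<phi> x)" using state_scale[OF \<phi>s(1)] r(1) by simp
    have r\<phi>le: "state_le (\<lambda>x. r * \<phi> x) \<phi>"
      using r stateD(2)[OF \<phi>s(1)] by (auto simp: state_le_def mult_left_le_one_le)
    obtain \<theta> where \<theta>: "state \<theta>" "state_le \<theta> \<chi>" "state_le \<theta> (\<lambda>x. r * \<phi> x)"
      "disjoint_states (\<lambda>x. \<chi> x - \<theta> x) (\<lambda>x. r * \<phi> x - \<theta> x)"
      using disjoint_part[OF \<chi> r\<phi>] by blast
    define \<alpha> where "\<alpha> = (\<lambda>x. \<chi> x - \<theta> x)"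
    define \<beta> where "\<beta> = (\<lambda>x. r * \<phi> x - \<theta> x)"
    have \<alpha>: "state \<alpha>" unfolding \<alpha>_def
      using state_scale_diff[OF \<theta>(1) \<chi>, of 1] \<theta>(2) by (simp add: state_le_def)
    have \<beta>: "state \<beta>" unfolding \<beta>_def
      using state_scale_diff[OF \<theta>(1) r\<phi>, of 1] \<theta>(3) by (simp add: state_le_def)
    have \<alpha>n: "\<not> null_state \<alpha>"
      using x(1) r(3) \<theta>(3) unfolding null_state_def \<alpha>_def state_le_def by fastforce
    have \<beta>n: "\<not> null_state \<beta>"
    proof
      assume "null_state \<beta>"
      then have "state_le (\<lambda>x. r * \<phi> x) \<chi>"
        using \<theta>(2) unfolding null_state_def \<beta>_def state_le_def by auto
      then show False using t(3)[OF r(1)] unfolding \<chi>_def by blast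
    qed
    have le: "state_le \<alpha> \<phi>" "state_le \<beta> \<phi>"
      using \<chi>\<phi> r\<phi>le stateD(2)[OF \<theta>(1)] unfolding state_le_def \<alpha>_def \<beta>_def by (smt (verit))+
    have refl: "state_le \<xi> \<xi>" for \<xi> by (simp add: state_le_def)
    have fr0: "frame (\<Phi> - {\<phi>})" using fr by (auto simp: frame_def)
    have 1: "frame (insert \<beta> (\<Phi> - {\<phi>}))" "\<beta> \<notin> \<Phi> - {\<phi>}"
      by (rule frame_insert[OF fr0 \<beta> \<beta>n], use disjoint_states_mono[OF st(4)[OF \<phi>] le(2) refl] in blast)+
    have 2: "disjoint_states \<alpha> \<xi>" if "\<xi> \<in> insert \<beta> (\<Phi> - {\<phi>})" for \<xi>
      using that \<theta>(4) disjoint_states_mono[OF st(4)[OF \<phi>] le(1) refl] unfolding \<alpha>_def \<beta>_def by blast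
    have 3: "frame (insert \<alpha> (insert \<beta> (\<Phi> - {\<phi>})))" "\<alpha> \<notin> insert \<beta> (\<Phi> - {\<phi>})"
      using frame_insert[OF 1(1) \<alpha> \<alpha>n 2] by blast+
    have "card (insert \<alpha> (insert \<beta> (\<Phi> - {\<phi>}))) = Suc (card \<Phi>)"
      using 1(2) 3(2) st(1) card_Suc_Diff1[OF st(1) \<phi>] by simp
    then show False using \<Phi> 3(1) unfolding maximal_frame_def by (metis Suc_n_not_le_n)
  qed
  then show ?thesis using t(1) by (auto simp: null_state_def \<chi>_def)
qed

text \<open>Subtract largest multiples of the members successively; later subtractions only lower
  the remainder, so earlier multiples stay exhausted. The infimum of the final remainder with a
  member is a multiple of that member, hence 0, so a nonzero remainder could be added to the
  frame.\<close>

lemma maximal_frame_generates: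
  assumes \<Phi>: "maximal_frame \<Phi>" and \<psi>: "state \<psi>"
  shows "\<exists>t. (\<forall>\<phi>\<in>\<Phi>. 0 \<le> t \<phi>) \<and> (\<forall>x\<in>Q. \<psi> x = (\<Sum>\<phi>\<in>\<Phi>. t \<phi> * \<phi> x))"
proof -
  have fr: "frame \<Phi>" using \<Phi> by (simp add: maximal_frame_def)
  note st = frameD[OF fr]
  have "\<exists>t. (\<forall>\<phi>\<in>\<Psi>. 0 \<le> t \<phi>) \<and> state (\<lambda>x. \<psi> x - (\<Sum>\<phi>\<in>\<Psi>. t \<phi> * \<phi> x)) \<and>
    (\<forall>\<phi>\<in>\<Psi>. \<forall>r>0. \<not> state_le (\<lambda>x. r * \<phi> x) (\<lambda>x. \<psi> x - (\<Sum>\<phi>\<in>\<Psi>. t \<phi> * \<phi> x)))"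
    if "finite \<Psi>" "\<Psi> \<subseteq> \<Phi>" for \<Psi>
    using that
  proof (induction \<Psi> rule: finite_induct)
    case empty
    show ?case using \<psi> by simp
  next
    case (insert \<phi> \<Psi>)
    then obtain t where t: "\<forall>\<phi>\<in>\<Psi>. 0 \<le> t \<phi>" "state (\<lambda>x. \<psi> x - (\<Sum>\<phi>\<in>\<Psi>. t \<phi> * \<phi> x))"
      "\<forall>\<phi>\<in>\<Psi>. \<forall>r>0. \<not> state_le (\<lambda>x. r * \<phi> x) (\<lambda>x. \<psi> x - (\<Sum>\<phi>\<in>\<Psi>. t \<phi> * \<phi> x))" by auto
    define \<chi> where "\<chi> = (\<lambda>x. \<psi> x - (\<Sum>\<phi>\<in>\<Psi>. t \<phi> * \<phi> x))"
    have \<chi>: "state \<chi>" using t(2) by (simp add: \<chi>_def)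
    have \<phi>: "state \<phi>" "\<not> null_state \<phi>" using st insert.prems by auto
    obtain r where r: "0 \<le> r" "state_le (\<lambda>x. r * \<phi> x) \<chi>"
      "\<And>s. 0 < s \<Longrightarrow> \<not> state_le (\<lambda>x. s * \<phi> x) (\<lambda>x. \<chi> x - r * \<phi> x)"
      using largest_multiple[OF \<phi> \<chi>] by blast
    define u where "u = t(\<phi> := r)"
    have "(\<Sum>\<phi>\<in>\<Psi>. u \<phi> * \<phi> x) = (\<Sum>\<phi>\<in>\<Psi>. t \<phi> * \<phi> x)" for x
      using insert.hyps by (intro sum.cong) (auto simp: u_def)
    then have eq: "(\<lambda>x. \<psi> x - (\<Sum>\<phi>\<in>insert \<phi> \<Psi>. u \<phi> * \<phi> x)) = (\<lambda>x. \<chi> x - r * \<phi> x)"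
      using insert.hyps by (auto simp: \<chi>_def u_def fun_eq_iff)
    have 1: "state (\<lambda>x. \<chi> x - r * \<phi> x)"
      using state_scale_diff[OF \<phi>(1) \<chi>] r(2) by (simp add: state_le_def)
    have 2: "\<not> state_le (\<lambda>x. s * \<xi> x) (\<lambda>x. \<chi> x - r * \<phi> x)" if "\<xi> \<in> \<Psi>" "0 < s" for \<xi> s
    proof
      assume a: "state_le (\<lambda>x. s * \<xi> x) (\<lambda>x. \<chi> x - r * \<phi> x)"
      have "state_le (\<lambda>x. s * \<xi> x) \<chi>"
        unfolding state_le_def
      proof
        fix x assume "x \<in> Q"
        then have "s * \<xi> x \<le> \<chi> x - r * \<phi> x" "0 \<le> r * \<phi> x"
          using a stateD(2)[OF \<phi>(1)] r(1) by (auto simp: state_le_def)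
        then show "s * \<xi> x \<le> \<chi> x" by simp
      qed
      then show False using t(3) that unfolding \<chi>_def by blast
    qed
    show ?case
      using 1 2 r(1,3) t(1) insert.hyps by (intro exI[of _ u]) (unfold eq, auto simp: u_def)
  qed
  then obtain t where t: "\<forall>\<phi>\<in>\<Phi>. 0 \<le> t \<phi>" "state (\<lambda>x. \<psi> x - (\<Sum>\<phi>\<in>\<Phi>. t \<phi> * \<phi> x))"
    "\<forall>\<phi>\<in>\<Phi>. \<forall>r>0. \<not> state_le (\<lambda>x. r * \<phi> x) (\<lambda>x. \<psi> x - (\<Sum>\<phi>\<in>\<Phi>. t \<phi> * \<phi> x))"
    using st(1) by blast
  define \<chi> where "\<chi> = (\<lambda>x. \<psi> x - (\<Sum>\<phi>\<in>\<Phi>. t \<phi> * \<phi> x))"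
  have \<chi>: "state \<chi>" using t(2) by (simp add: \<chi>_def)
  have "disjoint_states \<chi> \<phi>" if \<phi>: "\<phi> \<in> \<Phi>" for \<phi>
  proof -
    obtain \<theta> where \<theta>: "state \<theta>" "state_le \<theta> \<chi>" "state_le \<theta> \<phi>"
      "disjoint_states (\<lambda>x. \<chi> x - \<theta> x) (\<lambda>x. \<phi> x - \<theta> x)"
      using disjoint_part[OF \<chi> st(2)[OF \<phi>]] by blast
    obtain r where r: "r \<ge> 0" "\<forall>x\<in>Q. \<theta> x = r * \<phi> x"
      using maximal_frame_atom[OF \<Phi> \<phi> \<theta>(1,3)] by blast
    have "r = 0"
    proof (rule ccontr)
      assume "r \<noteq> 0"
      then have "0 < r" using r by simp
      moreover have "state_le (\<lambda>x. r * \<phi> x) \<chi>" using \<theta>(2) r(2) by (auto simp: state_le_def)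
      ultimately show False using t(3) \<phi> unfolding \<chi>_def by blast
    qed
    then have "\<And>x. x \<in> Q \<Longrightarrow> \<theta> x = 0" using r by simp
    then show ?thesis
      using disjoint_states_mono[OF \<theta>(4)] by (simp add: state_le_def)
  qed
  then have "null_state \<chi>"
    using frame_insert[OF fr \<chi>] \<Phi> st(1) unfolding maximal_frame_def
    by (metis card_insert_disjoint Suc_n_not_le_n)
  then show ?thesis using t(1) by (auto simp: null_state_def \<chi>_def)
qed

text \<open>A separating state would be a nonnegative combination of \<open>\<Phi>\<close>, with
  some positive coefficient because it is 1 at \<open>p\<close>, and so would be strictly larger at
  \<open>x\<close> than at \<open>y\<close>.\<close>

lemma maximal_frame_positive:
  assumes \<Phi>: "maximal_frame \<Phi>" and p: "p \<in> Q" "p \<notin> M"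
    and xy: "x \<in> Q" "y \<in> Q" and pos: "\<And>\<phi>. \<phi> \<in> \<Phi> \<Longrightarrow> \<phi> y < \<phi> x"
  obtains a b where "a \<in> Q" "b \<in> M" "x - y = a - b"
proof -
  have "\<exists>a\<in>Q. \<exists>b\<in>M. x - y = a - b"
  proof (rule ccontr)
    assume "\<not> ?thesis"
    then obtain \<psi> where \<psi>: "state \<psi>" "\<psi> p = 1" "\<psi> x \<le> \<psi> y"
      using state_separation[OF p xy] by blast
    obtain t where t: "\<forall>\<phi>\<in>\<Phi>. 0 \<le> t \<phi>" "\<And>x. x \<in> Q \<Longrightarrow> \<psi> x = (\<Sum>\<phi>\<in>\<Phi>. t \<phi> * \<phi> x)"
      using maximal_frame_generates[OF \<Phi> \<psi>(1)] by blast
    have fin: "finite \<Phi>" using \<Phi> by (auto simp: maximal_frame_def frame_def)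
    have "\<exists>\<phi>\<in>\<Phi>. t \<phi> \<noteq> 0"
    proof (rule ccontr)
      assume "\<not> ?thesis"
      then have "\<psi> p = 0" unfolding t(2)[OF p(1)] by (intro sum.neutral) auto
      then show False using \<psi>(2) by simp
    qed
    then obtain \<phi> where \<phi>: "\<phi> \<in> \<Phi>" "t \<phi> > 0" using t(1) by force
    have "(\<Sum>\<phi>\<in>\<Phi>. t \<phi> * \<phi> y) < (\<Sum>\<phi>\<in>\<Phi>. t \<phi> * \<phi> x)"
    proof (rule sum_strict_mono_ex1[OF fin])
      show "\<forall>\<phi>\<in>\<Phi>. t \<phi> * \<phi> y \<le> t \<phi> * \<phi> x" using t(1) pos by (intro ballI mult_left_mono) (auto intro: less_imp_le)
      show "\<exists>\<phi>\<in>\<Phi>. t \<phi> * \<phi> y < t \<phi> * \<phi> x" using \<phi> pos by (intro bexI[of _ \<phi>] mult_strict_left_mono) auto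
    qed
    then show False using t(2) xy \<psi>(3) by simp
  qed
  then show thesis using that by blast
qed

text \<open>\<open>s\<close> is an order unit modulo \<open>M\<close>, so a state vanishing at
  \<open>s\<close> would vanish on \<open>Q\<close>.\<close>

lemma frame_pos:
  assumes "frame \<Phi>" "\<phi> \<in> \<Phi>" "s \<in> Q" "s \<notin> M"
  shows "0 < \<phi> s"
proof -
  have st: "state \<phi>" "\<not> null_state \<phi>" using frameD(2,3)[OF assms(1,2)] by auto
  obtain x where x: "x \<in> Q" "\<phi> x > 0"
    using st stateD(2)[OF st(1)] unfolding null_state_def by force
  obtain n :: nat and m where nm: "m \<in> M" "real n *\<^sub>R s + m - x \<in> Q" using order_unit[OF assms(3,4) x(1)] .
  have "\<phi> x \<le> real n * \<phi> s"
    using state_mono[OF st(1) nm(2)] stateD(3)[OF st(1) nm(1)] by (simp add: stateD(4,6)[OF st(1)])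
  then show ?thesis using x(2) stateD(2)[OF st(1) assms(3)] by (cases "\<phi> s = 0") auto
qed

text \<open>For the empty frame the positivity criterion holds vacuously and would make
  \<open>- p\<close> positive modulo \<open>M\<close>.\<close>

lemma maximal_frame_nonempty:
  assumes "maximal_frame \<Phi>" "p \<in> Q" "p \<notin> M"
  shows "\<Phi> \<noteq> {}"
proof
  assume "\<Phi> = {}"
  then obtain a b where ab: "a \<in> Q" "b \<in> M" "0 - p = a - b"
    using maximal_frame_positive[OF assms faceD(2)[OF Q] assms(2)] by blast
  then have "b - p = a" by (simp add: algebra_simps)
  then have "p \<in> M" using face_le[OF face_M ab(2), of p] faceD(1)[OF Q] ab(1) assms(2) by simp
  then show False using assms by simp
qed

end

section \<open>Simplicial cones with generators over the subfield\<close>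

lemma sum_elem_le:
  fixes f :: "'a \<Rightarrow> 'b \<Rightarrow> real"
  assumes "finite A" "finite B" "a \<in> A" "b \<in> B" "\<And>a b. a \<in> A \<Longrightarrow> b \<in> B \<Longrightarrow> 0 \<le> f a b"
  shows "f a b \<le> (\<Sum>a\<in>A. \<Sum>b\<in>B. f a b)"
proof -
  have "f a b \<le> (\<Sum>b\<in>B. f a b)"
    by (rule member_le_sum) (use assms in auto)
  also have "\<dots> \<le> (\<Sum>a\<in>A. \<Sum>b\<in>B. f a b)"
    by (rule member_le_sum[of a A "\<lambda>a. \<Sum>b\<in>B. f a b"]) (use assms in \<open>auto intro: sum_nonneg\<close>)
  finally show ?thesis .
qed

text \<open>\<open>representation W\<close> is additive only on \<open>span W\<close>. Linear
  functionals on the whole type are needed in order to treat coordinates and states alike in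
  \<open>combos_dense\<close>.\<close>

lemma coordinate_functionals:
  fixes W :: "'a::real_vector set"
  assumes "finite W" "independent W"
  obtains \<tau> :: "'a \<Rightarrow> 'a \<Rightarrow> real" where "\<And>l. linear (\<tau> l)"
    "\<And>l x. l \<in> W \<Longrightarrow> x \<in> span W \<Longrightarrow> \<tau> l x = representation W x l"
proof -
  have "\<exists>g. linear g \<and> (\<forall>x\<in>W. g x = (if x = l then 1 else 0 :: real))" for l
    by (rule real_vector.linear_independent_extend[OF assms(2)])
  then obtain \<tau> where \<tau>: "\<And>l. linear (\<tau> l)" "\<And>l x. x \<in> W \<Longrightarrow> \<tau> l x = (if x = l then 1 else 0 :: real)"
    by metis
  have "\<tau> l x = representation W x l" if "l \<in> W" "x \<in> span W" for l x
  proof -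
    have "\<tau> l x = \<tau> l (\<Sum>t\<in>W. representation W x t *\<^sub>R t)"
      using sum_representation[OF assms that(2)] by simp
    also have "\<dots> = (\<Sum>t\<in>W. representation W x t * \<tau> l t)"
      using \<tau>(1) by (simp add: linear_sum linear_scale)
    also have "\<dots> = (\<Sum>t\<in>W. if t = l then representation W x t else 0)"
      by (rule sum.cong) (auto simp: \<tau>(2))
    also have "\<dots> = representation W x l" using assms(1) that(1) by simp
    finally show ?thesis .
  qed
  then show thesis using that \<tau>(1) by blast
qed

context real_subfield
begin

lemma Rats_subset: "\<rat> \<subseteq> F"
  using of_rat_mem by (auto simp: Rats_def)

text \<open>Round the coefficients of \<open>v\<close> to rationals. The error \<open>m / K\<close>
  is chosen so that no functional in \<open>G\<close> changes by as much as \<open>m\<close>, its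
  least possible value at \<open>v\<close>.\<close>

lemma combos_dense:
  fixes D :: "'a::real_vector set"
  assumes D: "finite D" and G: "finite G" "\<And>g. g \<in> G \<Longrightarrow> linear g"
    and v: "v \<in> span D" "\<And>g. g \<in> G \<Longrightarrow> (0::real) < g v"
  shows "\<exists>t\<in>combos F D. \<forall>g\<in>G. 0 < g t"
proof -
  obtain r where r: "v = (\<Sum>d\<in>D. r d *\<^sub>R d)"
    using v(1) real_vector.span_finite[OF D] by auto
  define m where "m = Min (insert 1 ((\<lambda>g. g v) ` G))"
  have m: "0 < m" "\<And>g. g \<in> G \<Longrightarrow> m \<le> g v" using G(1) v(2) by (auto simp: m_def)
  define K where "K = 1 + (\<Sum>g\<in>G. \<Sum>d\<in>D. \<bar>g d\<bar>)"
  have K: "1 \<le> K" by (simp add: K_def sum_nonneg)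
  define e where "e = m / K"
  have e: "0 < e" using m K by (simp add: e_def)
  have "\<exists>q. q \<in> \<rat> \<and> r d < q \<and> q < r d + e" for d
    using Rats_dense_in_real[of "r d" "r d + e"] e by auto
  then obtain q where q: "\<And>d. q d \<in> \<rat>" "\<And>d. r d < q d" "\<And>d. q d < r d + e" by metis
  define t where "t = (\<Sum>d\<in>D. q d *\<^sub>R d)"
  have "q ` D \<subseteq> F" using q(1) Rats_subset by blast
  then have "t \<in> combos F D" unfolding t_def by (rule combosI)
  moreover have "0 < g t" if g: "g \<in> G" for g
  proof -
    have "g v - g t = (\<Sum>d\<in>D. (r d - q d) * g d)"
      using G(2)[OF g] by (simp add: r t_def linear_sum linear_scale left_diff_distrib sum_subtractf)
    also have "\<dots> \<le> (\<Sum>d\<in>D. e * \<bar>g d\<bar>)"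
    proof (rule sum_mono)
      fix d
      have "(r d - q d) * g d \<le> \<bar>r d - q d\<bar> * \<bar>g d\<bar>" by (metis abs_ge_self abs_mult)
      also have "\<dots> \<le> e * \<bar>g d\<bar>"
        by (rule mult_right_mono) (use q(2)[of d] q(3)[of d] in auto)
      finally show "(r d - q d) * g d \<le> e * \<bar>g d\<bar>" .
    qed
    also have "\<dots> = e * (\<Sum>d\<in>D. \<bar>g d\<bar>)" by (simp add: sum_distrib_left)
    also have "\<dots> \<le> e * (K - 1)"
      using member_le_sum[of g G "\<lambda>g. \<Sum>d\<in>D. \<bar>g d\<bar>"] G(1) g e
      by (intro mult_left_mono) (auto simp: K_def intro: sum_nonneg)
    also have "\<dots> < e * K" using e by simp
    also have "\<dots> = m" using K by (simp add: e_def)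
    finally show ?thesis using m(2)[OF g] by simp
  qed
  ultimately show ?thesis by blast
qed

text \<open>The states need only be nonnegative on each vector of \<open>W\<close> and positive on
  the sum; adding a small multiple of the sum then makes them all positive. Each exchange lowers the
  number of vectors that are not over \<open>F\<close> or not strictly positive, while the
  coordinates of \<open>S\<close> remain positive.\<close>

lemma basis_push:
  fixes D :: "'a::real_vector set"
  assumes D: "finite D" and \<Phi>: "finite \<Phi>" "\<And>\<phi>. \<phi> \<in> \<Phi> \<Longrightarrow> linear \<phi>" and S: "finite S" "S \<subseteq> span D"
    and W: "finite W" "independent W" "span W = span D"
      "\<And>w \<phi>. w \<in> W \<Longrightarrow> \<phi> \<in> \<Phi> \<Longrightarrow> (0::real) \<le> \<phi> w" "\<And>\<phi>. \<phi> \<in> \<Phi> \<Longrightarrow> 0 < \<phi> (\<Sum>W)"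
      "\<And>s l. s \<in> S \<Longrightarrow> l \<in> W \<Longrightarrow> 0 < representation W s l"
  shows "\<exists>T. finite T \<and> independent T \<and> span T = span D \<and> T \<subseteq> combos F D \<and>
    (\<forall>t\<in>T. \<forall>\<phi>\<in>\<Phi>. 0 < \<phi> t) \<and> (\<forall>s\<in>S. \<forall>t\<in>T. 0 < representation T s t)"
  using W
proof (induction "card {w \<in> W. \<not> (w \<in> combos F D \<and> (\<forall>\<phi>\<in>\<Phi>. 0 < \<phi> w))}" arbitrary: W rule: less_induct)
  case less
  note W = less.prems
  define bad where "bad W = {w \<in> W. \<not> (w \<in> combos F D \<and> (\<forall>\<phi>\<in>\<Phi>. 0 < \<phi> w))}" for W
  \<comment> \<open>Exchange a bad \<open>w\<close> for some \<open>t\<close> in \<open>combos F D\<close> near \<open>w + \<epsilon> *\<^sub>R \<Sum>W\<close>.\<close>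
  show ?case
  proof (cases "bad W = {}")
    case True
    then have "\<forall>w\<in>W. w \<in> combos F D \<and> (\<forall>\<phi>\<in>\<Phi>. 0 < \<phi> w)" by (auto simp: bad_def)
    then show ?thesis using W(1,2,3,6) by (intro exI[of _ W]) blast
  next
    case False
    then obtain w where w: "w \<in> bad W" by blast
    then have wW: "w \<in> W" by (simp add: bad_def)
    obtain \<tau> :: "'a \<Rightarrow> 'a \<Rightarrow> real" where \<tau>: "\<And>l. linear (\<tau> l)"
      "\<And>l x. l \<in> W \<Longrightarrow> x \<in> span W \<Longrightarrow> \<tau> l x = representation W x l"
      using coordinate_functionals[OF W(1,2)] by blast
    let ?r = "representation W"
    \<comment> \<open>\<open>A\<close> exceeds every ratio of the coordinate of \<open>s\<close> at
      \<open>w\<close> to another coordinate of \<open>s\<close>, so the multiple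
      \<open>\<epsilon> = 1 / A\<close> of the first stays below each of the others.\<close>
    define A where "A = 1 + (\<Sum>s\<in>S. \<Sum>l\<in>W. ?r s w / ?r s l)"
    have A: "?r s w / ?r s l < A" if "s \<in> S" "l \<in> W" for s l
      using sum_elem_le[OF S(1) W(1) that, of "\<lambda>s l. ?r s w / ?r s l"] W(6) wW
      by (force simp: A_def intro: less_imp_le)
    have A1: "1 \<le> A" unfolding A_def using W(6) wW by (force intro!: sum_nonneg intro: less_imp_le)
    define \<epsilon> where "\<epsilon> = 1 / A"
    have \<epsilon>: "0 < \<epsilon>" using A1 by (simp add: \<epsilon>_def)
    have \<epsilon>s: "\<epsilon> * ?r s w < ?r s l" if "s \<in> S" "l \<in> W" for s l
      using A[OF that] W(6)[OF that] A1 by (simp add: \<epsilon>_def field_simps)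
    \<comment> \<open>The open conditions on the new vector \<open>t\<close>: a positive pivot,
      positive states, and positive numerators in the exchange formulas for the coordinates of each
      \<open>s\<close>.\<close>
    define G where "G = insert (\<tau> w) (\<Phi> \<union> (\<lambda>(s, l) x. ?r s l * \<tau> w x - ?r s w * \<tau> l x) ` (S \<times> (W - {w})))"
    define t0 where "t0 = w + \<epsilon> *\<^sub>R (\<Sum>W)"
    have sumW: "\<Sum>W \<in> span W" by (intro span_sum span_base)
    have t0: "t0 \<in> span W"
      unfolding t0_def using span_base[OF wW] sumW by (intro span_add span_scale)
    have rsum: "?r (\<Sum>W) l = 1" if "l \<in> W" for l
      using representation_sum_coeff[OF W(1,2) that, of "\<lambda>_. 1"] by simp
    have rt0: "\<tau> l t0 = (if l = w then 1 else 0) + \<epsilon>" if "l \<in> W" for l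
    proof -
      have "\<tau> l w = (if l = w then 1 else 0)"
        using \<tau>(2)[OF that, of w] wW W(2) by (simp add: span_base real_vector.representation_basis)
      then show ?thesis
        using \<tau>(2)[OF that sumW] rsum[OF that] by (simp add: t0_def linear_add linear_scale \<tau>(1))
    qed
    have "\<exists>t\<in>combos F D. \<forall>g\<in>G. 0 < g t"
    proof (rule combos_dense[OF D, where v = t0])
      show "finite G" using \<Phi>(1) S(1) W(1) by (simp add: G_def)
      show "t0 \<in> span D" using t0 W(3) by simp
      have lin: "linear (\<lambda>x. a * \<tau> w x - b * \<tau> l x)" for a b l
        using \<tau>(1)[of w] \<tau>(1)[of l] unfolding linear_iff by (simp add: algebra_simps)
      show "linear g" if "g \<in> G" for g
        using that \<Phi>(2) \<tau>(1) lin by (auto simp: G_def)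
      show "0 < g t0" if gG: "g \<in> G" for g
      proof -
        consider "g = \<tau> w" | "g \<in> \<Phi>" | s l where "s \<in> S" "l \<in> W" "l \<noteq> w" "g = (\<lambda>x. ?r s l * \<tau> w x - ?r s w * \<tau> l x)"
          using gG by (auto simp: G_def)
        then show ?thesis
        proof cases
          case 1
          then show ?thesis using rt0[OF wW] \<epsilon> by simp
        next
          case 2
          have "0 < \<epsilon> * g (\<Sum>W)" using \<epsilon> W(5)[OF 2] by simp
          then show ?thesis using W(4)[OF wW 2] by (simp add: t0_def linear_add linear_scale \<Phi>(2)[OF 2])
        next
          case (3 s l)
          have "0 < \<epsilon> * ?r s l" using \<epsilon> W(6)[OF 3(1,2)] by simp
          then show ?thesis using 3 rt0[OF wW] rt0[OF 3(2)] \<epsilon>s[OF 3(1,2)] by (simp add: algebra_simps)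
        qed
      qed
    qed
    then obtain t where t: "t \<in> combos F D" "\<And>g. g \<in> G \<Longrightarrow> 0 < g t" by blast
    have tW: "t \<in> span W" using t(1) combos_subset_span W(3) by blast
    have \<tau>t: "0 < ?r t w" using t(2)[of "\<tau> w"] \<tau>(2)[OF wW tW] by (simp add: G_def)
    have \<phi>t: "0 < \<phi> t" if "\<phi> \<in> \<Phi>" for \<phi> using t(2) that by (simp add: G_def)
    have rt: "0 < ?r s l * ?r t w - ?r s w * ?r t l" if "s \<in> S" "l \<in> W - {w}" for s l
    proof -
      have "(\<lambda>x. ?r s l * \<tau> w x - ?r s w * \<tau> l x) \<in> G" using that by (auto simp: G_def)
      then show ?thesis using t(2) \<tau>(2)[OF wW tW] \<tau>(2)[OF _ tW, of l] that(2) by force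
    qed
    define W' where "W' = insert t (W - {w})"
    note ex = independent_exchange[OF W(1,2) wW tW, folded W'_def]
    have \<tau>t0: "?r t w \<noteq> 0" using \<tau>t by simp
    have fW': "finite W'" using W(1) by (simp add: W'_def)
    show ?thesis
    proof (rule less.hyps[of W', folded bad_def])
      have "bad W' \<subseteq> bad W - {w}" using t(1) \<phi>t by (auto simp: W'_def bad_def)
      then have "bad W' \<subset> bad W" using w by blast
      moreover have "finite (bad W)" using W(1) by (simp add: bad_def)
      ultimately show "card (bad W') < card (bad W)" by (rule psubset_card_mono[rotated])
      show "finite W'" by (rule fW')
      show "independent W'" by (rule ex(2)[OF \<tau>t0])
      show "span W' = span D" using ex(3)[OF \<tau>t0] W(3) by simp
      show nonneg: "0 \<le> \<phi> x" if "x \<in> W'" "\<phi> \<in> \<Phi>" for x \<phi>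
        using that W(4) \<phi>t[OF that(2)] by (auto simp: W'_def)
      show "0 < \<phi> (\<Sum>W')" if "\<phi> \<in> \<Phi>" for \<phi>
      proof -
        have "0 < (\<Sum>x\<in>W'. \<phi> x)"
          by (rule sum_pos2[of _ t]) (use fW' \<phi>t nonneg that in \<open>auto simp: W'_def\<close>)
        then show ?thesis using \<Phi>(2)[OF that] by (simp add: linear_sum)
      qed
      show "0 < representation W' s l" if s: "s \<in> S" and l: "l \<in> W'" for s l
      proof -
        have sW: "s \<in> span W" using s S(2) W(3) by blast
        show ?thesis
        proof (cases "l = t")
          case True
          then show ?thesis using ex(4)[OF \<tau>t0 sW] W(6)[OF s wW] \<tau>t by simp
        next
          case False
          then have l': "l \<in> W - {w}" using l by (simp add: W'_def)
          have "representation W' s l = (?r s l * ?r t w - ?r s w * ?r t l) / ?r t w"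
            unfolding ex(5)[OF \<tau>t0 sW l'] using \<tau>t by (simp add: diff_divide_distrib)
          then show ?thesis using rt[OF s l'] \<tau>t by simp
        qed
      qed
    qed
  qed
qed

text \<open>Start from the vectors dual to \<open>\<Phi>\<close> and a basis of the common kernel.
  The coordinates of \<open>s\<close> at the dual vectors are the values of the states, hence
  positive; those at the kernel vectors have no sign and are corrected before
  \<open>basis_push\<close> is applied.\<close>

lemma simplicial_basis:
  fixes D :: "'a::real_vector set"
  assumes D: "finite D" and \<Phi>: "finite \<Phi>" "\<Phi> \<noteq> {}" "\<And>\<phi>. \<phi> \<in> \<Phi> \<Longrightarrow> linear \<phi>"
    and dual: "\<And>\<phi>. \<phi> \<in> \<Phi> \<Longrightarrow> \<exists>w\<in>span D. \<phi> w = 1 \<and> (\<forall>\<psi>\<in>\<Phi> - {\<phi>}. \<psi> w = (0::real))"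
    and S: "finite S" "S \<subseteq> span D" "\<And>s \<phi>. s \<in> S \<Longrightarrow> \<phi> \<in> \<Phi> \<Longrightarrow> 0 < \<phi> s"
  shows "\<exists>T. finite T \<and> independent T \<and> span T = span D \<and> T \<subseteq> combos F D \<and>
    (\<forall>t\<in>T. \<forall>\<phi>\<in>\<Phi>. 0 < \<phi> t) \<and> (\<forall>s\<in>S. \<forall>t\<in>T. 0 < representation T s t)"
proof -
  have "\<forall>\<phi>\<in>\<Phi>. \<exists>w. w \<in> span D \<and> \<phi> w = 1 \<and> (\<forall>\<psi>\<in>\<Phi> - {\<phi>}. \<psi> w = 0)" using dual by blast
  then obtain w where w: "\<And>\<phi>. \<phi> \<in> \<Phi> \<Longrightarrow> w \<phi> \<in> span D"
    "\<And>\<phi> \<psi>. \<phi> \<in> \<Phi> \<Longrightarrow> \<psi> \<in> \<Phi> \<Longrightarrow> \<phi> (w \<psi>) = (if \<phi> = \<psi> then 1 else 0)" by (metis DiffI singletonD)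
  have inj: "inj_on w \<Phi>"
    using dual_family_independent(1)[of \<Phi> w] \<Phi>(1,3) w(2) by blast
  \<comment> \<open>This is a real subspace and may have no basis over \<open>F\<close>; the basis
    obtained here is therefore only provisional.\<close>
  define U where "U = {x \<in> span D. \<forall>\<phi>\<in>\<Phi>. \<phi> x = 0}"
  obtain G where G: "G \<subseteq> U" "independent G" "U \<subseteq> span G"
    using real_vector.maximal_independent_subset[of U] by blast
  have fG: "finite G"
    using real_vector.independent_span_bound[OF D G(2)] G(1) by (auto simp: U_def)
  define W where "W = w ` \<Phi> \<union> G"
  have fW: "finite W" using \<Phi>(1) fG by (simp add: W_def)
  have \<phi>G: "\<phi> g = 0" if "\<phi> \<in> \<Phi>" "g \<in> G" for \<phi> g using that G(1) by (auto simp: U_def)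
  have disj: "w ` \<Phi> \<inter> G = {}"
  proof -
    have "w \<phi> \<notin> G" if "\<phi> \<in> \<Phi>" for \<phi> using \<phi>G[OF that] w(2)[OF that that] by force
    then show ?thesis by blast
  qed
  have \<phi>sum: "\<phi> (\<Sum>x\<in>W. f x *\<^sub>R x) = f (w \<phi>)" if \<phi>: "\<phi> \<in> \<Phi>" for \<phi> f
  proof -
    have "\<phi> (\<Sum>x\<in>W. f x *\<^sub>R x) = (\<Sum>x\<in>W. f x * \<phi> x)"
      using \<Phi>(3)[OF \<phi>] by (simp add: linear_sum linear_scale)
    also have "\<dots> = (\<Sum>x\<in>w ` \<Phi>. f x * \<phi> x) + (\<Sum>x\<in>G. f x * \<phi> x)"
      unfolding W_def by (rule sum.union_disjoint) (use \<Phi>(1) fG disj in auto)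
    also have "(\<Sum>x\<in>G. f x * \<phi> x) = 0" using \<phi>G[OF \<phi>] by (intro sum.neutral) auto
    also have "(\<Sum>x\<in>w ` \<Phi>. f x * \<phi> x) = (\<Sum>\<psi>\<in>\<Phi>. if \<psi> = \<phi> then f (w \<psi>) else 0)"
      using w(2)[OF \<phi>] by (subst sum.reindex[OF inj]) (auto intro!: sum.cong)
    finally show ?thesis using \<phi> \<Phi>(1) by simp
  qed
  have ind: "independent W"
  proof (rule real_vector.independent_if_scalars_zero[OF fW])
    fix f x assume 0: "(\<Sum>x\<in>W. f x *\<^sub>R x) = 0" and x: "x \<in> W"
    have f0: "f (w \<phi>) = 0" if "\<phi> \<in> \<Phi>" for \<phi>
      using \<phi>sum[OF that, of f] 0 \<Phi>(3)[OF that] by (simp add: linear_0)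
    have "(\<Sum>x\<in>G. f x *\<^sub>R x) = (\<Sum>x\<in>W. f x *\<^sub>R x)"
      using f0 fW by (intro sum.mono_neutral_left) (auto simp: W_def)
    then have "f g = 0" if "g \<in> G" for g
      using real_vector.independentD[OF G(2) fG order_refl _ that] 0 by simp
    then show "f x = 0" using x f0 by (auto simp: W_def)
  qed
  have "W \<subseteq> span D" using w(1) G(1) by (auto simp: W_def U_def)
  moreover have "span D \<subseteq> span W"
  proof
    fix x assume x: "x \<in> span D"
    let ?y = "\<Sum>\<phi>\<in>\<Phi>. \<phi> x *\<^sub>R w \<phi>"
    have "\<phi> (x - ?y) = 0" if \<phi>: "\<phi> \<in> \<Phi>" for \<phi>
    proof -
      have "\<phi> ?y = (\<Sum>\<psi>\<in>\<Phi>. if \<phi> = \<psi> then \<psi> x else 0)"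
        using \<Phi>(3)[OF \<phi>] w(2)[OF \<phi>] by (simp add: linear_sum linear_scale) (rule sum.cong, auto)
      then show ?thesis using \<phi> \<Phi>(1) by (simp add: linear_diff[OF \<Phi>(3)[OF \<phi>]])
    qed
    moreover have "?y \<in> span D" using w(1) by (intro span_sum span_scale)
    ultimately have "x - ?y \<in> U" using x by (simp add: U_def span_diff)
    then have "x - ?y \<in> span W" using G(3) span_mono[of G W] by (auto simp: W_def)
    moreover have "?y \<in> span W" by (intro span_sum span_scale span_base) (simp add: W_def)
    ultimately show "x \<in> span W" using span_add[of "x - ?y" W ?y] by simp
  qed
  ultimately have sp: "span W = span D" by (meson span_minimal real_vector.subspace_span subset_antisym)
  let ?r = "representation W"
  have r\<phi>: "?r x (w \<phi>) = \<phi> x" if "x \<in> span D" "\<phi> \<in> \<Phi>" for x \<phi>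
    using \<phi>sum[OF that(2), of "?r x"] sum_representation[OF fW ind, of x] that(1) sp by simp
  obtain \<phi>0 where \<phi>0: "\<phi>0 \<in> \<Phi>" using \<Phi>(2) by blast
  \<comment> \<open>Replacing \<open>w \<phi>0\<close> by itself minus \<open>\<gamma>\<close> times
    the sum of \<open>G\<close> adds \<open>\<gamma> * \<phi>0 s\<close> to each kernel coordinate
    of \<open>s\<close>. This bound makes all of them positive, while the states, which vanish on
    \<open>G\<close>, do not notice the change.\<close>
  define \<gamma> where "\<gamma> = 1 + (\<Sum>s\<in>S. \<Sum>g\<in>G. \<bar>?r s g\<bar> / \<phi>0 s)"
  have \<gamma>: "0 < ?r s g + \<gamma> * \<phi>0 s" if "s \<in> S" "g \<in> G" for s g
  proof -
    have "\<bar>?r s g\<bar> / \<phi>0 s < \<gamma>"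
      using sum_elem_le[OF S(1) fG that, of "\<lambda>s g. \<bar>?r s g\<bar> / \<phi>0 s"] S(3)[OF _ \<phi>0]
      by (force simp: \<gamma>_def intro: less_imp_le)
    then have "\<bar>?r s g\<bar> < \<gamma> * \<phi>0 s" using S(3)[OF that(1) \<phi>0] by (simp add: pos_divide_less_eq)
    then show ?thesis by linarith
  qed
  define t where "t = w \<phi>0 - \<gamma> *\<^sub>R (\<Sum>G)"
  have wW: "w \<phi>0 \<in> W" using \<phi>0 by (simp add: W_def)
  define c where "c x = (if x = w \<phi>0 then 1 else if x \<in> G then - \<gamma> else 0)" for x
  have t_eq: "t = (\<Sum>x\<in>W. c x *\<^sub>R x)"
  proof -
    have "w \<phi>0 \<notin> G" using disj \<phi>0 by blast
    then have "(\<Sum>x\<in>G. c x *\<^sub>R x) = (\<Sum>x\<in>G. (- \<gamma>) *\<^sub>R x)" by (intro sum.cong) (auto simp: c_def)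
    also have "\<dots> = - (\<gamma> *\<^sub>R (\<Sum>G))" by (simp add: scaleR_sum_right sum_negf)
    finally have 1: "(\<Sum>x\<in>G. c x *\<^sub>R x) = - (\<gamma> *\<^sub>R (\<Sum>G))" .
    have "(\<Sum>x\<in>w ` \<Phi>. c x *\<^sub>R x) = (\<Sum>x\<in>w ` \<Phi>. if x = w \<phi>0 then x else 0)"
      using disj by (intro sum.cong) (auto simp: c_def)
    also have "\<dots> = w \<phi>0" using \<phi>0 \<Phi>(1) by simp
    finally show ?thesis using 1 \<Phi>(1) fG disj by (simp add: t_def W_def sum.union_disjoint)
  qed
  have tW: "t \<in> span W" unfolding t_eq by (intro span_sum span_scale span_base)
  have rt: "?r t x = c x" if "x \<in> W" for x
    unfolding t_eq by (rule representation_sum_coeff[OF fW ind that])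
  have t1: "?r t (w \<phi>0) = 1" using rt[OF wW] by (simp add: c_def)
  then have t10: "?r t (w \<phi>0) \<noteq> 0" by simp
  define W' where "W' = insert t (W - {w \<phi>0})"
  have fW': "finite W'" using fW by (simp add: W'_def)
  note ex = independent_exchange[OF fW ind wW tW t10, folded W'_def]
  have \<phi>t: "\<phi> t = (if \<phi> = \<phi>0 then 1 else 0)" if "\<phi> \<in> \<Phi>" for \<phi>
    using that w(2)[OF that \<phi>0] \<phi>G[OF that] \<Phi>(3)[OF that]
    by (simp add: t_def linear_diff linear_scale linear_sum)
  show ?thesis
  proof (rule basis_push[OF D \<Phi>(1,3) S(1,2) fW'])
    show "independent W'" by (rule ex(2))
    show "span W' = span D" using ex(3) sp by simp
    show nonneg: "0 \<le> \<phi> x" if "x \<in> W'" "\<phi> \<in> \<Phi>" for x \<phi>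
      using that \<phi>t[OF that(2)] w(2)[OF that(2)] \<phi>G[OF that(2)] by (auto simp: W'_def W_def)
    show "0 < \<phi> (\<Sum>W')" if \<phi>: "\<phi> \<in> \<Phi>" for \<phi>
    proof -
      have "\<exists>x\<in>W'. 0 < \<phi> x"
      proof (cases "\<phi> = \<phi>0")
        case True
        then show ?thesis using \<phi>t[OF \<phi>] by (auto simp: W'_def)
      next
        case False
        then have "w \<phi> \<in> W'" using \<phi> \<phi>0 inj by (auto simp: W'_def W_def inj_on_def)
        then show ?thesis using w(2)[OF \<phi> \<phi>] by (intro bexI[of _ "w \<phi>"]) auto
      qed
      then obtain x where "x \<in> W'" "0 < \<phi> x" by blast
      then have "0 < (\<Sum>x\<in>W'. \<phi> x)"
        by (intro sum_pos2[of _ x]) (use fW' nonneg \<phi> in auto)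
      then show ?thesis using \<Phi>(3)[OF \<phi>] by (simp add: linear_sum)
    qed
    show "0 < representation W' s l" if s: "s \<in> S" and l: "l \<in> W'" for s l
    proof -
      have sD: "s \<in> span D" and sW: "s \<in> span W" using s S(2) sp by auto
      have s0: "?r s (w \<phi>0) = \<phi>0 s" by (rule r\<phi>[OF sD \<phi>0])
      consider "l = t" | "l \<in> W - {w \<phi>0}" using l by (auto simp: W'_def)
      then show ?thesis
      proof cases
        case 1
        then show ?thesis using ex(4)[OF sW] s0 S(3)[OF s \<phi>0] t1 by simp
      next
        case 2
        have eq: "representation W' s l = ?r s l - \<phi>0 s * c l"
          using ex(5)[OF sW 2] s0 t1 rt[of l] 2 by simp
        show ?thesis
        proof (cases "l \<in> G")
          case True
          then show ?thesis using eq \<gamma>[OF s True] 2 by (simp add: c_def mult.commute)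
        next
          case False
          then obtain \<phi> where \<phi>: "\<phi> \<in> \<Phi>" "l = w \<phi>" using 2 by (auto simp: W_def)
          then have "?r s l = \<phi> s" using r\<phi>[OF sD] by simp
          then show ?thesis using eq False 2 S(3)[OF s \<phi>(1)] by (simp add: c_def)
        qed
      qed
    qed
  qed
qed

end

section \<open>Lifting through the faces\<close>

lemma independent_span_disjoint:
  fixes C D :: "'a::real_vector set"
  assumes "finite D" "independent (C \<union> D)" "C \<inter> D = {}" "x \<in> span C" "x \<in> span D"
  shows "x = 0"
proof -
  have D: "independent D" by (rule real_vector.independent_mono[OF assms(2)]) blast
  have "representation (C \<union> D) x = representation C x" "representation (C \<union> D) x = representation D x"
    using assms(4,5) by (auto intro!: real_vector.representation_extend assms(2))
  then have eq: "representation D x = representation C x" by simp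
  have "representation D x d = 0" if "d \<in> D" for d
  proof (rule ccontr)
    assume "representation D x d \<noteq> 0"
    then have "d \<in> C" unfolding eq by (rule real_vector.representation_ne_zero)
    then show False using that assms(3) by blast
  qed
  then have "(\<Sum>d\<in>D. representation D x d *\<^sub>R d) = 0" by (intro sum.neutral) simp
  then show ?thesis using sum_representation[OF assms(1) D assms(5)] by simp
qed

text \<open>Modulo \<open>span M\<close> a relation becomes one between the elements of
  \<open>T\<close>, whose span meets \<open>span M\<close> trivially; its coefficients vanish,
  leaving a relation inside \<open>T'\<close>.\<close>

lemma independent_lift:
  fixes T T' M :: "'a::real_vector set"
  assumes T: "finite T" "independent T" and TM: "\<And>x. x \<in> span T \<Longrightarrow> x \<in> span M \<Longrightarrow> x = 0"
    and T': "finite T'" "independent T'" "T' \<subseteq> span M"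
    and y: "\<And>t. t \<in> T \<Longrightarrow> y t - t \<in> span M"
  shows "independent (y ` T \<union> T')"
proof -
  have inj: "inj_on y T"
  proof (rule inj_onI)
    fix t u assume *: "t \<in> T" "u \<in> T" "y t = y u"
    have "(y u - u) - (y t - t) \<in> span M" by (intro span_diff y *)
    then have "t - u \<in> span M" using *(3) by simp
    moreover have "t - u \<in> span T" using * by (intro span_diff span_base)
    ultimately show "t = u" using TM[of "t - u"] by simp
  qed
  have disj: "y ` T \<inter> T' = {}"
  proof -
    have "y t \<notin> T'" if t: "t \<in> T" for t
    proof
      assume "y t \<in> T'"
      then have "y t - (y t - t) \<in> span M" using T'(3) by (intro span_diff y t) blast
      then have "t = 0" using TM[of t] span_base[OF t] by simp
      then show False using real_vector.dependent_zero T(2) t by blast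
    qed
    then show ?thesis by blast
  qed
  show ?thesis
  proof (rule real_vector.independent_if_scalars_zero)
    show "finite (y ` T \<union> T')" using T T' by simp
    fix f x assume sum0: "(\<Sum>x\<in>y ` T \<union> T'. f x *\<^sub>R x) = 0" and x: "x \<in> y ` T \<union> T'"
    have split: "(\<Sum>t\<in>T. f (y t) *\<^sub>R y t) + (\<Sum>x\<in>T'. f x *\<^sub>R x) = 0"
      using sum0 T(1) T'(1) disj inj by (simp add: sum.union_disjoint sum.reindex)
    have "(\<Sum>t\<in>T. f (y t) *\<^sub>R t) = (\<Sum>t\<in>T. f (y t) *\<^sub>R y t) - (\<Sum>t\<in>T. f (y t) *\<^sub>R (y t - t))"
      by (simp add: sum_subtractf[symmetric] scaleR_diff_right)
    also have "(\<Sum>t\<in>T. f (y t) *\<^sub>R y t) = - (\<Sum>x\<in>T'. f x *\<^sub>R x)"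
      using split by (simp add: eq_neg_iff_add_eq_0)
    also have "- (\<Sum>x\<in>T'. f x *\<^sub>R x) - (\<Sum>t\<in>T. f (y t) *\<^sub>R (y t - t)) \<in> span M"
    proof (rule span_diff[OF span_neg])
      show "(\<Sum>x\<in>T'. f x *\<^sub>R x) \<in> span M" using T'(3) by (intro span_sum span_scale) blast
      show "(\<Sum>t\<in>T. f (y t) *\<^sub>R (y t - t)) \<in> span M" by (rule span_sum, rule span_scale, rule y)
    qed
    finally have "(\<Sum>t\<in>T. f (y t) *\<^sub>R t) \<in> span M" .
    moreover have "(\<Sum>t\<in>T. f (y t) *\<^sub>R t) \<in> span T" by (intro span_sum span_scale span_base)
    ultimately have "(\<Sum>t\<in>T. f (y t) *\<^sub>R t) = 0" using TM by blast
    then have f0: "f (y t) = 0" if "t \<in> T" for t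
      using real_vector.independentD[OF T(2,1) order_refl, of "\<lambda>t. f (y t)"] that by blast
    then have "(\<Sum>x\<in>T'. f x *\<^sub>R x) = 0" using split by simp
    then have "f x = 0" if "x \<in> T'" for x
      using real_vector.independentD[OF T'(2,1) order_refl, of f] that by blast
    then show "f x = 0" using x f0 by blast
  qed
qed

lemma countable_combos:
  assumes "finite D" "countable C"
  shows "countable (combos C D)"
  using assms(1)
proof (induction D rule: finite_induct)
  case empty
  have "combos C {} \<subseteq> {0}" by (auto simp: combos_def)
  then show ?case using countable_subset by blast
next
  case (insert d D)
  have "combos C (insert d D) \<subseteq> (\<lambda>(q, x). q *\<^sub>R d + x) ` (C \<times> combos C D)"
  proof
    fix x assume "x \<in> combos C (insert d D)"
    then obtain c where c: "\<forall>t\<in>insert d D. c t \<in> C" "x = (\<Sum>t\<in>insert d D. c t *\<^sub>R t)"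
      using combosE by metis
    have "(\<Sum>t\<in>D. c t *\<^sub>R t) \<in> combos C D" by (rule combosI) (use c in auto)
    moreover have "x = c d *\<^sub>R d + (\<Sum>t\<in>D. c t *\<^sub>R t)" using c(2) insert.hyps by simp
    ultimately show "x \<in> (\<lambda>(q, x). q *\<^sub>R d + x) ` (C \<times> combos C D)" using c(1) by force
  qed
  moreover have "countable (C \<times> combos C D)" using insert.IH assms(2) by simp
  ultimately show ?case by (meson countable_image countable_subset)
qed

section \<open>Shrinking lifts, and simplicial hulls of finite sets\<close>

context riesz_cone
begin

text \<open>A bound on \<open>y\<close> that holds only up to elements of \<open>M\<close> becomes
  an exact bound once \<open>y\<close> is lowered by an element of \<open>M\<close>.\<close>

lemma small_lift:
  assumes M: "face M" and y: "y \<in> P" and I: "finite I"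
    and c: "\<And>i. i \<in> I \<Longrightarrow> c i \<in> Fpos" and x: "\<And>i. i \<in> I \<Longrightarrow> x i \<in> P" and n: "\<And>i. i \<in> I \<Longrightarrow> n i \<in> M"
    and le: "\<And>i. i \<in> I \<Longrightarrow> x i + n i - c i *\<^sub>R y \<in> P"
  shows "\<exists>y'\<in>P. y - y' \<in> M \<and> (\<forall>i\<in>I. x i - c i *\<^sub>R y' \<in> P)"
  using I c x n le
proof (induction I rule: finite_induct)
  case empty
  show ?case using y faceD(2)[OF M] by (intro bexI[of _ y]) auto
next
  case (insert i I)
  obtain y' where y': "y' \<in> P" "y - y' \<in> M" "\<forall>i\<in>I. x i - c i *\<^sub>R y' \<in> P"
    using insert.IH insert.prems by auto
  have ci: "c i \<in> Fpos" and xi: "x i \<in> P" and ni: "n i \<in> M" and lei: "x i + n i - c i *\<^sub>R y \<in> P"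
    using insert.prems by auto
  show ?case
  proof (cases "c i = 0")
    case True
    then show ?thesis using y' xi by (intro bexI[of _ y']) auto
  next
    case False
    have ic: "inverse (c i) \<in> Fpos" using ci inverse_mem by simp
    have "x i + n i - c i *\<^sub>R y + c i *\<^sub>R (y - y') \<in> P"
      by (intro add_P scale_P lei ci faceD(1)[OF M y'(2)])
    then have "x i + n i - c i *\<^sub>R y' \<in> P" by (simp add: scaleR_diff_right)
    then have "inverse (c i) *\<^sub>R (x i + n i - c i *\<^sub>R y') \<in> P" by (rule scale_P[OF ic])
    then have d: "inverse (c i) *\<^sub>R x i + inverse (c i) *\<^sub>R n i - y' \<in> P"
      using False by (simp add: scaleR_diff_right scaleR_add_right)
    \<comment> \<open>Decompose along the two terms of the upper bound: keep the part below the
      multiple of \<open>x i\<close>, and discard the part below the multiple of \<open>n i\<close>,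
      which lies in \<open>M\<close>. Lowering further does not harm the earlier bounds.\<close>
    obtain z m where zm: "y' = z + m" "z \<in> P" "m \<in> P" "inverse (c i) *\<^sub>R x i - z \<in> P"
      "inverse (c i) *\<^sub>R n i - m \<in> P"
      using decomposition[OF y'(1) scale_P[OF ic xi] scale_P[OF ic faceD(1)[OF M ni]] d] by blast
    have m: "m \<in> M" by (rule face_le[OF M face_scale[OF M ic ni] zm(3,5)])
    have eq: "y - z = (y - y') + m" using zm(1) by simp
    have 1: "y - z \<in> M" unfolding eq by (rule faceD(3)[OF M y'(2) m])
    have "c i *\<^sub>R (inverse (c i) *\<^sub>R x i - z) \<in> P" by (rule scale_P[OF ci zm(4)])
    then have 2: "x i - c i *\<^sub>R z \<in> P" using False by (simp add: scaleR_diff_right)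
    have 3: "x j - c j *\<^sub>R z \<in> P" if j: "j \<in> I" for j
    proof -
      have "(x j - c j *\<^sub>R y') + c j *\<^sub>R m \<in> P"
        using y'(3) j insert.prems(1)[of j] zm(3) by (intro add_P scale_P) auto
      then show ?thesis using zm(1) by (simp add: scaleR_add_right)
    qed
    show ?thesis using zm(2) 1 2 3 by (intro bexI[of _ z]) auto
  qed
qed

text \<open>The lifts are shrunk one at a time. Since all summands are positive,
  \<open>x i + b i\<close> dominates each single \<open>c i t *\<^sub>R y t\<close>, so
  \<open>small_lift\<close> applies with \<open>b i\<close> as the excess.\<close>

lemma simultaneous_lift:
  assumes M: "face M" and T: "finite T" and I: "finite I"
    and y: "\<And>t. t \<in> T \<Longrightarrow> y t \<in> P" and x: "\<And>i. i \<in> I \<Longrightarrow> x i \<in> P"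
    and c: "\<And>i t. i \<in> I \<Longrightarrow> t \<in> T \<Longrightarrow> c i t \<in> Fpos"
    and ab: "\<And>i. i \<in> I \<Longrightarrow> a i \<in> M \<and> b i \<in> M \<and> x i - (\<Sum>t\<in>T. c i t *\<^sub>R y t) = a i - b i"
  shows "\<exists>y'. (\<forall>t\<in>T. y' t \<in> P \<and> y t - y' t \<in> M) \<and> (\<forall>i\<in>I. x i - (\<Sum>t\<in>T. c i t *\<^sub>R y' t) \<in> P)"
  using T y x c ab
proof (induction T arbitrary: x a rule: finite_induct)
  case empty
  then show ?case by simp
next
  case (insert t T)
  have "\<exists>z\<in>P. y t - z \<in> M \<and> (\<forall>i\<in>I. x i - c i t *\<^sub>R z \<in> P)"
  proof (rule small_lift[OF M _ I])
    show "y t \<in> P" using insert.prems by simp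
    show "c i t \<in> Fpos" "x i \<in> P" "b i \<in> M" if "i \<in> I" for i using insert.prems that by auto
    show "x i + b i - c i t *\<^sub>R y t \<in> P" if i: "i \<in> I" for i
    proof -
      have "(\<Sum>t\<in>T. c i t *\<^sub>R y t) + a i \<in> P"
        using insert.prems i faceD(1)[OF M] by (intro add_P sum_P scale_P) auto
      moreover have "x i - (c i t *\<^sub>R y t + (\<Sum>t\<in>T. c i t *\<^sub>R y t)) = a i - b i"
        using insert.prems(4)[OF i] insert.hyps by simp
      then have "x i + b i - c i t *\<^sub>R y t = (\<Sum>t\<in>T. c i t *\<^sub>R y t) + a i" by (simp add: algebra_simps)
      ultimately show ?thesis by simp
    qed
  qed
  then obtain z where z: "z \<in> P" "y t - z \<in> M" "\<And>i. i \<in> I \<Longrightarrow> x i - c i t *\<^sub>R z \<in> P" by blast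
  \<comment> \<open>The part already used is subtracted from \<open>x i\<close>; the loss
    \<open>y t - z\<close> incurred by shrinking is in \<open>M\<close> and is absorbed into
    \<open>a i\<close>.\<close>
  have "\<exists>y'. (\<forall>t\<in>T. y' t \<in> P \<and> y t - y' t \<in> M) \<and>
    (\<forall>i\<in>I. (x i - c i t *\<^sub>R z) - (\<Sum>t\<in>T. c i t *\<^sub>R y' t) \<in> P)"
  proof (rule insert.IH[of "\<lambda>i. x i - c i t *\<^sub>R z" "\<lambda>i. a i + c i t *\<^sub>R (y t - z)"])
    show "y u \<in> P" if "u \<in> T" for u using insert.prems that by simp
    show "x i - c i t *\<^sub>R z \<in> P" if "i \<in> I" for i using z(3) that .
    show "c i u \<in> Fpos" if "i \<in> I" "u \<in> T" for i u using insert.prems that by simp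
    show "a i + c i t *\<^sub>R (y t - z) \<in> M \<and> b i \<in> M \<and>
      x i - c i t *\<^sub>R z - (\<Sum>t\<in>T. c i t *\<^sub>R y t) = a i + c i t *\<^sub>R (y t - z) - b i" if i: "i \<in> I" for i
    proof (intro conjI)
      show "b i \<in> M" using insert.prems(4)[OF i] by simp
      show "a i + c i t *\<^sub>R (y t - z) \<in> M"
        using insert.prems(3,4)[OF i] z(2) by (intro faceD(3)[OF M] face_scale[OF M]) auto
      have "x i - (c i t *\<^sub>R y t + (\<Sum>t\<in>T. c i t *\<^sub>R y t)) = a i - b i"
        using insert.prems(4)[OF i] insert.hyps by simp
      then show "x i - c i t *\<^sub>R z - (\<Sum>t\<in>T. c i t *\<^sub>R y t) = a i + c i t *\<^sub>R (y t - z) - b i"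
        by (simp add: algebra_simps)
    qed
  qed
  then obtain y' where y': "\<forall>t\<in>T. y' t \<in> P \<and> y t - y' t \<in> M"
    "\<forall>i\<in>I. (x i - c i t *\<^sub>R z) - (\<Sum>t\<in>T. c i t *\<^sub>R y' t) \<in> P" by blast
  have eq: "(\<Sum>u\<in>T. c i u *\<^sub>R (y'(t := z)) u) = (\<Sum>u\<in>T. c i u *\<^sub>R y' u)" for i
    using insert.hyps by (intro sum.cong) auto
  show ?case
  proof (intro exI[of _ "y'(t := z)"] conjI ballI)
    fix u assume "u \<in> insert t T"
    then show "(y'(t := z)) u \<in> P" "y u - (y'(t := z)) u \<in> M" using y'(1) z insert.hyps by auto
  next
    fix i assume "i \<in> I"
    then show "x i - (\<Sum>u\<in>insert t T. c i u *\<^sub>R (y'(t := z)) u) \<in> P"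
      using y'(2) unfolding sum.insert[OF insert.hyps] eq by (simp add: diff_diff_eq)
  qed
qed

text \<open>The simplicial cone is produced in a complement of \<open>span M\<close>, which models
  the quotient. Its generators are positive only modulo \<open>M\<close>, so each \<open>t\<close>
  comes with a representative \<open>y t\<close> in \<open>Q\<close>.\<close>

lemma simple_quotient_basis:
  assumes Q: "face Q" and M: "maximal_face M Q" and S: "finite S" "S \<subseteq> Q"
  shows "\<exists>T y c. finite T \<and> independent T \<and> (\<forall>x. x \<in> span T \<longrightarrow> x \<in> span M \<longrightarrow> x = 0) \<and>
    (\<forall>t\<in>T. y t \<in> Q \<and> y t - t \<in> span M) \<and> (\<forall>s\<in>S. \<forall>t\<in>T. c s t \<in> Fpos) \<and>
    (\<forall>s\<in>S. s - (\<Sum>t\<in>T. c s t *\<^sub>R y t) \<in> span M)"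
proof -
  interpret maximal_face_pair F B P Q M
    by unfold_locales (rule Q, rule M)
  obtain C' where C': "C' \<subseteq> M" "finite C'" "independent C'" "span C' = span M"
    using face_basis[OF face_M empty_subsetI real_vector.independent_empty] by metis
  obtain C where C: "C' \<subseteq> C" "C \<subseteq> Q" "finite C" "independent C" "Q \<subseteq> combos F C"
    using face_basis[OF Q _ C'(3)] C'(1) M_subset by (metis subset_trans)
  define D where "D = C - C'"
  have CD: "C' \<union> D = C" "C' \<inter> D = {}" "finite D" "D \<subseteq> Q" using C by (auto simp: D_def)
  have indD: "independent D" using C(4) by (rule real_vector.independent_mono) (simp add: D_def)
  obtain p where p: "p \<in> Q" "p \<notin> M" using M by (auto simp: maximal_face_def)
  obtain \<Phi> where \<Phi>: "maximal_frame \<Phi>" using maximal_frame_exists .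
  then have fr: "frame \<Phi>" by (simp add: maximal_frame_def)
  note st = frameD[OF fr]
  have zero: "\<phi> x = 0" if \<phi>: "\<phi> \<in> \<Phi>" and x: "x \<in> span M" for \<phi> x
  proof (rule linear_eq_0_on_span[OF stateD(1)[OF st(2)[OF \<phi>]] _ x])
    show "\<phi> m = 0" if "m \<in> M" for m using stateD(3)[OF st(2)[OF \<phi>] that] .
  qed
  \<comment> \<open>Projection along \<open>M\<close>: drop the coordinates at the part
    \<open>C'\<close> of the basis. The component stays over \<open>F\<close>.\<close>
  have "\<exists>d\<in>combos F D. s - d \<in> span M" if "s \<in> Q" for s
  proof -
    have "s \<in> combos F C" using C(5) that by blast
    then obtain a where a: "\<forall>c\<in>C. a c \<in> F" "s = (\<Sum>c\<in>C. a c *\<^sub>R c)"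
      using combosE by metis
    have "s = (\<Sum>c\<in>C'. a c *\<^sub>R c) + (\<Sum>c\<in>D. a c *\<^sub>R c)"
      unfolding a(2) CD(1)[symmetric] by (rule sum.union_disjoint) (use C' CD in auto)
    then have "s - (\<Sum>c\<in>D. a c *\<^sub>R c) = (\<Sum>c\<in>C'. a c *\<^sub>R c)" by simp
    also have "\<dots> \<in> span M" using C'(1) by (intro span_sum span_scale span_base) blast
    finally have "s - (\<Sum>c\<in>D. a c *\<^sub>R c) \<in> span M" .
    moreover have "(\<Sum>c\<in>D. a c *\<^sub>R c) \<in> combos F D"
      by (rule combosI) (use a(1) CD(1) in auto)
    ultimately show ?thesis by blast
  qed
  then obtain \<pi> where \<pi>: "\<And>s. s \<in> Q \<Longrightarrow> \<pi> s \<in> combos F D" "\<And>s. s \<in> Q \<Longrightarrow> s - \<pi> s \<in> span M" by metis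
  have "Q \<subseteq> span (M \<union> D)"
  proof -
    have "C \<subseteq> M \<union> D" using C'(1) CD(1) by blast
    then have "span C \<subseteq> span (M \<union> D)" by (rule span_mono)
    then show ?thesis using C(5) combos_subset_span[of F C] by blast
  qed
  then have dual: "\<exists>w\<in>span D. \<phi> w = 1 \<and> (\<forall>\<psi>\<in>\<Phi> - {\<phi>}. \<psi> w = 0)" if "\<phi> \<in> \<Phi>" for \<phi>
    using frame_dual[OF fr _ that] by blast
  have SD: "finite (\<pi> ` (S - M))" "\<pi> ` (S - M) \<subseteq> span D"
    using S \<pi>(1) combos_subset_span[of F D] by auto
  have pos: "0 < \<phi> x" if "x \<in> \<pi> ` (S - M)" "\<phi> \<in> \<Phi>" for x \<phi>
  proof -
    obtain s where s: "s \<in> S" "s \<notin> M" "x = \<pi> s" using \<open>x \<in> \<pi> ` (S - M)\<close> by blast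
    then have sQ: "s \<in> Q" using S by blast
    have "\<phi> (s - \<pi> s) = 0" by (rule zero[OF that(2) \<pi>(2)[OF sQ]])
    then have "\<phi> (\<pi> s) = \<phi> s" using stateD(5)[OF st(2)[OF that(2)]] by simp
    then show ?thesis using frame_pos[OF fr that(2) sQ s(2)] s(3) by simp
  qed
  have "\<exists>T. finite T \<and> independent T \<and> span T = span D \<and> T \<subseteq> combos F D \<and>
    (\<forall>t\<in>T. \<forall>\<phi>\<in>\<Phi>. 0 < \<phi> t) \<and> (\<forall>s\<in>\<pi> ` (S - M). \<forall>t\<in>T. 0 < representation T s t)"
    by (rule simplicial_basis) (fact CD(3) st(1) maximal_frame_nonempty[OF \<Phi> p] stateD(1)[OF st(2)] dual SD pos)+
  then obtain T where T: "finite T" "independent T" "span T = span D" "T \<subseteq> combos F D"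
    "\<forall>t\<in>T. \<forall>\<phi>\<in>\<Phi>. 0 < \<phi> t" "\<forall>s\<in>\<pi> ` (S - M). \<forall>t\<in>T. 0 < representation T s t"
    by blast
  \<comment> \<open>Strict positivity on the maximal frame writes \<open>t\<close> as an element of
    \<open>Q\<close> minus an element of \<open>M\<close>; the former is the lift.\<close>
  have "\<exists>a. a \<in> Q \<and> a - t \<in> span M" if t: "t \<in> T" for t
  proof -
    have "combos F D \<subseteq> {x - y |x y. x \<in> Q \<and> y \<in> Q}"
      by (rule combos_F_least[OF F_subspace_differences[OF Q]]) (use CD(4) faceD(2)[OF Q] in force)
    then obtain u v where uv: "u \<in> Q" "v \<in> Q" "t = u - v" using T(4) t by blast
    have "\<phi> v < \<phi> u" if "\<phi> \<in> \<Phi>" for \<phi>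
      using T(5) t that uv(3) stateD(5)[OF st(2)[OF that]] by force
    then obtain a b where ab: "a \<in> Q" "b \<in> M" "u - v = a - b"
      using maximal_frame_positive[OF \<Phi> p uv(1,2)] by blast
    then have "a - t = b" using uv(3) by simp
    then show ?thesis using ab span_base by metis
  qed
  then obtain y where y: "\<And>t. t \<in> T \<Longrightarrow> y t \<in> Q \<and> y t - t \<in> span M" by metis
  \<comment> \<open>Elements of \<open>M\<close> were kept out of \<open>simplicial_basis\<close>,
    where the states must be strictly positive; modulo \<open>M\<close> they need coefficient
    0.\<close>
  define c where "c s t = (if s \<in> M then 0 else representation T (\<pi> s) t)" for s t
  show ?thesis
  proof (intro exI[of _ T] exI[of _ y] exI[of _ c] conjI ballI allI impI T(1,2))
    fix t assume "t \<in> T"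
    then show "y t \<in> Q" "y t - t \<in> span M" using y by blast+
  next
    show "x = 0" if "x \<in> span T" "x \<in> span M" for x
      by (rule independent_span_disjoint[of D C']) (use that T(3) C' CD C(4) in auto)
    show "c s t \<in> Fpos" if s: "s \<in> S" and t: "t \<in> T" for s t
    proof (cases "s \<in> M")
      case True
      then show ?thesis by (simp add: c_def zero_mem)
    next
      case False
      have sQ: "s \<in> Q" using s S by blast
      have "\<pi> s \<in> span T \<inter> combos F D" using \<pi>(1)[OF sQ] combos_subset_span[of F D] T(3) by blast
      then have "\<pi> s \<in> combos F T"
        using span_inter_combos[OF CD(3) indD T(1,2,4)] by blast
      then have "representation T (\<pi> s) t \<in> F"
        using combos_iff_representation[OF T(1,2)] t by blast
      then show ?thesis using T(6) s t False by (auto simp: c_def intro: less_imp_le)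
    qed
    show "s - (\<Sum>t\<in>T. c s t *\<^sub>R y t) \<in> span M" if s: "s \<in> S" for s
    proof (cases "s \<in> M")
      case True
      then show ?thesis by (simp add: c_def span_base)
    next
      case False
      have sQ: "s \<in> Q" using s S by blast
      have "\<pi> s \<in> span T" using \<pi>(1)[OF sQ] combos_subset_span[of F D] T(3) by blast
      then have "\<pi> s = (\<Sum>t\<in>T. c s t *\<^sub>R t)"
        using sum_representation[OF T(1,2)] False by (simp add: c_def)
      then have "s - (\<Sum>t\<in>T. c s t *\<^sub>R y t) = (s - \<pi> s) - (\<Sum>t\<in>T. c s t *\<^sub>R (y t - t))"
        by (simp add: scaleR_diff_right sum_subtractf)
      also have "\<dots> \<in> span M"
        by (rule span_diff[OF \<pi>(2)[OF sQ]], rule span_sum, rule span_scale) (use y in blast)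
      finally show ?thesis .
    qed
  qed
qed

lemma combos_cone_sum: "(\<And>i. i \<in> I \<Longrightarrow> f i \<in> combos Fpos T) \<Longrightarrow> sum f I \<in> combos Fpos T"
  by (induction I rule: infinite_finite_induct) (auto intro: combos_cone)

lemma combos_cone_least:
  assumes "finite T" "S \<subseteq> combos Fpos T"
  shows "combos Fpos S \<subseteq> combos Fpos T"
  by (rule combos_leastI) (use assms(2) in \<open>auto intro: combos_cone\<close>)

lemma combos_cone_base: "finite T \<Longrightarrow> T \<subseteq> combos Fpos T"
  using in_combos[of T _ Fpos] zero_mem one_mem by auto

text \<open>Induction on the dimension of the face. Subtracting combinations of shrunken lifts
  leaves remainders in \<open>M\<close>; a hull of these in \<open>M\<close> is independent of the
  lifts because the latter are independent modulo \<open>span M\<close>.\<close>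

lemma simplicial_hull:
  assumes "face Q" "finite S" "S \<subseteq> Q"
  shows "\<exists>T\<subseteq>Q. finite T \<and> independent T \<and> S \<subseteq> combos Fpos T"
  using assms
proof (induction "dim Q" arbitrary: Q S rule: less_induct)
  case less
  note Q = less.prems(1) and S = less.prems(2,3)
  show ?case
  proof (cases "Q = {0}")
    case True
    then have "S \<subseteq> combos Fpos {}" using S combos_cone(1)[of "{}"] by auto
    then show ?thesis using real_vector.independent_empty by blast
  next
    case False
    obtain M where M: "maximal_face M Q" using maximal_face_exists[OF Q False] .
    have fM: "face M" "M \<subset> Q" using M by (auto simp: maximal_face_def)
    obtain T y c where T: "finite T" "independent T" "\<forall>x. x \<in> span T \<longrightarrow> x \<in> span M \<longrightarrow> x = 0"
      and *: "\<forall>t\<in>T. y t \<in> Q \<and> y t - t \<in> span M" "\<forall>s\<in>S. \<forall>t\<in>T. c s t \<in> Fpos"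
        "\<forall>s\<in>S. s - (\<Sum>t\<in>T. c s t *\<^sub>R y t) \<in> span M"
      using simple_quotient_basis[OF Q M S] by (elim exE conjE)
    note TM = T(3)[rule_format] and y = *(1)[rule_format] and c = *(2)[rule_format] and s = *(3)[rule_format]
    have QE: "x \<in> combos F B" if "x \<in> Q" for x using that face_subset(1)[OF Q] by blast
    have "\<exists>a b. a \<in> M \<and> b \<in> M \<and> s - (\<Sum>t\<in>T. c s t *\<^sub>R y t) = a - b" if sS: "s \<in> S" for s
    proof -
      have "(\<Sum>t\<in>T. c s t *\<^sub>R y t) \<in> Q"
        by (rule face_sum_mem[OF Q], rule face_scale[OF Q]) (use c[OF sS] y in auto)
      then have "s - (\<Sum>t\<in>T. c s t *\<^sub>R y t) \<in> combos F B"
        using F_subspaceD(5)[OF F_subspace_combos] QE S(2) sS by blast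
      then show ?thesis using span_face_differences[OF fM(1) s[OF sS]] by metis
    qed
    then obtain a b where ab: "\<And>s. s \<in> S \<Longrightarrow> a s \<in> M \<and> b s \<in> M \<and> s - (\<Sum>t\<in>T. c s t *\<^sub>R y t) = a s - b s"
      by metis
    have yP: "y t \<in> P" if "t \<in> T" for t using y[OF that] faceD(1)[OF Q] by blast
    have SP: "s \<in> P" if "s \<in> S" for s using that S(2) faceD(1)[OF Q] by blast
    have "\<exists>y'. (\<forall>t\<in>T. y' t \<in> P \<and> y t - y' t \<in> M) \<and> (\<forall>s\<in>S. s - (\<Sum>t\<in>T. c s t *\<^sub>R y' t) \<in> P)"
      by (rule simultaneous_lift[where x = "\<lambda>s. s" and a = a and b = b, OF fM(1) T(1) S(1)])
        (fact yP SP c ab)+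
    then obtain y' where y': "\<And>t. t \<in> T \<Longrightarrow> y' t \<in> P \<and> y t - y' t \<in> M"
      "\<And>s. s \<in> S \<Longrightarrow> s - (\<Sum>t\<in>T. c s t *\<^sub>R y' t) \<in> P" by blast
    have y'Q: "y' t \<in> Q" if "t \<in> T" for t
      by (rule face_le[OF Q]) (use y[OF that] y'(1)[OF that] faceD(1)[OF fM(1)] in auto)
    \<comment> \<open>The remainder is positive by the shrinking and lies in \<open>span M\<close>,
      which together place it in \<open>M\<close>.\<close>
    define r where "r s = s - (\<Sum>t\<in>T. c s t *\<^sub>R y' t)" for s
    have rM: "r s \<in> M" if sS: "s \<in> S" for s
    proof (rule face_mem_span[OF fM(1)])
      show "r s \<in> P" using y'(2)[OF sS] by (simp add: r_def)
      have "r s = (s - (\<Sum>t\<in>T. c s t *\<^sub>R y t)) + (\<Sum>t\<in>T. c s t *\<^sub>R (y t - y' t))"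
        by (simp add: r_def scaleR_diff_right sum_subtractf)
      also have "\<dots> \<in> span M"
        by (rule span_add[OF s[OF sS]], rule span_sum, rule span_scale, rule span_base) (use y'(1) in blast)
      finally show "r s \<in> span M" .
    qed
    obtain T' where T': "T' \<subseteq> M" "finite T'" "independent T'" "r ` S \<subseteq> combos Fpos T'"
      using less.hyps[OF dim_face_less[OF fM(1) Q fM(2)] fM(1), of "r ` S"] S(1) rM by auto
    have "independent (y' ` T \<union> T')"
    proof (rule independent_lift[OF T(1,2) TM T'(2,3)])
      show "T' \<subseteq> span M" using T'(1) span_base by blast
      show "y' t - t \<in> span M" if t: "t \<in> T" for t
      proof -
        have "(y t - t) - (y t - y' t) \<in> span M"
          using y[OF t] y'(1)[OF t] span_base[of "y t - y' t" M] by (metis span_diff)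
        then show ?thesis by simp
      qed
    qed
    moreover have "s \<in> combos Fpos (y' ` T \<union> T')" if sS: "s \<in> S" for s
    proof -
      let ?T = "y' ` T \<union> T'"
      have fin: "finite ?T" using T T' by simp
      have mem: "x \<in> combos Fpos ?T" if "x \<in> ?T" for x
        by (rule in_combos[OF fin that]) (use zero_mem one_mem in auto)
      have "(\<Sum>t\<in>T. c s t *\<^sub>R y' t) \<in> combos Fpos ?T"
        by (rule combos_cone_sum, rule combos_cone(3)[OF c[OF sS]]) (use mem in auto)
      moreover have "combos Fpos T' \<subseteq> combos Fpos ?T"
        by (rule combos_leastI) (use mem in \<open>auto intro: combos_cone\<close>)
      then have "r s \<in> combos Fpos ?T" using T'(4) sS by blast
      ultimately have "(\<Sum>t\<in>T. c s t *\<^sub>R y' t) + r s \<in> combos Fpos ?T" by (rule combos_cone(2))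
      then show ?thesis by (simp add: r_def)
    qed
    moreover have "y' ` T \<union> T' \<subseteq> Q" "finite (y' ` T \<union> T')" using y'Q T' fM T by auto
    ultimately show ?thesis by blast
  qed
qed

section \<open>Countable generation and the increasing sequence of simplicial cones\<close>

text \<open>Rounding the coordinates of \<open>x\<close> down gives a rational vector
  \<open>y\<close> in the same face, and \<open>x - y\<close> is a nonnegative combination of basis
  vectors that are themselves generators. What has to be shown is that \<open>y\<close> is still
  positive.\<close>

lemma countably_generated:
  "\<exists>G\<subseteq>P. countable G \<and> (\<forall>x\<in>P. \<exists>S\<subseteq>G. finite S \<and> x \<in> combos Fpos S)"
proof -
  have "\<exists>C. C \<subseteq> R \<and> finite C \<and> independent C \<and> R \<subseteq> combos F C \<and> span C = span R" if "face R" for R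
    using face_basis[OF that empty_subsetI real_vector.independent_empty] by metis
  then obtain C where C: "\<And>R. face R \<Longrightarrow> C R \<subseteq> R" "\<And>R. face R \<Longrightarrow> finite (C R)"
    "\<And>R. face R \<Longrightarrow> R \<subseteq> combos F (C R)" "\<And>R. face R \<Longrightarrow> span (C R) = span R" by metis
  define G where "G = (\<Union>R\<in>{R. face R}. R \<inter> combos \<rat> (C R))"
  have "{R. face R} = {R. face R \<and> R \<subseteq> P}" using faceD(1) by blast
  then have "finite {R. face R}" using finite_faces[OF face_P] by simp
  then have "countable G"
    unfolding G_def using countable_combos[OF C(2) countable_rat]
    by (intro countable_UN countable_Int2) (auto intro: countable_finite)
  moreover have "G \<subseteq> P" using faceD(1) by (auto simp: G_def)
  moreover have "\<exists>S\<subseteq>G. finite S \<and> x \<in> combos Fpos S" if x: "x \<in> P" for x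
  proof -
    \<comment> \<open>In the face generated by \<open>x\<close> the element \<open>x\<close> is an
      order unit, so it has room for a small perturbation in every direction of
      \<open>span R\<close>.\<close>
    define R where "R = face_gen {0} x"
    have R: "face R" "x \<in> R" using face_gen[OF face_zero x] by (auto simp: R_def)
    note CR = C[OF R(1)]
    have "x \<in> combos F (C R)" using CR(3) R(2) by blast
    then obtain a where a: "\<forall>c\<in>C R. a c \<in> F" "x = (\<Sum>c\<in>C R. a c *\<^sub>R c)" using combosE by metis
    have "\<exists>n::nat. real n *\<^sub>R x - c \<in> P" if "c \<in> C R" for c
      using that CR(1) unfolding R_def face_gen_def by auto
    then obtain m :: "'a \<Rightarrow> nat" where m: "\<And>c. c \<in> C R \<Longrightarrow> real (m c) *\<^sub>R x - c \<in> P" by metis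
    define N where "N = Suc (\<Sum>c\<in>C R. m c)"
    have N: "real N *\<^sub>R x - c \<in> P" if c: "c \<in> C R" for c
    proof -
      have "m c \<le> N" using member_le_sum[of c "C R" m] CR(2) c by (simp add: N_def)
      then have "(real N - real (m c)) *\<^sub>R x \<in> P"
        using x of_nat_mem diff_mem by (intro scale_P) auto
      from add_P[OF m[OF c] this] show ?thesis by (simp add: scaleR_diff_left)
    qed
    \<comment> \<open>Makes the total rounding error at most \<open>1 / N\<close>; the successor
      avoids a zero denominator when the basis is empty.\<close>
    define e where "e = 1 / (real N * real (Suc (card (C R))))"
    have N0: "0 < N" by (simp add: N_def)
    have e: "0 < e" using N0 by (simp add: e_def)
    have "\<exists>q. q \<in> \<rat> \<and> a c - e < q \<and> q < a c" for c
      using Rats_dense_in_real[of "a c - e" "a c"] e by auto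
    then obtain q where q: "\<And>c. q c \<in> \<rat>" "\<And>c. a c - e < q c" "\<And>c. q c < a c" by metis
    have aq: "a c - q c \<in> Fpos" if "c \<in> C R" for c
      using a(1) that q(1)[of c] q(3)[of c] Rats_subset by (auto intro: diff_mem)
    define y where "y = (\<Sum>c\<in>C R. q c *\<^sub>R c)"
    have xy: "x = y + (\<Sum>c\<in>C R. (a c - q c) *\<^sub>R c)"
      by (simp add: a(2) y_def scaleR_diff_left sum_subtractf)
    define d where "d = (\<Sum>c\<in>C R. a c - q c)"
    have dF: "d \<in> F"
    proof -
      have "(\<Sum>c\<in>D. a c - q c) \<in> F" if "finite D" "D \<subseteq> C R" for D
        using that aq by (induction D rule: finite_induct) (auto intro: zero_mem add_mem)
      then show ?thesis using CR(2) by (simp add: d_def)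
    qed
    have "d \<le> (\<Sum>c\<in>C R. e)"
      unfolding d_def using q(2) by (intro sum_mono) (simp add: less_imp_le algebra_simps)
    also have "\<dots> = real (card (C R)) * e" by simp
    finally have "d * real N \<le> real (card (C R)) * e * real N" by (intro mult_right_mono) auto
    also have "\<dots> \<le> 1" using N0 by (simp add: e_def divide_simps)
    finally have dN: "d * real N \<le> 1" .
    \<comment> \<open>Each subtracted basis vector is compensated by \<open>N\<close> copies of
      \<open>x\<close>; as the total error is at most \<open>1 / N\<close>, a nonnegative multiple
      of \<open>x\<close> remains.\<close>
    have "y = (\<Sum>c\<in>C R. (a c - q c) *\<^sub>R (real N *\<^sub>R x - c)) + (1 - d * real N) *\<^sub>R x"
    proof -
      have "(\<Sum>c\<in>C R. (a c - q c) *\<^sub>R (real N *\<^sub>R x - c)) = (d * real N) *\<^sub>R x - (x - y)"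
      proof -
        have 1: "(\<Sum>c\<in>C R. (a c - q c) *\<^sub>R c) = x - y"
          using arg_cong[OF xy, of "\<lambda>z. z - y"] by simp
        have "(\<Sum>c\<in>C R. (a c - q c) *\<^sub>R (real N *\<^sub>R x - c)) =
            (\<Sum>c\<in>C R. ((a c - q c) * real N) *\<^sub>R x) - (\<Sum>c\<in>C R. (a c - q c) *\<^sub>R c)"
          by (simp add: scaleR_diff_right sum_subtractf)
        also have "(\<Sum>c\<in>C R. ((a c - q c) * real N) *\<^sub>R x) = (d * real N) *\<^sub>R x"
          by (simp only: d_def sum_distrib_right scaleR_sum_left)
        finally show ?thesis unfolding 1 .
      qed
      then show ?thesis by (simp add: scaleR_diff_left)
    qed
    moreover have "(\<Sum>c\<in>C R. (a c - q c) *\<^sub>R (real N *\<^sub>R x - c)) \<in> P"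
      by (rule sum_P, rule scale_P) (use aq N in blast)+
    moreover have "(1 - d * real N) *\<^sub>R x \<in> P"
      using dN dF of_nat_mem one_mem by (intro scale_P x) (auto intro: diff_mem mult_mem)
    ultimately have yP: "y \<in> P" using add_P by metis
    have yC: "y \<in> combos \<rat> (C R)" unfolding y_def using q(1) by (intro combosI) auto
    then have "y \<in> span R" using combos_subset_span[of \<rat> "C R"] CR(4) by blast
    then have "y \<in> R" by (rule face_mem_span[OF R(1) yP])
    then have "y \<in> G" unfolding G_def using R(1) yC by blast
    moreover have CG: "C R \<subseteq> G"
      unfolding G_def using R(1) CR(1) in_combos[OF CR(2), of _ \<rat>] by auto
    moreover have "x \<in> combos Fpos (insert y (C R))"
    proof -
      have fin: "finite (insert y (C R))" using CR(2) by simp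
      note b = subsetD[OF combos_cone_base[OF fin]]
      have "(\<Sum>c\<in>C R. (a c - q c) *\<^sub>R c) \<in> combos Fpos (insert y (C R))"
        by (rule combos_cone_sum, rule combos_cone(3)) (use aq b in blast)+
      then show ?thesis
        by (subst xy) (rule combos_cone(2)[OF b], auto)
    qed
    ultimately show ?thesis using CR(2) by (intro exI[of _ "insert y (C R)"]) auto
  qed
  ultimately show ?thesis by blast
qed

text \<open>Each step takes a simplicial hull of the previous generators and one more generator of
  \<open>P\<close>. The assumption, supplied by directedness, is what gives the bases full
  cardinality.\<close>

lemma increasing_bases:
  assumes "combos F B \<subseteq> span P"
  obtains T :: "nat \<Rightarrow> 'a set" where "\<And>k. T k \<subseteq> P" "\<And>k. finite (T k)" "\<And>k. independent (T k)"
    "\<And>k. card (T k) = card B" "\<And>k. combos F (T k) = combos F B" "\<And>k. T k \<subseteq> combos Fpos (T (Suc k))"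
    "\<And>x. x \<in> P \<Longrightarrow> \<exists>k. x \<in> combos Fpos (T k)"
proof -
  have spP: "span P = span B"
  proof
    show "span P \<subseteq> span B"
      by (rule span_minimal[OF face_subset(2)[OF face_P] real_vector.subspace_span])
    have "B \<subseteq> combos F B" using in_combos[OF finite_B _ zero_mem one_mem] by blast
    then show "span B \<subseteq> span P"
      by (intro span_minimal[OF _ real_vector.subspace_span]) (use assms in blast)
  qed
  obtain C0 where C0: "C0 \<subseteq> P" "finite C0" "independent C0" "span C0 = span P"
    using face_basis[OF face_P empty_subsetI real_vector.independent_empty] by metis
  obtain G where G: "G \<subseteq> P" "countable G" "\<And>x. x \<in> P \<Longrightarrow> \<exists>S\<subseteq>G. finite S \<and> x \<in> combos Fpos S"
    using countably_generated by metis
  \<comment> \<open>Inserting 0 makes the enumerated set nonempty and adds nothing to the generated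
    cone.\<close>
  define g where "g = from_nat_into (insert 0 G)"
  have g: "range g = insert 0 G" unfolding g_def using G(2) by (intro range_from_nat_into) auto
  have "g k \<in> insert 0 G" for k unfolding g[symmetric] by (rule rangeI)
  then have gP: "g k \<in> P" for k using G(1) zero_P by (metis insertE subsetD)
  \<comment> \<open>A fixed basis \<open>C0\<close> of \<open>P\<close> is kept in every cone. This
    forces each \<open>T k\<close> to span, so all have the same number of elements.\<close>
  define good where "good T \<longleftrightarrow> T \<subseteq> P \<and> finite T \<and> independent T \<and> C0 \<subseteq> combos Fpos T" for T
  have "\<exists>T. \<forall>k. good (T k) \<and> insert (g k) (T k) \<subseteq> combos Fpos (T (Suc k))"
  proof (rule dependent_nat_choice)
    show "\<exists>T. good T"
      by (rule exI[of _ C0]) (simp add: good_def C0 combos_cone_base)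
  next
    fix T k assume T: "good T"
    have "finite (insert (g k) T)" "insert (g k) T \<subseteq> P" using T gP by (auto simp: good_def)
    then obtain T' where T': "T' \<subseteq> P" "finite T'" "independent T'" "insert (g k) T \<subseteq> combos Fpos T'"
      using simplicial_hull[OF face_P, of "insert (g k) T"] by auto
    have "combos Fpos T \<subseteq> combos Fpos T'" by (rule combos_cone_least[OF T'(2)]) (use T' in blast)
    then have "good T'" using T T' unfolding good_def by blast
    then show "\<exists>T'. good T' \<and> insert (g k) T \<subseteq> combos Fpos T'" using T'(4) by blast
  qed
  then obtain T where T: "\<And>k. good (T k)" "\<And>k. insert (g k) (T k) \<subseteq> combos Fpos (T (Suc k))"
    by blast
  have fin: "finite (T k)" for k using T(1)[of k] by (simp add: good_def)
  show thesis
  proof (rule that[of T])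
    show "T k \<subseteq> P" "finite (T k)" "independent (T k)" for k using T(1)[of k] by (auto simp: good_def)
    show "T k \<subseteq> combos Fpos (T (Suc k))" for k using T(2)[of k] by blast
    have spT: "span (T k) = span B" for k
    proof -
      have Tk: "T k \<subseteq> P" "C0 \<subseteq> span (T k)"
        using T(1)[of k] combos_subset_span[of Fpos "T k"] by (auto simp: good_def)
      have "span C0 \<subseteq> span (T k)" using Tk(2) by (rule span_minimal[OF _ real_vector.subspace_span])
      moreover have "span (T k) \<subseteq> span P" using Tk(1) by (rule span_mono)
      ultimately show ?thesis using C0(4) spP by simp
    qed
    have ind: "independent (T k)" for k using T(1)[of k] by (simp add: good_def)
    show "card (T k) = card B" for k
      using arg_cong[OF spT[of k], of dim] real_vector.dim_eq_card_independent[OF ind, of k]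
        real_vector.dim_eq_card_independent[OF independent_B] by simp
    show "combos F (T k) = combos F B" for k
    proof
      have TE: "T k \<subseteq> combos F B" using T(1)[of k] P_subset by (auto simp: good_def)
      then show "combos F (T k) \<subseteq> combos F B" by (rule combos_F_least[OF F_subspace_combos])
      show "combos F B \<subseteq> combos F (T k)"
        using span_inter_combos[OF finite_B independent_B fin ind TE] combos_subset_span[of F B] spT
        by blast
    qed
    have mono: "combos Fpos (T k) \<subseteq> combos Fpos (T l)" if "k \<le> l" for k l
      using that
    proof (induction l rule: dec_induct)
      case (step l)
      have "combos Fpos (T l) \<subseteq> combos Fpos (T (Suc l))"
        by (rule combos_cone_least[OF fin]) (use T(2)[of l] in blast)
      then show ?case using step.IH by blast
    qed simp
    fix x assume "x \<in> P"
    then obtain S where S: "S \<subseteq> G" "finite S" "x \<in> combos Fpos S" using G(3) by blast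
    have "\<exists>k. S \<subseteq> combos Fpos (T k)"
      using S(2,1)
    proof (induction S rule: finite_induct)
      case (insert s S)
      then obtain k where k: "S \<subseteq> combos Fpos (T k)" by blast
      obtain j where j: "s = g j" using g insert.prems by blast
      have "s \<in> combos Fpos (T (Suc j))" using T(2)[of j] j by blast
      then have "insert s S \<subseteq> combos Fpos (T (max k (Suc j)))"
        using k mono[of k "max k (Suc j)"] mono[of "Suc j" "max k (Suc j)"] by auto
      then show ?case by blast
    qed simp
    then obtain k where "S \<subseteq> combos Fpos (T k)" by blast
    then show "\<exists>k. x \<in> combos Fpos (T k)" using combos_cone_least[OF fin] S(3) by blast
  qed
qed

end

section \<open>Charts and the inductive limit\<close>

lemma coord_space_sel [simp]:
  "carrier (coord_space F n) = {v \<in> carrier_vec n. \<forall>i<n. v $ i \<in> F}"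
  "\<zero>\<^bsub>coord_space F n\<^esub> = 0\<^sub>v n" "x \<oplus>\<^bsub>coord_space F n\<^esub> y = x + y" "c \<odot>\<^bsub>coord_space F n\<^esub> x = c \<cdot>\<^sub>v x"
  by (simp_all add: coord_space_def module_vec_def)

lemma real_subfield_of_field:
  assumes "field (scalars F)"
  shows "real_subfield F"
proof -
  interpret F: field "scalars F" by (rule assms)
  have um: "- x \<in> F" if "x \<in> F" for x
  proof -
    have "\<ominus>\<^bsub>scalars F\<^esub> x \<in> F" "\<ominus>\<^bsub>scalars F\<^esub> x + x = 0"
      using F.a_inv_closed[of x] F.l_neg[of x] that by simp_all
    then show ?thesis by (metis add_eq_0_iff2)
  qed
  show ?thesis
  proof
    show "1 \<in> F" using F.one_closed by simp
    show "x * y \<in> F" if "x \<in> F" "y \<in> F" for x y using F.m_closed[of x y] that by simp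
    show "x - y \<in> F" if "x \<in> F" "y \<in> F" for x y using F.a_closed[of x "- y"] that um by simp
    show "inverse x \<in> F" if x: "x \<in> F" for x
    proof (cases "x = 0")
      case False
      then have "x \<in> Units (scalars F)" using x F.field_Units by simp
      then obtain y where "y \<in> F" "y * x = 1" by (auto simp: Units_def)
      then show ?thesis by (metis inverse_unique mult.commute)
    qed (use x in simp)
  qed
qed

context real_subfield
begin

lemma coord_vectorspace:
  assumes "field (scalars F)"
  shows "vectorspace (scalars F) (coord_space F n)"
proof -
  interpret F: field "scalars F" by (rule assms)
  have group: "abelian_group (coord_space F n)"
  proof (rule abelian_groupI)
    fix x assume x: "x \<in> carrier (coord_space F n)"
    have "- x \<in> carrier (coord_space F n)" "- x + x = 0\<^sub>v n" using x by (auto simp: uminus_mem)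
    then show "\<exists>y\<in>carrier (coord_space F n). y \<oplus>\<^bsub>coord_space F n\<^esub> x = \<zero>\<^bsub>coord_space F n\<^esub>"
      unfolding coord_space_sel(2,3) by blast
  qed (auto simp: add_mem zero_mem comm_add_vec intro!: assoc_add_vec[where n = n])
  have "module (scalars F) (coord_space F n)"
    by (rule moduleI[OF F.is_cring group])
      (auto simp: mult_mem add_smult_distrib_vec smult_add_distrib_vec[where n = n] smult_smult_assoc)
  then show ?thesis using assms by (simp add: vectorspace_def)
qed

lemma coord_ordered_vectorspace:
  assumes "field (scalars F)"
  shows "ordered_vectorspace F (coord_space F n) (coord_cone F n)"
proof -
  interpret vectorspace "scalars F" "coord_space F n" by (rule coord_vectorspace[OF assms])
  have sub: "coord_cone F n \<subseteq> carrier (coord_space F n)" by (auto simp: coord_cone_def)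
  show ?thesis
  proof
    show "coord_cone F n \<subseteq> carrier (coord_space F n)" by (rule sub)
    show "coord_cone F n \<inter> {\<ominus>\<^bsub>coord_space F n\<^esub> x |x. x \<in> coord_cone F n} = {\<zero>\<^bsub>coord_space F n\<^esub>}"
    proof
      have z: "0\<^sub>v n \<in> coord_cone F n" by (auto simp: coord_cone_def zero_mem)
      have "0\<^sub>v n = \<ominus>\<^bsub>coord_space F n\<^esub> (0\<^sub>v n)"
        using M.minus_equality[of "0\<^sub>v n" "0\<^sub>v n"] by (simp add: zero_mem)
      with z show "{\<zero>\<^bsub>coord_space F n\<^esub>} \<subseteq> coord_cone F n \<inter> {\<ominus>\<^bsub>coord_space F n\<^esub> x |x. x \<in> coord_cone F n}"
        by auto
      show "coord_cone F n \<inter> {\<ominus>\<^bsub>coord_space F n\<^esub> x |x. x \<in> coord_cone F n} \<subseteq> {\<zero>\<^bsub>coord_space F n\<^esub>}"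
      proof
        fix y assume "y \<in> coord_cone F n \<inter> {\<ominus>\<^bsub>coord_space F n\<^esub> x |x. x \<in> coord_cone F n}"
        then obtain x where x: "x \<in> coord_cone F n" "y = \<ominus>\<^bsub>coord_space F n\<^esub> x" and y: "y \<in> coord_cone F n"
          by blast
        have "y + x = 0\<^sub>v n" using M.l_neg[of x] x sub by auto
        then have "y $ i + x $ i = 0" if "i < n" for i
          using that x(1) y by (metis (no_types, lifting) coord_cone_def carrier_vecD index_add_vec(1)
              index_zero_vec(1) mem_Collect_eq)
        then have "y $ i = 0" if "i < n" for i
          using that x(1) y unfolding coord_cone_def by (force simp: add_nonneg_eq_0_iff)
        then have "y = 0\<^sub>v n" using y by (auto simp: coord_cone_def)
        then show "y \<in> {\<zero>\<^bsub>coord_space F n\<^esub>}" by simp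
      qed
    qed
    show "x \<oplus>\<^bsub>coord_space F n\<^esub> y \<in> coord_cone F n" if "x \<in> coord_cone F n" "y \<in> coord_cone F n" for x y
      using that by (auto simp: coord_cone_def add_mem)
    show "c \<odot>\<^bsub>coord_space F n\<^esub> x \<in> coord_cone F n" if "c \<in> F \<inter> {0..}" "x \<in> coord_cone F n" for c x
      using that by (auto simp: coord_cone_def mult_mem)
  qed
qed

text \<open>Stated for arbitrary coefficients \<open>C\<close>, so that it identifies the space for
  \<open>C = F\<close> and the positive cone for \<open>C = Fpos\<close> with one and the same
  map.\<close>

lemma simplicial_chart:
  fixes T :: "'a::real_vector set"
  assumes T: "independent T" and h: "bij_betw h {..<n} T"
  defines "\<sigma> \<equiv> \<lambda>v. \<Sum>i<n. (v $ i) *\<^sub>R h i"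
  shows "inj_on \<sigma> (carrier_vec n)" "\<sigma> ` {v \<in> carrier_vec n. \<forall>i<n. v $ i \<in> C} = combos C T"
proof -
  have inj: "inj_on h {..<n}" and im: "h ` {..<n} = T" using h by (auto simp: bij_betw_def)
  have fin: "finite T" using im by (metis finite_imageI finite_lessThan)
  define g where "g = inv_into {..<n} h"
  have g: "g (h i) = i" if "i < n" for i using inj that by (simp add: g_def)
  have gT: "g t < n" "h (g t) = t" if "t \<in> T" for t
    using that im g by (metis imageE lessThan_iff)+
  have eq: "\<sigma> v = (\<Sum>t\<in>T. (v $ g t) *\<^sub>R t)" for v
    unfolding \<sigma>_def im[symmetric] by (subst sum.reindex[OF inj]) (auto intro!: sum.cong simp: g)
  have rep: "representation T (\<sigma> v) t = v $ g t" if "t \<in> T" for v t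
    unfolding eq by (rule representation_sum_coeff[OF fin T that])
  show "inj_on \<sigma> (carrier_vec n)"
  proof (rule inj_onI)
    fix v w :: "real vec" assume *: "v \<in> carrier_vec n" "w \<in> carrier_vec n" "\<sigma> v = \<sigma> w"
    have "v $ i = w $ i" if "i < n" for i
    proof -
      have "h i \<in> T" using that im by blast
      then show ?thesis using rep[of "h i" v] rep[of "h i" w] *(3) g[OF that] by simp
    qed
    then show "v = w" using * by (intro eq_vecI) auto
  qed
  show "\<sigma> ` {v \<in> carrier_vec n. \<forall>i<n. v $ i \<in> C} = combos C T"
  proof
    show "\<sigma> ` {v \<in> carrier_vec n. \<forall>i<n. v $ i \<in> C} \<subseteq> combos C T"
      unfolding eq using gT(1) by (auto intro!: combosI)
    show "combos C T \<subseteq> \<sigma> ` {v \<in> carrier_vec n. \<forall>i<n. v $ i \<in> C}"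
    proof
      fix x assume "x \<in> combos C T"
      then obtain c where c: "\<forall>t\<in>T. c t \<in> C" "x = (\<Sum>t\<in>T. c t *\<^sub>R t)" using combosE by metis
      let ?v = "vec n (\<lambda>i. c (h i))"
      have "\<sigma> ?v = x" unfolding eq c(2) using gT by (intro sum.cong) auto
      moreover have "?v \<in> {v \<in> carrier_vec n. \<forall>i<n. v $ i \<in> C}" using c(1) im by auto
      ultimately show "x \<in> \<sigma> ` {v \<in> carrier_vec n. \<forall>i<n. v $ i \<in> C}" by blast
    qed
  qed
qed

end

text \<open>The charts are isomorphisms of vector spaces, so the connecting maps are changes of
  chart and the limit is \<open>V\<close> again. Only the cones grow, and positivity of the
  connecting maps is exactly their monotonicity.\<close>

lemma limit_of_charts:
  fixes \<psi> :: "nat \<Rightarrow> real vec \<Rightarrow> 'v"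
  assumes V: "ordered_vectorspace F V P"
    and lin: "\<And>k. linear_map (scalars F) (coord_space F n) V (\<psi> k)"
    and bij: "\<And>k. bij_betw (\<psi> k) (carrier (coord_space F n)) (carrier V)"
    and mono: "\<And>k. \<psi> k ` coord_cone F n \<subseteq> \<psi> (Suc k) ` coord_cone F n"
    and union: "P = (\<Union>k. \<psi> k ` coord_cone F n)"
  shows "\<exists>\<phi> :: nat \<Rightarrow> nat \<Rightarrow> real vec \<Rightarrow> real vec.
    inductive_system F {1..} (\<lambda>_. coord_space F n) (\<lambda>_. coord_cone F n) \<phi> \<and>
    (\<exists>f. ordered_vs_iso F
      (limit_space {1..} (\<lambda>_. coord_space F n) \<phi>)
      (limit_cone {1..} (\<lambda>_. coord_space F n) (\<lambda>_. coord_cone F n) \<phi>) V P f)"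
proof -
  let ?E = "coord_space F n" and ?C = "coord_cone F n"
  have fld: "field (scalars F)"
    using ordered_vectorspace.axioms(1)[OF V] by (simp add: vectorspace_def)
  interpret real_subfield F by (rule real_subfield_of_field[OF fld])
  have ordE: "ordered_vectorspace F ?E ?C" by (rule coord_ordered_vectorspace[OF fld])
  have vsE: "vectorspace (scalars F) ?E" by (rule coord_vectorspace[OF fld])
  interpret E: vectorspace "scalars F" ?E by (rule vsE)
  have sub: "?C \<subseteq> carrier ?E" by (auto simp: coord_cone_def)
  have hom: "\<psi> k \<in> module_hom (scalars F) ?E V" for k
    using lin[of k] by (simp add: linear_map_def mod_hom_def mod_hom_axioms_def)
  have inj: "x = y" if "x \<in> carrier ?E" "y \<in> carrier ?E" "\<psi> k x = \<psi> k y" for k x y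
    using bij[of k] that unfolding bij_betw_def inj_on_def by blast
  have \<psi>V: "\<psi> k x \<in> carrier V" if "x \<in> carrier ?E" for k x
    by (rule funcset_mem[OF module_hom_closed[OF hom] that])
  have cone_mono: "\<psi> j ` ?C \<subseteq> \<psi> k ` ?C" if "j \<le> k" for j k
    using lift_Suc_mono_le[of "\<lambda>k. \<psi> k ` ?C", OF mono that] .
  \<comment> \<open>Change of chart, defined and linear for all \<open>j\<close> and
    \<open>k\<close>; it is positive for \<open>j \<le> k\<close>.\<close>
  define \<phi> where "\<phi> j k x = inv_into (carrier ?E) (\<psi> k) (\<psi> j x)" for j k x
  have \<phi>: "\<phi> j k x \<in> carrier ?E" "\<psi> k (\<phi> j k x) = \<psi> j x" if "x \<in> carrier ?E" for j k x
  proof -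
    have "\<psi> j x \<in> \<psi> k ` carrier ?E" using \<psi>V[OF that] bij[of k] by (simp add: bij_betw_def)
    then show "\<phi> j k x \<in> carrier ?E" "\<psi> k (\<phi> j k x) = \<psi> j x"
      unfolding \<phi>_def by (rule inv_into_into, rule f_inv_into_f)
  qed
  have \<phi>_eqI: "\<phi> j k x = y" if "x \<in> carrier ?E" "y \<in> carrier ?E" "\<psi> k y = \<psi> j x" for j k x y
    by (rule inj[of _ _ k, OF \<phi>(1)[OF that(1)] that(2)]) (simp only: \<phi>(2)[OF that(1)] that(3))
  have add: "\<psi> k (x \<oplus>\<^bsub>?E\<^esub> y) = \<psi> k x \<oplus>\<^bsub>V\<^esub> \<psi> k y" if "x \<in> carrier ?E" "y \<in> carrier ?E" for k x y
    by (rule module_hom_add[OF hom that])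
  have smult: "\<psi> k (c \<odot>\<^bsub>?E\<^esub> x) = c \<odot>\<^bsub>V\<^esub> \<psi> k x" if "c \<in> F" "x \<in> carrier ?E" for k c x
    using hom[of k] that by (simp add: module_hom_def del: coord_space_sel)
  have \<phi>_hom: "\<phi> j k \<in> module_hom (scalars F) ?E ?E" for j k
    unfolding module_hom_def
  proof (intro CollectI conjI allI impI Pi_I)
    show "\<phi> j k x \<in> carrier ?E" if "x \<in> carrier ?E" for x by (rule \<phi>(1)[OF that])
  next
    fix x y assume xy: "x \<in> carrier ?E \<and> y \<in> carrier ?E"
    show "\<phi> j k (x \<oplus>\<^bsub>?E\<^esub> y) = \<phi> j k x \<oplus>\<^bsub>?E\<^esub> \<phi> j k y"
      using xy \<phi> by (intro \<phi>_eqI E.M.add.m_closed) (simp_all add: add del: coord_space_sel)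
  next
    fix c x assume cx: "c \<in> carrier (scalars F) \<and> x \<in> carrier ?E"
    then have c: "c \<in> F" by simp
    show "\<phi> j k (c \<odot>\<^bsub>?E\<^esub> x) = c \<odot>\<^bsub>?E\<^esub> \<phi> j k x"
      using cx c \<phi> by (intro \<phi>_eqI E.smult_closed) (simp_all add: smult del: coord_space_sel)
  qed
  have \<phi>_lin: "linear_map (scalars F) ?E ?E (\<phi> j k)" for j k
    using \<phi>_hom[of j k] vsE by (simp add: linear_map_def mod_hom_def mod_hom_axioms_def vectorspace_def)
  have \<phi>_pos: "\<phi> j k x \<in> ?C" if jk: "j \<le> k" and x: "x \<in> ?C" for j k x
  proof -
    obtain y where y: "y \<in> ?C" "\<psi> j x = \<psi> k y" using cone_mono[OF jk] x by blast
    have "\<phi> j k x = y" by (rule \<phi>_eqI) (use x y sub in \<open>auto simp del: coord_space_sel\<close>)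
    then show ?thesis using y by simp
  qed
  interpret I: inductive_system F "{1::nat..}" "\<lambda>_. ?E" "\<lambda>_. ?C" \<phi>
  proof (rule inductive_system.intro)
    show "{1::nat..} \<noteq> {}" by simp
    show "\<exists>\<gamma>\<in>{1..}. \<alpha> \<le> \<gamma> \<and> \<beta> \<le> \<gamma>" if "\<alpha> \<in> {1..}" "\<beta> \<in> {1..}" for \<alpha> \<beta> :: nat
      using that by (intro bexI[of _ "max \<alpha> \<beta>"]) auto
    show "ordered_vectorspace F ?E ?C" by (rule ordE)
    show "positive_linear_map F ?E ?C ?E ?C (\<phi> \<alpha> \<beta>)" if "\<alpha> \<le> \<beta>" for \<alpha> \<beta>
      unfolding positive_linear_map_def positive_linear_map_axioms_def
      using ordE \<phi>_lin \<phi>_pos[OF that] by blast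
    show "\<phi> \<alpha> \<alpha> x = x" if "x \<in> carrier ?E" for \<alpha> x by (rule \<phi>_eqI[OF that that refl])
    show "\<phi> \<beta> \<gamma> (\<phi> \<alpha> \<beta> x) = \<phi> \<alpha> \<gamma> x" if "x \<in> carrier ?E" for \<alpha> \<beta> \<gamma> x
      by (rule \<phi>_eqI) (use \<phi> that in \<open>simp_all del: coord_space_sel\<close>)
  qed
  obtain g where g: "linear_map (scalars F) I.L V g"
    "\<And>\<alpha> x. \<alpha> \<in> {1..} \<Longrightarrow> x \<in> carrier ?E \<Longrightarrow> g (I.\<iota> \<alpha> x) = \<psi> \<alpha> x"
    using I.limit_universal[OF ordered_vectorspace.axioms(1)[OF V], of \<psi>] lin \<phi>(2) by blast
  have "bij_betw g (carrier I.L) (carrier V)"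
    unfolding bij_betw_def
  proof
    show "inj_on g (carrier I.L)"
    proof (rule inj_onI)
      fix X Y assume XY: "X \<in> carrier I.L" "Y \<in> carrier I.L" "g X = g Y"
      obtain \<alpha> x y where *: "\<alpha> \<in> {1..}" "x \<in> carrier ?E" "y \<in> carrier ?E" "X = I.\<iota> \<alpha> x" "Y = I.\<iota> \<alpha> y"
        using I.common_index2[OF XY(1,2)] .
      then have "x = y" using XY(3) g(2) by (intro inj[of x y \<alpha>]) simp_all
      then show "X = Y" using * by simp
    qed
    show "g ` carrier I.L = carrier V"
    proof
      show "g ` carrier I.L \<subseteq> carrier V" unfolding I.carrier_limit using g(2) \<psi>V by fastforce
      \<comment> \<open>Every chart is onto, so the image of a single stage already exhausts
        \<open>V\<close>.\<close>
      have "carrier V = \<psi> 1 ` carrier ?E" using bij[of 1] by (simp add: bij_betw_def)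
      also have "\<dots> = g ` I.\<iota> 1 ` carrier ?E" using g(2)[of 1] by (simp add: image_image del: coord_space_sel)
      also have "\<dots> \<subseteq> g ` carrier I.L" unfolding I.carrier_limit by (intro image_mono) auto
      finally show "carrier V \<subseteq> g ` carrier I.L" .
    qed
  qed
  moreover have "g ` limit_cone {1..} (\<lambda>_. ?E) (\<lambda>_. ?C) \<phi> = P"
  proof -
    have "g ` limit_cone {1..} (\<lambda>_. ?E) (\<lambda>_. ?C) \<phi> = (\<Union>\<alpha>\<in>{1..}. (\<lambda>x. g (I.\<iota> \<alpha> x)) ` ?C)"
      by (auto simp: limit_cone_def)
    also have "\<dots> = (\<Union>\<alpha>\<in>{1..}. \<psi> \<alpha> ` ?C)"
      using g(2) sub by (intro SUP_cong image_cong refl) auto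
    \<comment> \<open>The system starts at index 1 and the charts at 0; the cone of chart 0 is
      contained in that of chart 1, so the union is unchanged.\<close>
    also have "\<dots> = P"
      unfolding union using mono by fastforce
    finally show ?thesis .
  qed
  ultimately have "ordered_vs_iso F I.L (limit_cone {1..} (\<lambda>_. ?E) (\<lambda>_. ?C) \<phi>) V P g"
    using g(1) by (simp add: ordered_vs_iso_def)
  then show ?thesis using I.inductive_system_axioms by blast
qed

text \<open>Coordinates live in the finitely supported functions, since no type has the dimension \<open>n\<close>.\<close>

lemma lookup_scaleR: "Poly_Mapping.lookup (r *\<^sub>R a) v = r *\<^sub>R Poly_Mapping.lookup a v"
proof -
  have "finite {i. r *\<^sub>R Poly_Mapping.lookup a i \<noteq> 0}"
    by (rule finite_subset[OF _ finite_lookup[of a]]) auto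
  then show ?thesis by (simp add: scaleR_poly_mapping_def Abs_poly_mapping_inverse)
qed

lemma single_combination:
  fixes A :: "'v set"
  assumes "finite A"
  defines "s \<equiv> \<lambda>v. Poly_Mapping.single v (1::real)"
  shows "finite (s ` A)" "independent (s ` A)" "card (s ` A) = card A"
    "combos F (s ` A) = {a. (\<forall>v\<in>A. Poly_Mapping.lookup a v \<in> F) \<and> (\<forall>v. v \<notin> A \<longrightarrow> Poly_Mapping.lookup a v = 0)}"
proof -
  have inj: "inj_on s A"
    by (auto simp: inj_on_def s_def lookup_single when_def split: if_splits
        dest!: arg_cong[where f = Poly_Mapping.lookup] fun_cong)
  show fin: "finite (s ` A)" using assms(1) by simp
  show "card (s ` A) = card A" by (rule card_image[OF inj])
  have lookup: "Poly_Mapping.lookup (\<Sum>t\<in>s ` A. c t *\<^sub>R t) v = (if v \<in> A then c (s v) else 0)" for c v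
  proof -
    have "Poly_Mapping.lookup (\<Sum>t\<in>s ` A. c t *\<^sub>R t) v = (\<Sum>u\<in>A. Poly_Mapping.lookup (c (s u) *\<^sub>R s u) v)"
      by (simp add: sum.reindex[OF inj] lookup_sum)
    also have "\<dots> = (\<Sum>u\<in>A. if u = v then c (s u) else 0)"
      by (rule sum.cong) (auto simp: s_def lookup_single lookup_scaleR when_def)
    finally show ?thesis using assms(1) by simp
  qed
  show "independent (s ` A)"
  proof (rule real_vector.independent_if_scalars_zero[OF fin])
    fix f x assume "(\<Sum>x\<in>s ` A. f x *\<^sub>R x) = 0" "x \<in> s ` A"
    then obtain v where "v \<in> A" "x = s v" "(\<Sum>x\<in>s ` A. f x *\<^sub>R x) = 0" by blast
    then show "f x = 0" using lookup[of f v] by simp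
  qed
  show "combos F (s ` A) = {a. (\<forall>v\<in>A. Poly_Mapping.lookup a v \<in> F) \<and> (\<forall>v. v \<notin> A \<longrightarrow> Poly_Mapping.lookup a v = 0)}"
  proof (rule subset_antisym; rule subsetI)
    fix a assume "a \<in> combos F (s ` A)"
    then obtain c where c: "\<forall>t\<in>s ` A. c t \<in> F" "a = (\<Sum>t\<in>s ` A. c t *\<^sub>R t)"
      by (rule combosE)
    then have "\<And>v. Poly_Mapping.lookup a v = (if v \<in> A then c (s v) else 0)" by (simp only: lookup)
    then show "a \<in> {a. (\<forall>v\<in>A. Poly_Mapping.lookup a v \<in> F) \<and> (\<forall>v. v \<notin> A \<longrightarrow> Poly_Mapping.lookup a v = 0)}"
      using c(1) by simp
  next
    fix a assume a: "a \<in> {a. (\<forall>v\<in>A. Poly_Mapping.lookup a v \<in> F) \<and> (\<forall>v. v \<notin> A \<longrightarrow> Poly_Mapping.lookup a v = 0)}"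
    define c where "c t = Poly_Mapping.lookup a (inv_into A s t)" for t
    have c: "c (s v) = Poly_Mapping.lookup a v" if "v \<in> A" for v using inj that by (simp add: c_def)
    have "a = (\<Sum>t\<in>s ` A. c t *\<^sub>R t)"
      by (rule poly_mapping_eqI) (use lookup[of c] c a in auto)
    moreover have "(\<Sum>t\<in>s ` A. c t *\<^sub>R t) \<in> combos F (s ` A)" by (rule combosI) (use c a in auto)
    ultimately show "a \<in> combos F (s ` A)" by simp
  qed
qed

section \<open>Transport of an abstract ordered space to coordinates\<close>

lemma coordinate_isomorphism:
  fixes V :: "(real, 'v, 'm) module_scheme"
  assumes "vectorspace (scalars F) V" "vectorspace.fin_dim (scalars F) V"
  obtains B and \<tau> :: "('v \<Rightarrow>\<^sub>0 real) \<Rightarrow> 'v"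
  where "finite B" "independent B" "card B = vectorspace.dim (scalars F) V"
    "bij_betw \<tau> (combos F B) (carrier V)"
    "\<And>a b. a \<in> combos F B \<Longrightarrow> b \<in> combos F B \<Longrightarrow> \<tau> (a + b) = \<tau> a \<oplus>\<^bsub>V\<^esub> \<tau> b"
    "\<And>c a. c \<in> F \<Longrightarrow> a \<in> combos F B \<Longrightarrow> \<tau> (c *\<^sub>R a) = c \<odot>\<^bsub>V\<^esub> \<tau> a"
proof -
  interpret vectorspace "scalars F" V by (rule assms(1))
  obtain A where A: "finite A" "basis A" using finite_basis_exists[OF assms(2)] by blast
  have AV: "A \<subseteq> carrier V" using A(2) unfolding basis_def by blast
  \<comment> \<open>The unit vectors are indexed by the basis vectors of \<open>V\<close>
    themselves, so the coordinate function of an element serves directly as the coefficient function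
    of \<open>lincomb\<close>.\<close>
  define B where "B = (\<lambda>v. Poly_Mapping.single v (1::real)) ` A"
  note B = single_combination[OF A(1), folded B_def]
  define \<tau> where "\<tau> a = lincomb (Poly_Mapping.lookup a) A" for a
  have coeffs: "Poly_Mapping.lookup a \<in> A \<rightarrow> carrier (scalars F)" if "a \<in> combos F B" for a
    using that unfolding B(4) by auto
  have unique: "\<exists>!c. c \<in> A \<rightarrow>\<^sub>E carrier (scalars F) \<and> lincomb c A = v" if "v \<in> carrier V" for v
    using basis_criterion[OF A(1) AV] A(2) that by blast
  have restrict: "restrict (Poly_Mapping.lookup a) A \<in> A \<rightarrow>\<^sub>E carrier (scalars F)"
    "lincomb (restrict (Poly_Mapping.lookup a) A) A = \<tau> a" if "a \<in> combos F B" for a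
  proof -
    show "restrict (Poly_Mapping.lookup a) A \<in> A \<rightarrow>\<^sub>E carrier (scalars F)" using coeffs[OF that] by auto
    show "lincomb (restrict (Poly_Mapping.lookup a) A) A = \<tau> a"
      unfolding \<tau>_def by (rule lincomb_cong[OF refl AV]) (use coeffs[OF that] in auto)
  qed
  have \<tau>V: "\<tau> a \<in> carrier V" if "a \<in> combos F B" for a
    unfolding \<tau>_def by (rule lincomb_closed[OF AV coeffs[OF that]])
  have bij: "bij_betw \<tau> (combos F B) (carrier V)"
    unfolding bij_betw_def
  proof
    show "inj_on \<tau> (combos F B)"
    proof (rule inj_onI)
      fix a b assume ab: "a \<in> combos F B" "b \<in> combos F B" "\<tau> a = \<tau> b"
      have "restrict (Poly_Mapping.lookup a) A = restrict (Poly_Mapping.lookup b) A"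
        using unique[OF \<tau>V[OF ab(1)]] restrict[OF ab(1)] restrict[OF ab(2)] ab(3) by auto
      then have "Poly_Mapping.lookup a v = Poly_Mapping.lookup b v" for v
        using ab(1,2) unfolding B(4) by (cases "v \<in> A") (auto dest: fun_cong[of _ _ v])
      then show "a = b" by (rule poly_mapping_eqI)
    qed
    show "\<tau> ` combos F B = carrier V"
    proof
      show "\<tau> ` combos F B \<subseteq> carrier V" using \<tau>V by blast
      show "carrier V \<subseteq> \<tau> ` combos F B"
      proof
        fix v assume v: "v \<in> carrier V"
        obtain c where c: "c \<in> A \<rightarrow>\<^sub>E carrier (scalars F)" "lincomb c A = v" using unique[OF v] by blast
        define a where "a = Abs_poly_mapping (\<lambda>v. if v \<in> A then c v else 0)"
        have "finite {v. (if v \<in> A then c v else 0) \<noteq> 0}"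
          by (rule finite_subset[OF _ A(1)]) auto
        then have l: "Poly_Mapping.lookup a v = (if v \<in> A then c v else 0)" for v
          by (simp add: a_def Abs_poly_mapping_inverse)
        have aE: "a \<in> combos F B" unfolding B(4) using c(1) by (auto simp: l)
        have "\<tau> a = lincomb c A"
          unfolding \<tau>_def by (rule lincomb_cong[OF refl AV]) (use c(1) in \<open>auto simp: l\<close>)
        then have "v = \<tau> a" using c(2) by simp
        then show "v \<in> \<tau> ` combos F B" using aE by (rule image_eqI)
      qed
    qed
  qed
  show thesis
  proof (rule that[OF B(1,2) _ bij])
    show "card B = dim" using B(3) dim_basis[OF A] by simp
    show "\<tau> (a + b) = \<tau> a \<oplus>\<^bsub>V\<^esub> \<tau> b" if "a \<in> combos F B" "b \<in> combos F B" for a b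
    proof -
      have "Poly_Mapping.lookup (a + b) =
          (\<lambda>v. Poly_Mapping.lookup a v \<oplus>\<^bsub>scalars F\<^esub> Poly_Mapping.lookup b v)"
        by (simp add: fun_eq_iff lookup_add)
      then show ?thesis
        unfolding \<tau>_def using lincomb_sum[OF A(1) AV coeffs[OF that(1)] coeffs[OF that(2)]] by simp
    qed
    show "\<tau> (c *\<^sub>R a) = c \<odot>\<^bsub>V\<^esub> \<tau> a" if "c \<in> F" "a \<in> combos F B" for c a
    proof -
      have "Poly_Mapping.lookup (c *\<^sub>R a) = (\<lambda>v. c \<otimes>\<^bsub>scalars F\<^esub> Poly_Mapping.lookup a v)"
        by (simp add: fun_eq_iff lookup_scaleR)
      then show ?thesis
        unfolding \<tau>_def using lincomb_smult[OF AV coeffs[OF that(2)], of c] that(1) by simp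
    qed
  qed
qed

text \<open>The cone is pulled back to the coordinate model as \<open>P'\<close>. There
  interpolation supplies the decomposition property of \<open>riesz_cone\<close>, directedness the
  spanning hypothesis of \<open>increasing_bases\<close>, and the bases found yield charts by
  composition with \<open>\<tau>\<close>.\<close>

lemma simplicial_charts:
  fixes V :: "(real, 'v, 'm) module_scheme"
  assumes V: "ordered_vectorspace F V P" and fin: "vectorspace.fin_dim (scalars F) V"
    and dim: "vectorspace.dim (scalars F) V = n"
    and dir: "directed_order V P" and riesz: "riesz_interpolation V P"
  obtains \<psi> :: "nat \<Rightarrow> real vec \<Rightarrow> 'v"
  where "\<And>k. linear_map (scalars F) (coord_space F n) V (\<psi> k)"
    "\<And>k. bij_betw (\<psi> k) (carrier (coord_space F n)) (carrier V)"
    "\<And>k. \<psi> k ` coord_cone F n \<subseteq> \<psi> (Suc k) ` coord_cone F n"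
    "P = (\<Union>k. \<psi> k ` coord_cone F n)"
proof -
  interpret V: ordered_vectorspace F V P by (rule V)
  have fld: "field (scalars F)" using V.vectorspace_axioms by (simp add: vectorspace_def)
  interpret real_subfield F by (rule real_subfield_of_field[OF fld])
  obtain B and \<tau> :: "('v \<Rightarrow>\<^sub>0 real) \<Rightarrow> 'v" where B: "finite B" "independent B" "card B = n"
    and \<tau>: "bij_betw \<tau> (combos F B) (carrier V)"
    and add: "\<And>a b. a \<in> combos F B \<Longrightarrow> b \<in> combos F B \<Longrightarrow> \<tau> (a + b) = \<tau> a \<oplus>\<^bsub>V\<^esub> \<tau> b"
    and smult: "\<And>c a. c \<in> F \<Longrightarrow> a \<in> combos F B \<Longrightarrow> \<tau> (c *\<^sub>R a) = c \<odot>\<^bsub>V\<^esub> \<tau> a"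
    using coordinate_isomorphism[OF V.vectorspace_axioms fin] dim by metis
  define E where "E = combos F B"
  note E = F_subspaceD[OF F_subspace_combos[of B], folded E_def]
  note add = add[folded E_def] and smult = smult[folded E_def]
  have \<tau>V: "\<tau> a \<in> carrier V" if "a \<in> E" for a using \<tau> that by (auto simp: bij_betw_def E_def)
  have inj: "a = b" if "a \<in> E" "b \<in> E" "\<tau> a = \<tau> b" for a b
    using \<tau> that unfolding bij_betw_def inj_on_def E_def by blast
  have surj: "\<exists>a\<in>E. v = \<tau> a" if "v \<in> carrier V" for v using \<tau> that unfolding bij_betw_def E_def by blast
  have minus: "\<tau> (a - b) = \<tau> a \<ominus>\<^bsub>V\<^esub> \<tau> b" if "a \<in> E" "b \<in> E" for a b
  proof -
    have d: "a - b \<in> E" by (rule E(5)[OF that])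
    have "\<tau> a = \<tau> (a - b) \<oplus>\<^bsub>V\<^esub> \<tau> b" using add[OF d that(2)] by simp
    then show ?thesis
      using \<tau>V[OF d] \<tau>V[OF that(2)] by (simp add: V.M.minus_eq V.M.a_assoc V.M.r_neg)
  qed
  have zero: "\<tau> 0 = \<zero>\<^bsub>V\<^esub>" using minus[OF E(1,1)] \<tau>V[OF E(1)] by (simp add: V.M.minus_eq V.M.r_neg)
  define P' where "P' = {a \<in> E. \<tau> a \<in> P}"
  have zeroP: "\<zero>\<^bsub>V\<^esub> \<in> P" using V.cone_pointed by blast
  have P_eq: "P = \<tau> ` P'"
  proof
    show "P \<subseteq> \<tau> ` P'"
    proof
      fix v assume v: "v \<in> P"
      then obtain a where "a \<in> E" "v = \<tau> a" using surj V.cone_subset by blast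
      then show "v \<in> \<tau> ` P'" using v by (simp add: P'_def)
    qed
  qed (auto simp: P'_def)
  have le: "cone_le V P (\<tau> a) (\<tau> b) \<longleftrightarrow> b - a \<in> P'" if "a \<in> E" "b \<in> E" for a b
    using minus[OF that(2,1)] E(5)[OF that(2,1)] by (simp add: cone_le_def P'_def)
  interpret riesz_cone F B P'
  proof
    show "finite B" "independent B" by fact+
    show "P' \<subseteq> combos F B" by (auto simp: P'_def E_def)
    show "0 \<in> P'" using E(1) zero zeroP by (simp add: P'_def)
    show "x + y \<in> P'" if "x \<in> P'" "y \<in> P'" for x y
      using that E(2) add V.cone_add by (auto simp: P'_def)
    show "c *\<^sub>R x \<in> P'" if "c \<in> Fpos" "x \<in> P'" for c x
      using that E(3) smult V.cone_smult by (auto simp: P'_def)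
    show "x = 0" if "x \<in> P'" "- x \<in> P'" for x
    proof -
      have x: "x \<in> E" "\<tau> x \<in> P" "- x \<in> E" "\<tau> (- x) \<in> P" using that by (auto simp: P'_def)
      have "\<tau> x \<oplus>\<^bsub>V\<^esub> \<tau> (- x) = \<zero>\<^bsub>V\<^esub>" using add[OF x(1,3)] zero by simp
      then have "\<ominus>\<^bsub>V\<^esub> \<tau> (- x) = \<tau> x" using \<tau>V x by (intro V.M.minus_equality) auto
      then have "\<tau> x \<in> P \<inter> {\<ominus>\<^bsub>V\<^esub> x |x. x \<in> P}" using x(2,4) by force
      then have "\<tau> x = \<tau> 0" using V.cone_pointed zero by simp
      then show ?thesis by (rule inj[OF x(1) E(1)])
    qed
    show "\<exists>y' z'. x = y' + z' \<and> y' \<in> P' \<and> z' \<in> P' \<and> y - y' \<in> P' \<and> z - z' \<in> P'"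
      if xyz: "x \<in> P'" "y \<in> P'" "z \<in> P'" "y + z - x \<in> P'" for x y z
    proof -
      have mem: "x \<in> E" "y \<in> E" "z \<in> E" "x - z \<in> E" using xyz E(5) by (auto simp: P'_def)
      \<comment> \<open>Interpolating between 0, \<open>x - z\<close> below and \<open>x\<close>,
        \<open>y\<close> above gives \<open>b\<close>; then \<open>x = b + (x - b)\<close> is the
        required decomposition, the bound \<open>x - z\<close> being the condition that
        \<open>x - b\<close> lies below \<open>z\<close>.\<close>
      have ac: "\<forall>a\<in>{\<tau> 0, \<tau> (x - z)}. \<forall>c\<in>{\<tau> x, \<tau> y}. cone_le V P a c"
        using xyz le[OF E(1) mem(1)] le[OF E(1) mem(2)] le[OF mem(4,1)] le[OF mem(4,2)]
        by (simp add: algebra_simps)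
      obtain v where v: "v \<in> carrier V"
        "\<forall>a\<in>{\<tau> 0, \<tau> (x - z)}. \<forall>c\<in>{\<tau> x, \<tau> y}. cone_le V P a v \<and> cone_le V P v c"
        using riesz[unfolded riesz_interpolation_def, THEN bspec, OF \<tau>V[OF E(1)], THEN bspec,
            OF \<tau>V[OF mem(4)], THEN bspec, OF \<tau>V[OF mem(1)], THEN bspec, OF \<tau>V[OF mem(2)], THEN mp, OF ac]
        by (rule bexE)
      obtain b where b: "b \<in> E" "v = \<tau> b" using surj[OF v(1)] by blast
      have "b \<in> P'" "x - b \<in> P'" "y - b \<in> P'" "b - (x - z) \<in> P'"
      proof -
        have *: "cone_le V P (\<tau> 0) (\<tau> b)" "cone_le V P (\<tau> b) (\<tau> x)" "cone_le V P (\<tau> b) (\<tau> y)"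
          "cone_le V P (\<tau> (x - z)) (\<tau> b)" using v(2) unfolding b(2) by simp_all
        show "b \<in> P'" using le[OF E(1) b(1)] *(1) by (simp only: diff_zero)
        show "x - b \<in> P'" using le[OF b(1) mem(1)] *(2) by (simp only:)
        show "y - b \<in> P'" using le[OF b(1) mem(2)] *(3) by (simp only:)
        show "b - (x - z) \<in> P'" using le[OF mem(4) b(1)] *(4) by (simp only:)
      qed
      then show ?thesis by (intro exI[of _ b] exI[of _ "x - b"]) (simp add: algebra_simps)
    qed
  qed
  have "combos F B \<subseteq> span P'"
  proof
    fix x assume "x \<in> combos F B"
    then have x: "x \<in> E" by (simp add: E_def)
    obtain v where v: "v \<in> carrier V" "cone_le V P (\<tau> x) v" "cone_le V P (\<tau> 0) v"
      using dir[unfolded directed_order_def, THEN bspec, OF \<tau>V[OF x], THEN bspec, OF \<tau>V[OF E(1)]]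
      by blast
    obtain z where z: "z \<in> E" "v = \<tau> z" using surj[OF v(1)] by blast
    have "z - x \<in> P'" using v(2) le[OF x z(1)] unfolding z(2) by (simp only:)
    moreover have "z \<in> P'" using v(3) le[OF E(1) z(1)] unfolding z(2) by (simp only: diff_zero)
    \<comment> \<open>With \<open>z\<close> above both 0 and \<open>x\<close>, the vector
      \<open>x\<close> is a difference of two positive vectors.\<close>
    ultimately have "z - (z - x) \<in> span P'" by (intro span_diff span_base)
    then show "x \<in> span P'" by simp
  qed
  then obtain T where T: "\<And>k. T k \<subseteq> P'" "\<And>k. finite (T k)" "\<And>k. independent (T k)"
    "\<And>k. card (T k) = card B" "\<And>k. combos F (T k) = combos F B" "\<And>k. T k \<subseteq> combos Fpos (T (Suc k))"
    "\<And>x. x \<in> P' \<Longrightarrow> \<exists>k. x \<in> combos Fpos (T k)"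
    using increasing_bases by metis
  have "\<exists>h. bij_betw h {..<n} (T k)" for k
    using ex_bij_betw_nat_finite[OF T(2)[of k]] T(4) B(3) by (simp add: atLeast0LessThan)
  then obtain h where h: "\<And>k. bij_betw (h k) {..<n} (T k)" by metis
  define \<sigma> where "\<sigma> k v = (\<Sum>i<n. (v $ i) *\<^sub>R h k i)" for k v
  note chart = simplicial_chart[OF T(3) h, folded \<sigma>_def]
  have cone: "\<sigma> k ` coord_cone F n = combos Fpos (T k)" for k
    using chart(2)[of k Fpos] by (simp add: coord_cone_def)
  have \<sigma>E: "\<sigma> k ` carrier (coord_space F n) = E" for k
    using chart(2)[of k F] T(5) by (simp add: E_def)
  define \<psi> where "\<psi> k v = \<tau> (\<sigma> k v)" for k v
  have \<sigma>_mem: "\<sigma> k v \<in> E" if "v \<in> carrier (coord_space F n)" for k v using \<sigma>E that by blast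
  show thesis
  proof (rule that[of \<psi>])
    show "bij_betw (\<psi> k) (carrier (coord_space F n)) (carrier V)" for k
    proof -
      have "bij_betw (\<sigma> k) (carrier (coord_space F n)) E"
        unfolding bij_betw_def using \<sigma>E chart(1)[of k] by (auto intro: inj_on_subset)
      moreover have "\<psi> k = \<tau> \<circ> \<sigma> k" by (simp add: \<psi>_def fun_eq_iff)
      ultimately show ?thesis using bij_betw_trans \<tau>[folded E_def] by simp
    qed
    show "linear_map (scalars F) (coord_space F n) V (\<psi> k)" for k
    proof -
      have "\<psi> k \<in> module_hom (scalars F) (coord_space F n) V"
        unfolding module_hom_def
      proof (intro CollectI conjI allI impI Pi_I)
        show "\<psi> k v \<in> carrier V" if "v \<in> carrier (coord_space F n)" for v
          using \<tau>V[OF \<sigma>_mem[OF that]] by (simp add: \<psi>_def)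
      next
        fix v w assume vw: "v \<in> carrier (coord_space F n) \<and> w \<in> carrier (coord_space F n)"
        then have "\<sigma> k (v + w) = \<sigma> k v + \<sigma> k w"
          by (auto simp: \<sigma>_def scaleR_add_left sum.distrib)
        then show "\<psi> k (v \<oplus>\<^bsub>coord_space F n\<^esub> w) = \<psi> k v \<oplus>\<^bsub>V\<^esub> \<psi> k w"
          using add \<sigma>_mem vw by (simp add: \<psi>_def)
      next
        fix c v assume cv: "c \<in> carrier (scalars F) \<and> v \<in> carrier (coord_space F n)"
        then have "\<sigma> k (c \<cdot>\<^sub>v v) = c *\<^sub>R \<sigma> k v"
          by (auto simp: \<sigma>_def scaleR_sum_right)
        then show "\<psi> k (c \<odot>\<^bsub>coord_space F n\<^esub> v) = c \<odot>\<^bsub>V\<^esub> \<psi> k v"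
          using smult \<sigma>_mem cv by (simp add: \<psi>_def)
      qed
      then show ?thesis
        using coord_vectorspace[OF fld, of n] V.vectorspace_axioms
        by (simp add: linear_map_def mod_hom_def mod_hom_axioms_def vectorspace_def)
    qed
    have im: "\<psi> k ` coord_cone F n = \<tau> ` combos Fpos (T k)" for k
      unfolding cone[symmetric] image_image \<psi>_def ..
    show "\<psi> k ` coord_cone F n \<subseteq> \<psi> (Suc k) ` coord_cone F n" for k
      unfolding im by (intro image_mono combos_cone_least T)
    have sub: "combos Fpos (T k) \<subseteq> P'" for k
      by (rule combos_leastI) (use T(1) in \<open>auto intro: zero_P add_P scale_P\<close>)
    have "P' = (\<Union>k. combos Fpos (T k))"
    proof
      show "P' \<subseteq> (\<Union>k. combos Fpos (T k))"
      proof
        fix x assume "x \<in> P'"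
        then obtain k where "x \<in> combos Fpos (T k)" using T(7) by blast
        then show "x \<in> (\<Union>k. combos Fpos (T k))" by (rule UN_I[OF UNIV_I])
      qed
    qed (rule UN_least[OF sub])
    then show "P = (\<Union>k. \<psi> k ` coord_cone F n)" unfolding im P_eq image_UN[symmetric] by (rule arg_cong)
  qed
qed

theorem theorem1p1:
  fixes F :: "real set" and n :: nat
    and V :: "(real, 'v, 'm) module_scheme" and P :: "'v set"
  assumes "subfield F class_ring"
    and "ordered_vectorspace F V P"
    and "vectorspace.fin_dim (scalars F) V"
    and "vectorspace.dim (scalars F) V = n"
    and "directed_order V P"
    and "riesz_interpolation V P"
  shows "\<exists>\<phi> :: nat \<Rightarrow> nat \<Rightarrow> real vec \<Rightarrow> real vec.
    inductive_system F {1..} (\<lambda>_. coord_space F n) (\<lambda>_. coord_cone F n) \<phi> \<and>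
    (\<exists>f. ordered_vs_iso F
      (limit_space {1..} (\<lambda>_. coord_space F n) \<phi>)
      (limit_cone {1..} (\<lambda>_. coord_space F n) (\<lambda>_. coord_cone F n) \<phi>) V P f)"
proof -
  obtain \<psi> :: "nat \<Rightarrow> real vec \<Rightarrow> 'v"
    where "\<And>k. linear_map (scalars F) (coord_space F n) V (\<psi> k)"
      "\<And>k. bij_betw (\<psi> k) (carrier (coord_space F n)) (carrier V)"
      "\<And>k. \<psi> k ` coord_cone F n \<subseteq> \<psi> (Suc k) ` coord_cone F n"
      "P = (\<Union>k. \<psi> k ` coord_cone F n)"
    using simplicial_charts[OF assms(2-6)] by blast
  then show ?thesis by (rule limit_of_charts[OF assms(2)])
qed

end
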